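(* Let $G=(W,B)$ be a finite simple connected bipartite graph with bipartition $W,B$, with $\nu$ vertices, and let $M$ be a perfect matching of $G$. Suppose that for every pair of vertices $w\in W$ and $b\in B$ that are nonadjacent, we have $d(w)+d(b)\ge \nu/2+1$. Then $G$ has an $M$-alternating Hamilton cycle, unless one of the following holds (up to isomorphism): (1) $G\in\mathcal{G}_1$ and $M\in\mathcal{M}_1$; (2) $G\in\mathcal{G}_2$ and $M\in\mathcal{M}_2$; (3) $G\in\mathcal{G}_3$ and $M\in\mathcal{M}_3$; (4) $G=G_4$ and $M=M_4$; where these exceptional graphs and matchings are defined in the context.
   Context: $\nu$ is the number of vertices of $G$ and $d(u)$ the degree of $u$. For a matching $M$, an $M$-alternating cycle is a cycle whose edges are alternately in $M$ and in $E(G)\setminus M$; it is Hamilton if it passes through all vertices of $G$. $kK_2$ denotes a graph consisting of $k$ independent edges. In each case below, the membership of $G$ and $M$ refers to the same construction of $G$. $\mathcal{G}_1,\mathcal{M}_1$: $\mathcal{G}_1$ is the class of graphs $G$ constructed, for some integers $m,n\ge1$, by identifying an edge of one $K_{m+1,m+1}$ with an edge of one $K_{n+1,n+1}$; $\mathcal{M}_1$ is the set of all perfect matchings of $G$ containing the identified edge. $\mathcal{G}_2,\mathcal{M}_2$: $\mathcal{G}_2$ is the class of graphs $G$ constructed, for some integer $n\ge1$, by taking a copy of $(n+1)K_2$ with bipartition $(B',W')$ and a disjoint arbitrary bipartite graph $G_2$ (not necessarily connected) with bipartition $(B_1,W_1)$, $|B_1|=|W_1|=n$, which has at least one perfect matching,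 then connecting every vertex in $B'$ to every vertex in $W_1$, and every vertex in $W'$ to every vertex in $B_1$. $\mathcal{M}_2$ is the set of all perfect matchings of $G$ containing all the edges of $(n+1)K_2$. $\mathcal{G}_3,\mathcal{M}_3$: let $G_3$ be the bipartite graph with parts $\{w_0,w_1,w_2,w_3\}$ and $\{b_0,b_1,b_2,b_3\}$ and edges $w_0b_0,\ w_1b_1,\ w_2b_2,\ w_3b_3,\ w_2b_3,\ w_3b_2,\ w_0b_3,\ w_1b_2,\ w_2b_0,\ w_3b_1$. $\mathcal{G}_3$ is the set of graphs $G$ constructed, for some integer $n\ge1$, from $G_3$ and a disjoint copy of $K_{n,n}$ with bipartition $(B'',W'')$ by connecting every vertex in $B''$ to $w_0$ and $w_1$, every vertex in $W''$ to $b_0$ and $b_1$, and possibly adding any of the edges $w_0b_1$, $w_1b_0$, or both. $\mathcal{M}_3$ is the set of perfect matchings of $G$ containing the four edges $w_0b_0,w_1b_1,w_2b_2,w_3b_3$. $G_4,M_4$: let $X=\{h,c_1,c_2,c_3,t_1,t_2,t_3\}$ (indices modulo $3$), and let $A$ be the set consisting of the following $21$ ordered pairs: $(h,c_i)$ and $(c_i,h)$ for $i=1,2,3$; $(c_i,c_{i+1})$ for $i=1,2,3$; $(t_i,t_j)$ for all $i\ne j$; $(t_i,c_i)$ for $i=1,2,3$; $(c_i,t_{i+1})$ for $i=1,2,3$. $G_4$ is the bipartite graph with parts $\{w_x:x\in X\}$ and $\{b_x:x\in X\}$ (14 vertices) whose edges are $w_xb_x$ for $x\in X$ and $w_xb_y$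 for $(x,y)\in A$; $M_4=\{w_xb_x:x\in X\}$.
   Formalization: The graph G is additionally assumed to have more than 2 vertices, which excludes exactly G = K_2, where the degree condition is vacuous but there is no cycle and none of the exceptional cases (1)-(4) applies. *)

theory Defs
  imports Complex_Main
begin

text \<open>A finite simple graph is given by its vertex set and its set of edges, an edge being the
  two-element set of its endpoints.\<close>

definition complete_bip :: "'a set \<Rightarrow> 'a set \<Rightarrow> 'a set set" where
  "complete_bip X Y = {{x, y} |x y. x \<in> X \<and> y \<in> Y}"

definition bipartite_graph :: "'a set \<Rightarrow> 'a set \<Rightarrow> 'a set set \<Rightarrow> bool" where
  "bipartite_graph W B E \<longleftrightarrow> finite W \<and> finite B \<and> W \<inter> B = {} \<and> E \<subseteq> complete_bip W B"

definition connected_graph :: "'a set \<Rightarrow> 'a set set \<Rightarrow> bool" where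
  "connected_graph V E \<longleftrightarrow> V \<noteq> {} \<and> (\<forall>u\<in>V. \<forall>v\<in>V. (u, v) \<in> {(x, y). {x, y} \<in> E}\<^sup>*)"

definition degree :: "'a set set \<Rightarrow> 'a \<Rightarrow> nat" where
  "degree E v = card {e \<in> E. v \<in> e}"

definition perfect_matching :: "'a set \<Rightarrow> 'a set set \<Rightarrow> 'a set set \<Rightarrow> bool" where
  "perfect_matching V E M \<longleftrightarrow> M \<subseteq> E \<and> (\<forall>v\<in>V. \<exists>!e. e \<in> M \<and> v \<in> e)"

text \<open>A cycle is the cyclic sequence of its (at least three, pairwise distinct) vertices;
  \<open>cycle_edge p i\<close> is its \<open>i\<close>-th edge, with indices modulo \<open>length p\<close>.\<close>

definition cycle_edge :: "'a list \<Rightarrow> nat \<Rightarrow> 'a set" where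
  "cycle_edge p i = {p ! (i mod length p), p ! (Suc i mod length p)}"

definition is_cycle :: "'a set set \<Rightarrow> 'a list \<Rightarrow> bool" where
  "is_cycle E p \<longleftrightarrow> 3 \<le> length p \<and> distinct p \<and> (\<forall>i<length p. cycle_edge p i \<in> E)"

definition alternating_cycle :: "'a set set \<Rightarrow> 'a set set \<Rightarrow> 'a list \<Rightarrow> bool" where
  "alternating_cycle E M p \<longleftrightarrow>
     is_cycle E p \<and> (\<forall>i<length p. cycle_edge p i \<in> M \<longleftrightarrow> cycle_edge p (Suc i) \<notin> M)"

definition has_alternating_Hamilton_cycle :: "'a set \<Rightarrow> 'a set set \<Rightarrow> 'a set set \<Rightarrow> bool" where
  "has_alternating_Hamilton_cycle V E M \<longleftrightarrow> (\<exists>p. alternating_cycle E M p \<and> set p = V)"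

text \<open>\<open>class1 V E M\<close>, \<open>class2 V E M\<close>, \<open>class3 V E M\<close> say that the graph \<open>(V, E)\<close> arises from the
  respective construction carried out on vertices of the type \<open>'a\<close>, and that \<open>M\<close> is one of the
  matchings associated with that construction. The vertices used by the construction are
  arbitrary, so these predicates are invariant under isomorphism.

  In \<open>class1\<close>, identifying an edge of one complete bipartite graph with an edge of the other
  means that the two graphs have exactly the endpoints \<open>x\<close>, \<open>y\<close> of the edge in common.\<close>

definition class1 :: "'a set \<Rightarrow> 'a set set \<Rightarrow> 'a set set \<Rightarrow> bool" where
  "class1 V E M \<longleftrightarrow>
     (\<exists>m n X\<^sub>1 Y\<^sub>1 X\<^sub>2 Y\<^sub>2 x y. 1 \<le> m \<and> 1 \<le> n \<and>
        card X\<^sub>1 = m + 1 \<and> card Y\<^sub>1 = m + 1 \<and> card X\<^sub>2 = n + 1 \<and> card Y\<^sub>2 = n + 1 \<and>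
        X\<^sub>1 \<inter> X\<^sub>2 = {x} \<and> Y\<^sub>1 \<inter> Y\<^sub>2 = {y} \<and> (X\<^sub>1 \<union> X\<^sub>2) \<inter> (Y\<^sub>1 \<union> Y\<^sub>2) = {} \<and>
        V = X\<^sub>1 \<union> X\<^sub>2 \<union> Y\<^sub>1 \<union> Y\<^sub>2 \<and>
        E = complete_bip X\<^sub>1 Y\<^sub>1 \<union> complete_bip X\<^sub>2 Y\<^sub>2 \<and>
        perfect_matching V E M \<and> {x, y} \<in> M)"

text \<open>In \<open>class2\<close>, the edges of \<open>(n + 1)K\<^sub>2\<close> join each \<open>b \<in> B'\<close> to \<open>f b \<in> W'\<close>.\<close>

definition class2 :: "'a set \<Rightarrow> 'a set set \<Rightarrow> 'a set set \<Rightarrow> bool" where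
  "class2 V E M \<longleftrightarrow>
     (\<exists>n B' W' f K B\<^sub>1 W\<^sub>1 E\<^sub>2. 1 \<le> n \<and>
        card B' = n + 1 \<and> card W' = n + 1 \<and> B' \<inter> W' = {} \<and>
        bij_betw f B' W' \<and> K = {{b, f b} |b. b \<in> B'} \<and>
        card B\<^sub>1 = n \<and> card W\<^sub>1 = n \<and> bipartite_graph B\<^sub>1 W\<^sub>1 E\<^sub>2 \<and>
        (\<exists>M\<^sub>2. perfect_matching (B\<^sub>1 \<union> W\<^sub>1) E\<^sub>2 M\<^sub>2) \<and>
        (B' \<union> W') \<inter> (B\<^sub>1 \<union> W\<^sub>1) = {} \<and>
        V = B' \<union> W' \<union> B\<^sub>1 \<union> W\<^sub>1 \<and>
        E = K \<union> E\<^sub>2 \<union> complete_bip B' W\<^sub>1 \<union> complete_bip W' B\<^sub>1 \<and>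
        perfect_matching V E M \<and> K \<subseteq> M)"

definition class3 :: "'a set \<Rightarrow> 'a set set \<Rightarrow> 'a set set \<Rightarrow> bool" where
  "class3 V E M \<longleftrightarrow>
     (\<exists>n w\<^sub>0 w\<^sub>1 w\<^sub>2 w\<^sub>3 b\<^sub>0 b\<^sub>1 b\<^sub>2 b\<^sub>3 B'' W'' F. 1 \<le> n \<and>
        distinct [w\<^sub>0, w\<^sub>1, w\<^sub>2, w\<^sub>3, b\<^sub>0, b\<^sub>1, b\<^sub>2, b\<^sub>3] \<and>
        card B'' = n \<and> card W'' = n \<and> B'' \<inter> W'' = {} \<and>
        {w\<^sub>0, w\<^sub>1, w\<^sub>2, w\<^sub>3, b\<^sub>0, b\<^sub>1, b\<^sub>2, b\<^sub>3} \<inter> (B'' \<union> W'') = {} \<and>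
        F \<subseteq> {{w\<^sub>0, b\<^sub>1}, {w\<^sub>1, b\<^sub>0}} \<and>
        V = {w\<^sub>0, w\<^sub>1, w\<^sub>2, w\<^sub>3, b\<^sub>0, b\<^sub>1, b\<^sub>2, b\<^sub>3} \<union> B'' \<union> W'' \<and>
        E = {{w\<^sub>0, b\<^sub>0}, {w\<^sub>1, b\<^sub>1}, {w\<^sub>2, b\<^sub>2}, {w\<^sub>3, b\<^sub>3}, {w\<^sub>2, b\<^sub>3}, {w\<^sub>3, b\<^sub>2},
             {w\<^sub>0, b\<^sub>3}, {w\<^sub>1, b\<^sub>2}, {w\<^sub>2, b\<^sub>0}, {w\<^sub>3, b\<^sub>1}}
            \<union> complete_bip B'' W'' \<union> complete_bip B'' {w\<^sub>0, w\<^sub>1} \<union> complete_bip W'' {b\<^sub>0, b\<^sub>1} \<union> F \<and>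
        perfect_matching V E M \<and>
        {{w\<^sub>0, b\<^sub>0}, {w\<^sub>1, b\<^sub>1}, {w\<^sub>2, b\<^sub>2}, {w\<^sub>3, b\<^sub>3}} \<subseteq> M)"

text \<open>The graph \<open>G\<^sub>4\<close> with its matching \<open>M\<^sub>4\<close>: the vertex \<open>w\<^sub>x\<close> is \<open>Inl x\<close> and the vertex \<open>b\<^sub>x\<close> is
  \<open>Inr x\<close>. The type of labels has infinitely many elements; only those in \<open>X\<^sub>4\<close> are used.\<close>

datatype label = H | C nat | T nat

definition X\<^sub>4 :: "label set" where
  "X\<^sub>4 = {H, C 1, C 2, C 3, T 1, T 2, T 3}"

definition next3 :: "nat \<Rightarrow> nat" where
  "next3 i = i mod 3 + 1"

definition A\<^sub>4 :: "(label \<times> label) set" where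
  "A\<^sub>4 = {(H, C i) |i. i \<in> {1, 2, 3}} \<union> {(C i, H) |i. i \<in> {1, 2, 3}}
      \<union> {(C i, C (next3 i)) |i. i \<in> {1, 2, 3}}
      \<union> {(T i, T j) |i j. i \<in> {1, 2, 3} \<and> j \<in> {1, 2, 3} \<and> i \<noteq> j}
      \<union> {(T i, C i) |i. i \<in> {1, 2, 3}}
      \<union> {(C i, T (next3 i)) |i. i \<in> {1, 2, 3}}"

definition V\<^sub>4 :: "(label + label) set" where
  "V\<^sub>4 = Inl ` X\<^sub>4 \<union> Inr ` X\<^sub>4"

definition M\<^sub>4 :: "(label + label) set set" where
  "M\<^sub>4 = {{Inl x, Inr x} |x. x \<in> X\<^sub>4}"

definition E\<^sub>4 :: "(label + label) set set" where
  "E\<^sub>4 = M\<^sub>4 \<union> {{Inl x, Inr y} |x y. (x, y) \<in> A\<^sub>4}"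

text \<open>Isomorphism of graphs that carries one distinguished set of edges onto the other.\<close>

definition matched_graph_iso ::
  "'a set \<Rightarrow> 'a set set \<Rightarrow> 'a set set \<Rightarrow> 'b set \<Rightarrow> 'b set set \<Rightarrow> 'b set set \<Rightarrow> bool" where
  "matched_graph_iso V E M V' E' M' \<longleftrightarrow>
     (\<exists>f. bij_betw f V V' \<and> (`) f ` E = E' \<and> (`) f ` M = M')"

end

theory Submission
  imports Defs
begin

text \<open>
  Contract every edge \<open>w b\<close> of \<open>M\<close> to one vertex. An arc leads from \<open>x\<close> to \<open>y\<close> if the white
  end of \<open>x\<close> is adjacent to the black end of \<open>y\<close>; \<open>M\<close>-alternating Hamilton cycles are then the
  Hamilton cycles of a digraph on \<open>N\<close> vertices with \<open>d\<^sup>+(x) + d\<^sup>-(y) \<ge> N - 1\<close> for all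
  distinct \<open>x\<close>, \<open>y\<close> such that \<open>x y\<close> is not an arc.

  Take a longest cycle and the set \<open>R\<close> of the vertices off it. Choosing two vertices of the cycle
  attached to \<open>R\<close> with as short a gap \<open>S\<close> as possible, one finds that all estimates are
  tight: \<open>S\<close> and \<open>R\<close> are cliques without arcs between them, and each of their vertices is met
  by consecutive vertices \<open>x\<close>, \<open>y\<close> of the rest \<open>Q\<close> of the cycle in exactly one of the two
  possible ways, an arc from \<open>x\<close> or an arc to \<open>y\<close>. If \<open>Q\<close> is a single vertex, this is the first
  class; if \<open>S\<close> has at least two vertices, counting leaves only the third class. Otherwise \<open>R\<close>
  is a single vertex \<open>w\<close>, and the alternative above holds all around each cycle that misses
  just one vertex. If \<open>w\<close> has a neighbour joined to it in one direction only, comparing \<open>w\<close> with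
  a cycle vertex that is not adjacent to it determines so many arcs that there is a cycle, missing
  some other vertex, along which neighbours in both directions and non-neighbours of the missing
  vertex alternate. In that case the non-neighbours are independent, which is the second class, or
  form a clique, which leaves at most seven vertices: the third class with \<open>n = 1\<close>, or the digraph
  of \<open>G\<^sub>4\<close>.
\<close>

text \<open>Why all estimates are tight: a vertex that cannot be inserted into a path with q
  vertices is attached at most once per gap, so its arcs to and from the path number at most q + 1.
  For nonadjacent s in \<open>S\<close> and u in \<open>R\<close>, these bounds and the largest
  possible degrees inside \<open>S\<close> and \<open>R\<close> add up to exactly what the degree
  condition demands in both directions together. Equality turns adjacency into 0-1 words: either the
  i-th path vertex has an arc to u, or u has one to the next vertex. Each path vertex thus carries
  two labels, one for each clique; every excluded Hamilton cycle restricts the words, and every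
  label yields a lower degree bound through the condition against a clique vertex. The obstacle is
  the single missed vertex: a gap of one vertex cannot be shortened, so minimality says nothing
  more. Its substitute is that the alternation holds for every cycle missing any one vertex; the
  missed vertex can be exchanged for one not adjacent to it and all hypotheses survive.\<close>

section \<open>Counting along lists without forbidden consecutive pairs\<close>

lemma successivelyI:
  assumes "\<And>ps x y qs. xs = ps @ x # y # qs \<Longrightarrow> P x y"
  shows "successively P xs"
  using assms
proof (induction P xs rule: successively.induct)
  case (3 P x y xs)
  have "P x y" using 3(2)[of "[]"] by simp
  moreover have "successively P (y # xs)"
    by (rule 3(1)) (metis 3(2) append_Cons)
  ultimately show ?case by simp
qed auto

lemma successively_splitD: "successively P (ps @ x # y # qs) \<Longrightarrow> P x y"
  by (simp add: successively_append_iff)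

text \<open>Charge each \<open>P\<close>-entry to the gap after it and each \<open>Q\<close>-entry
  to the gap before it. Every gap is charged at most once, and only a \<open>Q\<close> at the head
  and a \<open>P\<close> at the end have no gap to be charged to.\<close>

lemma length_filter_adjacent:
  assumes "xs \<noteq> []" "successively (\<lambda>x y. \<not> (P x \<and> Q y)) xs"
  shows "length (filter P xs) + length (filter Q xs) + 1
    \<le> length xs + of_bool (Q (hd xs)) + of_bool (P (last xs))"
  using assms by (induction xs rule: induct_list012) (auto split: if_splits)

text \<open>Equality in the preceding bound means that every gap is charged.\<close>

lemma successively_xor_aux:
  assumes "xs \<noteq> []" "successively (\<lambda>x y. \<not> (P x \<and> Q y)) xs"
    and "length (filter P xs) + length (filter Q xs) + 1
      = length xs + of_bool (Q (hd xs)) + of_bool (P (last xs))"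
  shows "successively (\<lambda>x y. P x \<noteq> Q y) xs"
  using assms
proof (induction xs rule: induct_list012)
  case (3 x y zs)
  have s: "successively (\<lambda>x y. \<not> (P x \<and> Q y)) (y # zs)" and n: "\<not> (P x \<and> Q y)"
    using 3(4) by auto
  have "length (filter P (y # zs)) + length (filter Q (y # zs)) + 1
    \<le> length (y # zs) + of_bool (Q y) + of_bool (P (last (y # zs)))"
    using length_filter_adjacent[OF _ s] by simp
  then have "P x \<noteq> Q y" "length (filter P (y # zs)) + length (filter Q (y # zs)) + 1
    = length (y # zs) + of_bool (Q (hd (y # zs))) + of_bool (P (last (y # zs)))"
    using 3(5) n by (auto split: if_splits)
  then show ?case using 3(2)[OF _ s] by simp
qed auto

text \<open>The end terms contribute at most 2, so a count above the length forces both of them and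
  equality.\<close>

lemma successively_xor_of_length_filter:
  assumes "xs \<noteq> []" "successively (\<lambda>x y. \<not> (P x \<and> Q y)) xs"
    and "length xs + 1 \<le> length (filter P xs) + length (filter Q xs)"
  shows "Q (hd xs) \<and> P (last xs) \<and> successively (\<lambda>x y. P x \<noteq> Q y) xs"
proof -
  have h: "Q (hd xs)" "P (last xs)"
    using length_filter_adjacent[OF assms(1,2)] assms(3)
    by (cases "Q (hd xs)"; cases "P (last xs)"; simp)+
  then have "length (filter P xs) + length (filter Q xs) + 1
      = length xs + of_bool (Q (hd xs)) + of_bool (P (last xs))"
    using length_filter_adjacent[OF assms(1,2)] assms(3) by simp
  with h show ?thesis using successively_xor_aux[OF assms(1,2)] by blast
qed

lemma length_filter_eq_card: "distinct xs \<Longrightarrow> length (filter P xs) = card {x \<in> set xs. P x}"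
  by (metis distinct_card distinct_filter set_filter)

lemma successively_nth_mod:
  assumes "successively P c" "P (last c) (hd c)" "c \<noteq> []"
  shows "P (c ! (i mod length c)) (c ! (Suc i mod length c))"
proof (cases "Suc (i mod length c) = length c")
  case True
  then have "i mod length c = length c - 1" "Suc i mod length c = 0" by (simp_all add: mod_Suc)
  then show ?thesis using assms(2,3) by (simp add: last_conv_nth hd_conv_nth)
next
  case False
  then have "Suc (i mod length c) < length c" using assms(3) by (metis Suc_lessI length_greater_0_conv mod_less_divisor)
  then show ?thesis using assms(1) False by (simp add: successively_conv_nth mod_Suc)
qed

lemma card_Collect_split:
  assumes "\<And>z. P z \<Longrightarrow> z \<in> X \<union> Y" "finite X" "finite Y" "X \<inter> Y = {}"
  shows "card {z. P z} = card {z \<in> X. P z} + card {z \<in> Y. P z}"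
proof -
  have "card {z. P z} = card ({z \<in> X. P z} \<union> {z \<in> Y. P z})"
    using assms(1) by (intro arg_cong[where f = card]) auto
  also have "\<dots> = card {z \<in> X. P z} + card {z \<in> Y. P z}"
    by (rule card_Un_disjoint) (use assms in auto)
  finally show ?thesis .
qed

lemma card_Collect_le:
  assumes "\<And>z. P z \<Longrightarrow> z \<in> X \<or> z \<in> Y \<and> z \<noteq> x" "finite X" "finite Y"
  shows "card {z. P z} \<le> card {z \<in> X. P z} + card (Y - {x})"
proof -
  have "card {z. P z} \<le> card ({z \<in> X. P z} \<union> (Y - {x}))"
    by (rule card_mono) (use assms in auto)
  also have "\<dots> \<le> card {z \<in> X. P z} + card (Y - {x})" by (rule card_Un_le)
  finally show ?thesis .
qed

lemma length_filter_xor: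
  assumes "xs \<noteq> []" "successively (\<lambda>x y. P x \<noteq> Q y) xs"
  shows "length (filter P xs) + length (filter Q xs) + 1
    = length xs + of_bool (Q (hd xs)) + of_bool (P (last xs))"
  using assms by (induction xs rule: induct_list012) (auto split: if_splits)

text \<open>Configurations below number path vertices from 1, lists from 0; this and the next lemma
  carry out the shift.\<close>

lemma image_nth_pred: "(\<lambda>i. Q ! (i - 1)) ` {1..length Q} = set Q"
proof (intro equalityI subsetI)
  fix x assume "x \<in> set Q"
  then obtain i where "i < length Q" "x = Q ! i" by (auto simp: in_set_conv_nth)
  then show "x \<in> (\<lambda>i. Q ! (i - 1)) ` {1..length Q}" by (intro image_eqI[of _ _ "Suc i"]) auto
qed auto

lemma card_nth_pred:
  assumes "distinct Q"
  shows "card {i \<in> {1..length Q}. P (Q ! (i - 1))} = card {x \<in> set Q. P x}"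
proof -
  have "{i \<in> {1..length Q}. P (Q ! (i - 1))} = Suc ` {i. i < length Q \<and> P (Q ! i)}"
  proof (rule set_eqI)
    fix i show "i \<in> {i \<in> {1..length Q}. P (Q ! (i - 1))} \<longleftrightarrow> i \<in> Suc ` {i. i < length Q \<and> P (Q ! i)}"
      by (cases i) auto
  qed
  then have "card {i \<in> {1..length Q}. P (Q ! (i - 1))} = length (filter P Q)"
    by (simp add: card_image length_filter_conv_card)
  then show ?thesis using length_filter_eq_card[OF assms] by simp
qed

section \<open>The degree condition in digraphs\<close>

text \<open>In the digraph obtained by contracting a perfect matching, both vertex classes of the
  bipartite graph become the vertex set, and the degree condition loses one unit on either side.\<close>

locale ore_digraph =
  fixes V :: "'a set" and A :: "'a \<Rightarrow> 'a \<Rightarrow> bool"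
  assumes fin_V: "finite V"
    and arcD: "A x y \<Longrightarrow> x \<in> V \<and> y \<in> V \<and> x \<noteq> y"
    and two_le: "2 \<le> card V"
    and ore: "x \<in> V \<Longrightarrow> y \<in> V \<Longrightarrow> x \<noteq> y \<Longrightarrow> \<not> A x y \<Longrightarrow>
      card V \<le> card {z. A x z} + card {z. A z y} + 1"
begin

text \<open>Two vertices are enough, as a pair of opposite arcs comes from an alternating 4-cycle; a
  list of length one is excluded because there are no loops.\<close>

definition cyc :: "'a list \<Rightarrow> bool" where
  "cyc c \<longleftrightarrow> c \<noteq> [] \<and> distinct c \<and> set c \<subseteq> V \<and> successively A c \<and> A (last c) (hd c)"

definition hamiltonian :: bool where
  "hamiltonian \<longleftrightarrow> (\<exists>c. cyc c \<and> set c = V)"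

lemma arc_irrefl [simp]: "\<not> A x x"
  using arcD by blast

lemma fin_out: "finite {z. A x z}" and fin_in: "finite {z. A z x}"
  using fin_V arcD by (auto intro: finite_subset[of _ V])

lemma card_out_le:
  assumes "{z. A x z} \<subseteq> S" "finite S" shows "card {z. A x z} \<le> card S"
  using assms by (rule card_mono[rotated])

lemma card_in_le:
  assumes "{z. A z x} \<subseteq> S" "finite S" shows "card {z. A z x} \<le> card S"
  using assms by (rule card_mono[rotated])

lemma reverse: "ore_digraph V (\<lambda>x y. A y x)"
proof
  fix x y assume "x \<in> V" "y \<in> V" "x \<noteq> y" "\<not> A y x"
  then show "card V \<le> card {z. A z x} + card {z. A y z} + 1"
    using ore[of y x] by simp
qed (use fin_V arcD two_le in auto)

lemma cyc_rotate: "cyc (xs @ ys) \<Longrightarrow> cyc (ys @ xs)"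
  unfolding cyc_def
  by (cases "xs = []"; cases "ys = []") (auto simp: successively_append_iff)

text \<open>A closed walk no longer than the set it covers cannot repeat a vertex. Explicit cycles
  can thus be given by arcs, length and members, without a proof of distinctness.\<close>

lemma cyc_of_cover:
  assumes "successively A c" "A (last c) (hd c)" "c \<noteq> []" "length c \<le> card X" "X \<subseteq> set c" "X \<subseteq> V"
  shows "cyc c" "set c = X"
proof -
  have sc: "X = set c"
    using card_seteq[OF List.finite_set assms(5)] card_length[of c] assms(4) by linarith
  have "card (set c) = length c" using card_length[of c] assms(4) unfolding sc by linarith
  then have "distinct c" by (rule card_distinct)
  then show "cyc c" using assms(1-3,6) sc unfolding cyc_def by blast
  show "set c = X" by (rule sc[symmetric])
qed

lemma cyc_length_le: "cyc c \<Longrightarrow> length c \<le> card V"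
  unfolding cyc_def using card_mono[OF fin_V] by (metis distinct_card)

lemma cyc_length_lt: "\<not> hamiltonian \<Longrightarrow> cyc c \<Longrightarrow> length c < card V"
  using cyc_length_le[of c] unfolding hamiltonian_def cyc_def
  by (metis card_subset_eq distinct_card fin_V le_neq_implies_less)

text \<open>If no arc leaves \<open>X\<close>, a vertex inside has at most |X| - 1 out-neighbours
  and one outside at most N - |X| - 1 in-neighbours; their sum N - 2 is one too small for a missing
  arc.\<close>

lemma strong:
  assumes "X \<subseteq> V" "X \<noteq> {}" "X \<noteq> V"
  shows "\<exists>x\<in>X. \<exists>y\<in>V - X. A x y"
proof (rule ccontr)
  assume *: "\<not> ?thesis"
  obtain x y where xy: "x \<in> X" "y \<in> V - X" using assms by blast
  have fX: "finite X" using assms(1) fin_V finite_subset by blast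
  have "card {z. A x z} \<le> card (X - {x})"
    by (rule card_out_le) (use * xy fX arcD in auto)
  moreover have "card {z. A z y} \<le> card (V - X - {y})"
    by (rule card_in_le) (use * xy fin_V arcD in auto)
  moreover have "card V \<le> card {z. A x z} + card {z. A z y} + 1"
    by (rule ore) (use xy assms * in auto)
  moreover have "card (X - {x}) = card X - 1" "card (V - X - {y}) = card V - card X - 1"
    using xy fX fin_V assms(1) by (simp_all add: card_Diff_subset)
  moreover have "card X > 0" "card X < card V"
    using xy fX fin_V assms(1) by (auto simp: card_gt_0_iff intro: psubset_card_mono)
  ultimately show False by linarith
qed

text \<open>The last vertex of a longest path has an out-neighbour by strong connectivity, and this
  neighbour must lie on the path.\<close>

lemma ex_cyc: "\<exists>c. cyc c"
proof -
  define P where "P xs \<longleftrightarrow> xs \<noteq> [] \<and> distinct xs \<and> set xs \<subseteq> V \<and> successively A xs" for xs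
  obtain v where v: "v \<in> V" using two_le by fastforce
  then have "P [v]" by (simp add: P_def)
  moreover have "\<forall>xs. P xs \<longrightarrow> length xs < card V + 1"
    unfolding P_def using card_mono[OF fin_V] by (metis distinct_card less_Suc_eq_le Suc_eq_plus1)
  ultimately obtain xs where xs: "P xs" "\<And>ys. P ys \<Longrightarrow> length ys \<le> length xs"
    using ex_has_greatest_nat[of P "[v]" length] by blast
  obtain y where y: "A (last xs) y"
    using strong[of "{last xs}"] xs(1) two_le unfolding P_def by force
  have "y \<in> set xs"
  proof (rule ccontr)
    assume "y \<notin> set xs"
    then have "P (xs @ [y])" using xs(1) y arcD unfolding P_def by (auto simp: successively_append_iff)
    from xs(2)[OF this] show False by simp
  qed
  then obtain p q where "xs = p @ y # q" by (meson split_list)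
  then have "cyc (y # q)" using xs(1) y unfolding P_def cyc_def
    by (auto simp: successively_append_iff)
  then show ?thesis by blast
qed

lemma ex_longest_cyc: "\<exists>c. cyc c \<and> (\<forall>c'. cyc c' \<longrightarrow> length c' \<le> length c)"
  using ex_cyc cyc_length_le ex_has_greatest_nat[of cyc _ length "card V + 1"]
  by (metis Suc_eq_plus1 less_Suc_eq_le)

end

section \<open>Longest cycles\<close>

definition class1_digraph :: "'a set \<Rightarrow> ('a \<Rightarrow> 'a \<Rightarrow> bool) \<Rightarrow> bool" where
  "class1_digraph V A \<longleftrightarrow> (\<exists>X Y c. X \<union> Y = V \<and> X \<inter> Y = {c} \<and> X \<noteq> {c} \<and> Y \<noteq> {c} \<and>
     (\<forall>x y. A x y \<longleftrightarrow> x \<noteq> y \<and> (x \<in> X \<and> y \<in> X \<or> x \<in> Y \<and> y \<in> Y)))"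

locale longest_cycle = ore_digraph +
  fixes C :: "'a list"
  assumes cyc_C: "cyc C"
    and longest: "cyc c \<Longrightarrow> length c \<le> length C"
    and not_all: "set C \<noteq> V"
begin

abbreviation R :: "'a set" where "R \<equiv> V - set C"

lemma CV: "set C \<subseteq> V" and C_ne: "C \<noteq> []" and dC: "distinct C"
  using cyc_C by (auto simp: cyc_def)

lemma fin_R: "finite R" using fin_V by simp

lemma R_ne: "R \<noteq> {}" using CV not_all by blast

lemma card_V: "card V = length C + card R"
proof -
  have "card V = card (set C) + card R"
    using CV fin_V by (metis card_Diff_subset card_mono le_add_diff_inverse List.finite_set)
  then show ?thesis using distinct_card[OF dC] by simp
qed

lemma arc_in_V: "A x z \<Longrightarrow> z \<in> set C \<or> z \<in> R" "A z x \<Longrightarrow> z \<in> set C \<or> z \<in> R"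
  using arcD[of x z] arcD[of z x] by auto

lemma out_split: "card {z. A x z} = card {z \<in> set C. A x z} + card {z \<in> R. A x z}"
  by (rule card_Collect_split) (use arc_in_V(1)[of x] fin_R in auto)

lemma in_split: "card {z. A z x} = card {z \<in> set C. A z x} + card {z \<in> R. A z x}"
  by (rule card_Collect_split) (use arc_in_V(2)[of _ x] fin_R in auto)

lemma len_eq: "cyc c \<Longrightarrow> set c = set C \<Longrightarrow> length c = length C"
  by (metis cyc_def distinct_card dC)

text \<open>Rotation makes any two consecutive vertices the last and the first one, so
  \<open>ni\<close> forbids insertion in every gap. In the closing gap it keeps the two end terms
  from both being 1, which saves the unit that a path would have.\<close>

lemma cycle_count:
  assumes "cyc c" "set c = set C"
    and ni: "\<And>c'. cyc c' \<Longrightarrow> set c' = set C \<Longrightarrow> \<not> (A (last c') u \<and> A v (hd c'))"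
  shows "card {x \<in> set C. A x u} + card {x \<in> set C. A v x} \<le> length C"
proof -
  have c: "c \<noteq> []" "distinct c" using assms(1) by (auto simp: cyc_def)
  have "successively (\<lambda>x y. \<not> (A x u \<and> A v y)) c"
  proof (rule successivelyI)
    fix ps x y qs assume s: "c = ps @ x # y # qs"
    then have "cyc ((ps @ [x]) @ (y # qs))" using assms(1) by simp
    from ni[OF cyc_rotate[OF this]] show "\<not> (A x u \<and> A v y)"
      using assms(2) s by auto
  qed
  from length_filter_adjacent[OF c(1) this] ni[OF assms(1,2)]
  have "length (filter (\<lambda>x. A x u) c) + length (filter (\<lambda>x. A v x) c) \<le> length c"
    by (cases "A (last c) u"; cases "A v (hd c)"; simp)
  then show ?thesis using c(2) assms(2) len_eq[OF assms(1,2)] by (simp add: length_filter_eq_card)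
qed

section \<open>Paths through the vertices off the cycle\<close>

definition rpath :: "'a list \<Rightarrow> 'a \<Rightarrow> 'a \<Rightarrow> bool" where
  "rpath P u v \<longleftrightarrow> P \<noteq> [] \<and> distinct P \<and> set P \<subseteq> R \<and> successively A P \<and> hd P = u \<and> last P = v"

lemma no_insertion:
  assumes "rpath P u v" "cyc c" "set c \<subseteq> set C" "length C < length c + length P"
  shows "\<not> (A (last c) u \<and> A v (hd c))"
proof
  assume "A (last c) u \<and> A v (hd c)"
  then have "cyc (c @ P)"
    using assms(1-3) CV unfolding cyc_def rpath_def by (auto simp: successively_append_iff)
  from longest[OF this] assms(4) show False by simp
qed

lemma no_insertion':
  assumes "rpath P u v" "cyc c" "set c = set C"
  shows "\<not> (A (last c) u \<and> A v (hd c))"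
  by (rule no_insertion[OF assms(1,2)])
     (use assms len_eq in \<open>auto simp: rpath_def\<close>)

definition reach :: "'a \<Rightarrow> 'a \<Rightarrow> bool" where
  "reach u v \<longleftrightarrow> (\<exists>P. rpath P u v)"

lemma reach_refl: "u \<in> R \<Longrightarrow> reach u u"
  unfolding reach_def by (rule exI[of _ "[u]"]) (simp add: rpath_def)

lemma reach_step:
  assumes "reach u v" "A v w" "w \<in> R"
  shows "reach u w"
proof -
  obtain P where P: "rpath P u v" using assms(1) by (auto simp: reach_def)
  show ?thesis
  proof (cases "w \<in> set P")
    case True
    then obtain p q where "P = p @ w # q" by (meson split_list)
    then have "rpath (p @ [w]) u w"
      using P by (cases p) (auto simp: rpath_def successively_append_iff successively_Cons hd_append)
    then show ?thesis by (auto simp: reach_def)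
  next
    case False
    then have "rpath (P @ [w]) u w"
      using P assms by (auto simp: rpath_def successively_append_iff)
    then show ?thesis by (auto simp: reach_def)
  qed
qed

lemma reach_count:
  assumes "reach u v"
  shows "card {x \<in> set C. A x u} + card {x \<in> set C. A v x} \<le> length C"
proof -
  obtain P where P: "rpath P u v" using assms by (auto simp: reach_def)
  show ?thesis by (rule cycle_count[OF cyc_C refl]) (rule no_insertion'[OF P])
qed

text \<open>A vertex that is both an out-neighbour of \<open>u\<close> and an in-neighbour of
  \<open>v\<close> would give a path; hence these sets are disjoint, and both avoid \<open>u\<close>
  and \<open>v\<close>.\<close>

lemma not_reach_count:
  assumes "u \<in> R" "v \<in> R" "\<not> reach u v"
  shows "card {z \<in> R. A u z} + card {z \<in> R. A z v} + 2 \<le> card R" "u \<noteq> v" "\<not> A u v"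
proof -
  show uv: "u \<noteq> v" using reach_refl assms by blast
  show nA: "\<not> A u v" using reach_step[OF reach_refl] assms by blast
  have d: "{z \<in> R. A u z} \<inter> {z \<in> R. A z v} = {}"
  proof (rule ccontr)
    assume "\<not> ?thesis"
    then obtain w where w: "w \<in> R" "A u w" "A w v" by auto
    from reach_step[OF reach_step[OF reach_refl[OF assms(1)] w(2,1)] w(3) assms(2)] assms(3)
    show False by simp
  qed
  have "{z \<in> R. A u z} \<union> {z \<in> R. A z v} \<subseteq> R - {u, v}"
    using nA by auto
  then have "card ({z \<in> R. A u z} \<union> {z \<in> R. A z v}) \<le> card (R - {u, v})"
    using fin_R by (intro card_mono) auto
  moreover have "card (R - {u, v}) + 2 = card R"
    using card_Diff_subset[of "{u, v}" R] card_mono[OF fin_R, of "{u, v}"] assms uv by simp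
  ultimately show "card {z \<in> R. A u z} + card {z \<in> R. A z v} + 2 \<le> card R"
    using d fin_R by (subst (asm) card_Un_disjoint) auto
qed

text \<open>If only \<open>v\<close> reaches \<open>u\<close>, inserting that path bounds the
  degrees on \<open>C\<close>, and the total N - 2 is too small. If neither reaches the other, add
  the conditions for both orders and use one-vertex paths. Any two attachments to \<open>R\<close>
  can then be joined inside \<open>R\<close>.\<close>

lemma reach_all:
  assumes "u \<in> R" "v \<in> R"
  shows "reach u v"
proof (rule ccontr)
  assume n: "\<not> reach u v"
  note uv = not_reach_count[OF assms n]
  have o: "card V \<le> card {z. A u z} + card {z. A z v} + 1"
    by (rule ore) (use uv assms in auto)
  note sp = out_split[of u] in_split[of v] out_split[of v] in_split[of u] card_V
  show False
  proof (cases "reach v u")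
    case True
    from reach_count[OF this] uv(1) o sp show False by linarith
  next
    case False
    note vu = not_reach_count[OF assms(2,1) False]
    have o': "card V \<le> card {z. A v z} + card {z. A z u} + 1"
      by (rule ore) (use vu assms in auto)
    from reach_count[OF reach_refl[OF assms(1)]] reach_count[OF reach_refl[OF assms(2)]]
      uv(1) vu(1) o o' sp show False by linarith
  qed
qed

text \<open>The cut is chosen so that a path through \<open>R\<close> can replace the gap
  \<open>S\<close>: it is entered from the last vertex of \<open>Q\<close> and left towards the
  first.\<close>

definition split :: "'a list \<Rightarrow> 'a list \<Rightarrow> bool" where
  "split Q S \<longleftrightarrow> cyc (Q @ S) \<and> set (Q @ S) = set C \<and> Q \<noteq> [] \<and>
     (\<exists>u\<in>R. A (last Q) u) \<and> (\<exists>v\<in>R. A v (hd Q))"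

lemma ex_split: "\<exists>Q S. split Q S"
proof -
  obtain x u where xu: "x \<in> set C" "u \<in> R" "A x u"
    using strong[OF CV] C_ne not_all by auto
  obtain v x' where vx: "x' \<in> set C" "v \<in> R" "A v x'"
  proof -
    have "V - R = set C" using CV by auto
    moreover have "R \<noteq> V" using CV C_ne by (cases C) auto
    ultimately show ?thesis using strong[of R] R_ne that by auto
  qed
  obtain p r where pr: "C = p @ x' # r" using vx(1) by (meson split_list)
  \<comment> \<open>Start the cycle at the vertex entered from \<open>R\<close> and cut it after the
    one that leads to \<open>R\<close>; the rest is the gap.\<close>
  have c: "cyc ((x' # r) @ p)" using cyc_rotate[of p "x' # r"] cyc_C pr by simp
  moreover have "x \<in> set ((x' # r) @ p)" using xu pr by auto
  then obtain p2 r2 where "(x' # r) @ p = p2 @ x # r2" by (meson split_list)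
  then have eq: "(x' # r) @ p = (p2 @ [x]) @ r2" by simp
  have "hd (p2 @ [x]) = x'" using arg_cong[OF eq, of hd] by (cases p2) auto
  moreover have "set ((p2 @ [x]) @ r2) = set C" unfolding eq[symmetric] pr by auto
  ultimately have "split (p2 @ [x]) r2" unfolding split_def
    using c xu vx unfolding eq by (metis last_snoc snoc_eq_iff_butlast)
  then show ?thesis by blast
qed

end

section \<open>Consequences of a shortest gap\<close>

locale min_split = longest_cycle +
  fixes Q S :: "'a list"
  assumes split: "split Q S"
    and min_split: "split Q' S' \<Longrightarrow> length S \<le> length S'"
begin

lemma QS: "cyc (Q @ S)" "set Q \<union> set S = set C" "Q \<noteq> []" "distinct Q" "distinct S"
  "set Q \<inter> set S = {}" "successively A Q" "successively A S"
  using split by (auto simp: split_def cyc_def successively_append_iff)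

lemma len_QS: "length Q + length S = length C"
  using len_eq[OF QS(1)] QS(2) by simp

lemma ends: "\<exists>P u v. rpath P u v \<and> A (last Q) u \<and> A v (hd Q)"
  using split reach_all unfolding split_def reach_def by blast

lemma S_ne: "S \<noteq> []"
proof
  assume "S = []"
  then have "cyc Q" "set Q = set C" using QS by auto
  then show False using ends no_insertion' by blast
qed

text \<open>A vertex of \<open>S\<close> attached to \<open>R\<close> could become the new end of
  \<open>Q\<close>, with a strictly shorter gap.\<close>

lemma no_SR: assumes "s \<in> set S" "u \<in> R" shows "\<not> A s u" "\<not> A u s"
proof -
  obtain S1 S2 where S: "S = S1 @ s # S2" using assms(1) by (meson split_list)
  have sp: "cyc (Q @ S)" "set (Q @ S) = set C" "Q \<noteq> []" "\<exists>u\<in>R. A (last Q) u" "\<exists>v\<in>R. A v (hd Q)"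
    using split unfolding split_def by blast+
  show "\<not> A s u"
  proof
    assume "A s u"
    then have "split (Q @ S1 @ [s]) S2"
      using sp assms unfolding split_def S by (auto simp: hd_append)
    from min_split[OF this] S show False by simp
  qed
  show "\<not> A u s"
  proof
    assume "A u s"
    moreover have "cyc ((s # S2 @ Q) @ S1)"
      using cyc_rotate[of "Q @ S1" "s # S2"] sp(1) S by simp
    ultimately have "split (s # S2 @ Q) S1"
      using sp assms unfolding split_def S by auto
    from min_split[OF this] S show False by simp
  qed
qed

lemma nonins_R:
  assumes "u \<in> R" "v \<in> R"
  shows "successively (\<lambda>x y. \<not> (A x u \<and> A v y)) Q"
proof (rule successivelyI)
  fix ps x y qs assume s: "Q = ps @ x # y # qs"
  have "cyc (((y # qs) @ S) @ (ps @ [x]))"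
    using cyc_rotate[of "ps @ [x]" "y # qs @ S"] QS(1) s by simp
  moreover have "set (((y # qs) @ S) @ (ps @ [x])) = set C" using QS(2) s by auto
  moreover obtain P where "rpath P u v" using reach_all[OF assms] by (auto simp: reach_def)
  ultimately show "\<not> (A x u \<and> A v y)" using no_insertion' by fastforce
qed

text \<open>Keeping both ends of \<open>Q\<close> means that a path through \<open>R\<close> still
  closes up. The additional vertices come from \<open>S\<close>.\<close>

definition ext :: "'a list \<Rightarrow> bool" where
  "ext Q' \<longleftrightarrow> Q' \<noteq> [] \<and> distinct Q' \<and> successively A Q' \<and> hd Q' = hd Q \<and> last Q' = last Q \<and>
     set Q \<subseteq> set Q' \<and> set Q' \<subseteq> set C"

lemma ext_insert:
  assumes "ext (ps @ x # y # qs)" "P \<noteq> []" "distinct P" "successively A P"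
    "set P \<subseteq> set C - set (ps @ x # y # qs)" "A x (hd P)" "A (last P) y"
  shows "ext (ps @ x # P @ y # qs)"
  using assms unfolding ext_def
  by (auto simp: successively_append_iff successively_Cons hd_append)

lemma count_path:
  assumes "p \<noteq> []" "distinct p" "successively (\<lambda>x y. \<not> (A x u \<and> A v y)) p"
  shows "card {x \<in> set p. A x u} + card {x \<in> set p. A v x} \<le> length p + 1"
proof -
  have "of_bool (A v (hd p)) + of_bool (A (last p) u) \<le> (2::nat)" by (simp add: of_bool_def)
  then have "length (filter (\<lambda>x. A x u) p) + length (filter (\<lambda>x. A v x) p) \<le> length p + 1"
    using length_filter_adjacent[OF assms(1,3)] by linarith
  then show ?thesis using assms(2) by (simp add: length_filter_eq_card)
qed

text \<open>Insert as many vertices of \<open>S\<close> as possible into \<open>Q\<close>. If none were left, the result would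
  close to a longer cycle through \<open>R\<close>; a vertex that is left and a vertex of \<open>R\<close> have
  together too few neighbours unless nothing was inserted at all.\<close>

lemma ext_length: assumes "ext p" shows "length p \<le> length Q"
proof -
  have extQ: "ext Q" using QS unfolding ext_def by auto
  have bound: "\<forall>p. ext p \<longrightarrow> length p < length C + 1"
    unfolding ext_def using card_mono[of "set C"] distinct_card[OF dC]
    by (metis List.finite_set Suc_eq_plus1 distinct_card less_Suc_eq_le)
  obtain p' where p': "ext p'" "\<And>p. ext p \<Longrightarrow> length p \<le> length p'"
    using ex_has_greatest_nat[of ext Q length, OF extQ] bound by blast
  have e: "p' \<noteq> []" "distinct p'" "successively A p'" "hd p' = hd Q" "last p' = last Q"
    "set Q \<subseteq> set p'" "set p' \<subseteq> set C"
    using p'(1) by (auto simp: ext_def)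
  define S' where "S' = set C - set p'"
  have cS': "length p' + card S' = length C"
    using e(2,7) distinct_card[OF dC] card_mono[OF _ e(7)] unfolding S'_def
    by (simp add: card_Diff_subset distinct_card)
  have "S' \<noteq> {}"
  proof
    assume "S' = {}"
    then have s: "set p' = set C" using e(7) S'_def by blast
    obtain P u v where P: "rpath P u v" "A (last Q) u" "A v (hd Q)" using ends by blast
    have "cyc (p' @ P)" using P e CV s unfolding cyc_def rpath_def
      by (auto simp: successively_append_iff)
    from longest[OF this] P(1) cS' \<open>S' = {}\<close> show False by (simp add: rpath_def)
  qed
  then obtain s where s: "s \<in> S'" by blast
  have sS: "s \<in> set S" using s QS(2) e(6) unfolding S'_def by blast
  obtain u where u: "u \<in> R" using R_ne by blast
  have "successively (\<lambda>x y. \<not> (A x s \<and> A s y)) p'"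
  proof (rule successivelyI)
    fix ps x y qs assume pq: "p' = ps @ x # y # qs"
    show "\<not> (A x s \<and> A s y)"
    proof
      assume "A x s \<and> A s y"
      then have "ext (ps @ x # [s] @ y # qs)"
        using ext_insert[of ps x y qs "[s]"] p'(1) s pq unfolding S'_def by auto
      from p'(2)[OF this] show False using pq by simp
    qed
  qed
  note c1 = count_path[OF e(1,2) this]
  note c2 = count_path[OF QS(3,4) nonins_R[OF u u]]
  have fS': "finite S'" by (simp add: S'_def)
  have sC: "set C = set p' \<union> S'" using e(7) S'_def by blast
  have o1: "card {z. A s z} \<le> card {z \<in> set p'. A s z} + card (S' - {s})"
    by (rule card_Collect_le) (use no_SR[OF sS] arc_in_V(1)[of s] sC fS' in auto)
  have i1: "card {z. A z s} \<le> card {z \<in> set p'. A z s} + card (S' - {s})"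
    by (rule card_Collect_le) (use no_SR[OF sS] arc_in_V(2)[of _ s] sC fS' in auto)
  have o2: "card {z. A u z} \<le> card {z \<in> set Q. A u z} + card (R - {u})"
    by (rule card_Collect_le) (use no_SR[OF _ u] arc_in_V(1)[of u] QS(2) fin_R in auto)
  have i2: "card {z. A z u} \<le> card {z \<in> set Q. A z u} + card (R - {u})"
    by (rule card_Collect_le) (use no_SR[OF _ u] arc_in_V(2)[of _ u] QS(2) fin_R in auto)
  have c: "card (S' - {s}) + 1 = card S'" "card (R - {u}) + 1 = card R"
    using s u fS' fin_R by (metis Suc_eq_plus1 card.remove)+
  have us: "u \<noteq> s" "s \<in> V" "u \<in> V" using u sS QS(2) CV by auto
  have "card V \<le> card {z. A s z} + card {z. A z u} + 1"
       "card V \<le> card {z. A u z} + card {z. A z s} + 1"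
    using ore[of s u] ore[of u s] us no_SR[OF sS u] by auto
  \<comment> \<open>Together the two conditions give 2 N <= |p'| + |Q| + 2 |S'| + 2 |R|, while N =
    |p'| + |S'| + |R|.\<close>
  with o1 i1 o2 i2 c c1 c2 cS' card_V have "length p' \<le> length Q" by linarith
  then show ?thesis using p'(2)[OF assms] by linarith
qed

lemma nonins_S:
  assumes "P \<noteq> []" "distinct P" "successively A P" "set P \<subseteq> set S"
  shows "successively (\<lambda>x y. \<not> (A x (hd P) \<and> A (last P) y)) Q"
proof (rule successivelyI)
  fix ps x y qs assume pq: "Q = ps @ x # y # qs"
  have "ext Q" using QS unfolding ext_def by auto
  moreover have "set P \<subseteq> set C - set Q" using assms(4) QS by blast
  ultimately show "\<not> (A x (hd P) \<and> A (last P) y)"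
    using ext_length[of "ps @ x # P @ y # qs"] ext_insert[of ps x y qs P] assms pq by auto
qed

lemma nbs_S: assumes "s \<in> set S" "A s z \<or> A z s" shows "z \<in> set Q \<union> set S"
proof -
  have "z \<in> set C \<or> z \<in> R" using arc_in_V[of s z] arc_in_V[of z s] assms(2) by blast
  then show ?thesis using no_SR[OF assms(1), of z] assms(2) QS(2) by blast
qed

lemma nbs_R: assumes "u \<in> R" "A u z \<or> A z u" shows "z \<in> set Q \<union> R"
proof -
  have "z \<in> set C \<or> z \<in> R" using arc_in_V[of u z] arc_in_V[of z u] assms(2) by blast
  then show ?thesis using no_SR[OF _ assms(1), of z] assms(2) QS(2) by blast
qed

lemma out_S: assumes "s \<in> set S"
  shows "card {z. A s z} = card {z \<in> set Q. A s z} + card {z \<in> set S. A s z}"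
    "card {z. A z s} = card {z \<in> set Q. A z s} + card {z \<in> set S. A z s}"
  by (rule card_Collect_split, use nbs_S[OF assms] QS(6) in blast, simp_all add: QS(6))+

lemma out_R: assumes "u \<in> R"
  shows "card {z. A u z} = card {z \<in> set Q. A u z} + card {z \<in> R. A u z}"
    "card {z. A z u} = card {z \<in> set Q. A z u} + card {z \<in> R. A z u}"
proof -
  have "set Q \<inter> R = {}" using QS(2) by blast
  then show "card {z. A u z} = card {z \<in> set Q. A u z} + card {z \<in> R. A u z}"
    "card {z. A z u} = card {z \<in> set Q. A z u} + card {z \<in> R. A z u}"
    by (intro card_Collect_split; use nbs_R[OF assms] fin_R in blast)+
qed

text \<open>The conditions for (s, u) and (u, s) demand a degree total of 2 N - 2. The upper bounds
  are |Q| + 1 twice for the arcs at \<open>Q\<close>, 2 (|S| - 1) inside \<open>S\<close> and 2 (|R|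
  - 1) inside \<open>R\<close>, which sum to the same number; so each is attained.\<close>

lemma tight:
  assumes s: "s \<in> set S" and u: "u \<in> R"
  shows "{z \<in> set S. A s z} = set S - {s}" "{z \<in> R. A u z} = R - {u}"
    "card {z \<in> set Q. A s z} = card {z \<in> set Q. A u z}"
    "card {z \<in> set Q. A z s} = card {z \<in> set Q. A z u}"
    "card {z \<in> set Q. A z u} + card {z \<in> set Q. A u z} = length Q + 1"
proof -
  have us: "u \<noteq> s" "s \<in> V" "u \<in> V" using u s QS(2) CV by auto
  have o: "card V \<le> card {z. A s z} + card {z. A z u} + 1"
       "card V \<le> card {z. A u z} + card {z. A z s} + 1"
    using ore[of s u] ore[of u s] us no_SR[OF s u] by auto
  have sub: "{z \<in> set S. A s z} \<subseteq> set S - {s}" "{z \<in> R. A u z} \<subseteq> R - {u}"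
    "{z \<in> set S. A z s} \<subseteq> set S - {s}" "{z \<in> R. A z u} \<subseteq> R - {u}" by auto
  have le: "card {z \<in> set S. A s z} \<le> card (set S - {s})" "card {z \<in> R. A u z} \<le> card (R - {u})"
    "card {z \<in> set S. A z s} \<le> card (set S - {s})" "card {z \<in> R. A z u} \<le> card (R - {u})"
    using fin_R sub by (auto intro!: card_mono simp del: card_Diff_singleton)
  have c: "card (set S - {s}) + 1 = length S" "card (R - {u}) + 1 = card R"
    using s u fin_R QS(5) by (metis Suc_eq_plus1 card.remove distinct_card List.finite_set)+
  have c1: "card {x \<in> set Q. A x s} + card {x \<in> set Q. A s x} \<le> length Q + 1"
    using count_path[OF QS(3,4), of s s] nonins_S[of "[s]"] s by simp
  have c2: "card {x \<in> set Q. A x u} + card {x \<in> set Q. A u x} \<le> length Q + 1"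
    using count_path[OF QS(3,4)] nonins_R[OF u u] by simp
  note all = o out_S[OF s] out_R[OF u] le c c1 c2 card_V len_QS
  show "{z \<in> set S. A s z} = set S - {s}"
    by (rule card_subset_eq[OF _ sub(1)]) (use all in \<open>simp_all del: card_Diff_singleton, linarith?\<close>)
  show "{z \<in> R. A u z} = R - {u}"
    by (rule card_subset_eq[OF _ sub(2)]) (use all fin_R in \<open>simp_all del: card_Diff_singleton, linarith?\<close>)
  show "card {z \<in> set Q. A s z} = card {z \<in> set Q. A u z}"
    "card {z \<in> set Q. A z s} = card {z \<in> set Q. A z u}"
    "card {z \<in> set Q. A z u} + card {z \<in> set Q. A u z} = length Q + 1"
    using all by linarith+
qed

lemma clique_S: "x \<in> set S \<Longrightarrow> y \<in> set S \<Longrightarrow> x \<noteq> y \<Longrightarrow> A x y"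
  using tight(1)[of x] R_ne by blast

lemma clique_R: "x \<in> R \<Longrightarrow> y \<in> R \<Longrightarrow> x \<noteq> y \<Longrightarrow> A x y"
  using tight(2)[of "hd S" x] S_ne by (auto simp: set_eq_iff)

text \<open>\<open>tight\<close> puts the arcs between \<open>Q\<close> and \<open>R\<close> into
  the equality case of the gap count. Different vertices \<open>u\<close>, \<open>v\<close> may
  serve for the two directions, since all vertices of \<open>R\<close> have the same degrees to and
  from \<open>Q\<close>.\<close>

lemma xor_R:
  assumes "u \<in> R" "v \<in> R"
  shows "A v (hd Q) \<and> A (last Q) u \<and> successively (\<lambda>x y. A x u \<noteq> A v y) Q"
proof (rule successively_xor_of_length_filter[OF QS(3) nonins_R[OF assms]])
  show "length Q + 1 \<le> length (filter (\<lambda>x. A x u) Q) + length (filter (A v) Q)"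
    using tight(3-5)[of "hd S" u] tight(3-5)[of "hd S" v] S_ne assms
    by (simp add: length_filter_eq_card[OF QS(4)])
qed

lemma xor_S:
  assumes "s \<in> set S" "t \<in> set S"
  shows "A t (hd Q) \<and> A (last Q) s \<and> successively (\<lambda>x y. A x s \<noteq> A t y) Q"
proof (rule successively_xor_of_length_filter[OF QS(3)])
  show "successively (\<lambda>x y. \<not> (A x s \<and> A t y)) Q"
    using nonins_S[of "[s]"] nonins_S[of "[s, t]"] assms clique_S[of s t] by (cases "s = t") auto
  obtain u where "u \<in> R" using R_ne by blast
  with tight(3-5)[of s u] tight(3-5)[of t u] assms
  show "length Q + 1 \<le> length (filter (\<lambda>x. A x s) Q) + length (filter (A t) Q)"
    by (simp add: length_filter_eq_card[OF QS(4)])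
qed

text \<open>The clique \<open>R\<close> can take the place of \<open>S\<close> in the cycle, and
  \<open>C\<close> is longest.\<close>

lemma card_R_le: "card R \<le> length S"
proof -
  obtain P where P: "set P = R" "distinct P" using finite_distinct_list[OF fin_R] by blast
  have "successively A P"
  proof (rule successivelyI)
    fix ps x y qs assume "P = ps @ x # y # qs"
    then show "A x y" using P clique_R[of x y] by auto
  qed
  moreover have Pne: "P \<noteq> []" using P R_ne by auto
  moreover have "A (last Q) (hd P)" "A (last P) (hd Q)"
    using xor_R[of "hd P" "last P"] hd_in_set[OF Pne] last_in_set[OF Pne] P(1) by auto
  moreover have "set P \<inter> set Q = {}" "set P \<subseteq> V" "set Q \<subseteq> V" using P(1) QS(2) CV by auto
  ultimately have "cyc (Q @ P)" using P(2) QS(3,4,7) unfolding cyc_def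
    by (auto simp: successively_append_iff)
  from longest[OF this] P len_QS distinct_card[OF P(2)] show ?thesis by simp
qed

text \<open>Otherwise the vertex \<open>y\<close> between \<open>x\<close> and \<open>z\<close>
  would by itself be a shorter gap.\<close>

lemma gap:
  assumes "2 \<le> length S" "u \<in> R" "Q = ps @ x # y # z # qs"
  shows "\<not> (A x u \<and> A u z)"
proof
  assume "A x u \<and> A u z"
  moreover have "cyc ((z # qs @ S @ ps @ [x]) @ [y])"
    using cyc_rotate[of "ps @ [x, y]" "z # qs @ S"] QS(1) assms(3) by simp
  ultimately have "split (z # qs @ S @ ps @ [x]) [y]"
    unfolding split_def using QS(2) assms(2,3) by auto
  from min_split[OF this] assms(1) show False by simp
qed

lemma class1_of_length: assumes "length Q = 1" shows "class1_digraph V A"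
proof -
  obtain c where c: "Q = [c]" using assms by (cases Q) auto
  have cS: "A c s" "A s c" if "s \<in> set S" for s using xor_S[OF that that] c by auto
  have cR: "A c s" "A s c" if "s \<in> R" for s using xor_R[OF that that] c by auto
  have sC: "set C = insert c (set S)" "c \<notin> set S" "c \<in> V" using QS c CV by auto
  have "A x y \<longleftrightarrow> x \<noteq> y \<and> (x \<in> insert c (set S) \<and> y \<in> insert c (set S) \<or> x \<in> insert c R \<and> y \<in> insert c R)"
    for x y
    using arc_in_V[of x y] arc_in_V[of y x] sC no_SR clique_S clique_R cS cR by auto
  moreover have "insert c (set S) \<union> insert c R = V" "insert c (set S) \<inter> insert c R = {c}"
    using sC CV by auto
  moreover have "insert c (set S) \<noteq> {c}" using sC(2) S_ne by (cases S) auto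
  moreover have "insert c R \<noteq> {c}" using sC(1) R_ne by auto
  ultimately show ?thesis unfolding class1_digraph_def by blast
qed

end

section \<open>Two cliques attached to a path\<close>

text \<open>\<open>K\<close> consists of the contracted matching edges of the added complete
  bipartite graph. Arcs between \<open>x\<^sub>0\<close> and \<open>x\<^sub>1\<close> are left open
  because they come from the optional edges.\<close>

definition class3_digraph :: "'a set \<Rightarrow> ('a \<Rightarrow> 'a \<Rightarrow> bool) \<Rightarrow> bool" where
  "class3_digraph V A \<longleftrightarrow> (\<exists>x\<^sub>0 x\<^sub>1 x\<^sub>2 x\<^sub>3 K. distinct [x\<^sub>0, x\<^sub>1, x\<^sub>2, x\<^sub>3] \<and> {x\<^sub>0, x\<^sub>1, x\<^sub>2, x\<^sub>3} \<inter> K = {} \<and> K \<noteq> {} \<and>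
     V = {x\<^sub>0, x\<^sub>1, x\<^sub>2, x\<^sub>3} \<union> K \<and>
     (\<forall>x y. {x, y} \<noteq> {x\<^sub>0, x\<^sub>1} \<longrightarrow> (A x y \<longleftrightarrow>
        (x, y) \<in> {(x\<^sub>2, x\<^sub>3), (x\<^sub>3, x\<^sub>2), (x\<^sub>0, x\<^sub>3), (x\<^sub>1, x\<^sub>2), (x\<^sub>2, x\<^sub>0), (x\<^sub>3, x\<^sub>1)} \<or>
        x \<in> K \<and> y \<in> K \<and> x \<noteq> y \<or> x \<in> {x\<^sub>0, x\<^sub>1} \<and> y \<in> K \<or> x \<in> K \<and> y \<in> {x\<^sub>0, x\<^sub>1})))"

lemma class3I:
  assumes "V = {x0, x1, x2, x3} \<union> K"
    and "distinct [x0, x1, x2, x3]" "{x0, x1, x2, x3} \<inter> K = {}" "K \<noteq> {}"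
    and "\<And>x y. A x y \<Longrightarrow> x \<in> V \<and> y \<in> V \<and> x \<noteq> y"
    and "\<And>s s'. s \<in> K \<Longrightarrow> s' \<in> K \<Longrightarrow> s \<noteq> s' \<Longrightarrow> A s s'"
    and "\<And>s. s \<in> K \<Longrightarrow> A x0 s \<and> A x1 s \<and> A s x0 \<and> A s x1 \<and> \<not> A x2 s \<and> \<not> A x3 s \<and> \<not> A s x2 \<and> \<not> A s x3"
    and "A x2 x3" "A x3 x2" "A x0 x3" "A x1 x2" "A x2 x0" "A x3 x1"
    and "\<not> A x0 x2" "\<not> A x1 x3" "\<not> A x2 x1" "\<not> A x3 x0"
  shows "class3_digraph V A"
  unfolding class3_digraph_def
proof (rule exI[of _ x0], rule exI[of _ x1], rule exI[of _ x2], rule exI[of _ x3], rule exI[of _ K],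
    intro conjI allI impI)
  fix x z assume nb: "{x, z} \<noteq> {x0, x1}"
  have n: "x0 \<notin> K" "x1 \<notin> K" "x2 \<notin> K" "x3 \<notin> K" "x0 \<noteq> x1" "x0 \<noteq> x2" "x0 \<noteq> x3" "x1 \<noteq> x2" "x1 \<noteq> x3" "x2 \<noteq> x3"
    using assms(2,3) by auto
  show "A x z \<longleftrightarrow> (x, z) \<in> {(x2, x3), (x3, x2), (x0, x3), (x1, x2), (x2, x0), (x3, x1)} \<or>
      x \<in> K \<and> z \<in> K \<and> x \<noteq> z \<or> x \<in> {x0, x1} \<and> z \<in> K \<or> x \<in> K \<and> z \<in> {x0, x1}"
    (is "_ \<longleftrightarrow> ?E \<or> ?R")
  proof (cases "x \<in> V \<and> z \<in> V \<and> x \<noteq> z")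
    case False
    have "\<not> A x z" using assms(5) False by blast
    moreover have "\<not> ?E"
    proof
      assume ?E
      then consider "x = x2" "z = x3" | "x = x3" "z = x2" | "x = x0" "z = x3" | "x = x1" "z = x2"
        | "x = x2" "z = x0" | "x = x3" "z = x1" by blast
      then show False using False n unfolding assms(1) by cases simp_all
    qed
    moreover have "\<not> ?R" using False n unfolding assms(1) by blast
    ultimately show ?thesis by blast
  next
    case True
    consider (KK) "x \<in> K" "z \<in> K" | (Kz) "x \<in> K" "z \<notin> K" "z \<in> {x0, x1, x2, x3}"
      | (xK) "x \<notin> K" "z \<in> K" "x \<in> {x0, x1, x2, x3}"
      | (xz) "x \<notin> K" "z \<notin> K" "x \<in> {x0, x1, x2, x3}" "z \<in> {x0, x1, x2, x3}"
      using True assms(1) by auto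
    then show ?thesis
    proof cases
      case KK then show ?thesis using True assms(6)[of x z] by simp
    next
      case Kz then show ?thesis using assms(7)[of x] n by auto
    next
      case xK then show ?thesis using assms(7)[of z] n by auto
    next
      case xz
      have "x = x0 \<or> x = x1 \<or> x = x2 \<or> x = x3" using xz by simp
      then show ?thesis
      proof (elim disjE)
        assume "x = x0" then show ?thesis using xz(4) True nb n assms(10,14) by auto
      next
        assume "x = x1" then show ?thesis using xz(4) True nb n assms(11,15) by auto
      next
        assume "x = x2" then show ?thesis using xz(4) True n assms(8,12,16) by auto
      next
        assume "x = x3" then show ?thesis using xz(4) True n assms(9,13,17) by auto
      qed
    qed
  qed
qed (use assms in auto)

text \<open>The labels \<open>a i\<close> and \<open>e i\<close> tell whether the path vertex \<open>y i\<close> has arcs to the clique \<open>Us\<close>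
  and to the clique \<open>Ss\<close>; indices run from \<open>1\<close> to \<open>q\<close>. The vertices of a clique are twins with
  respect to the path.\<close>

locale config = ore_digraph +
  fixes y :: "nat \<Rightarrow> 'a" and q :: nat and Us Ss :: "'a list" and a e :: "nat \<Rightarrow> bool"
  assumes q2: "2 \<le> q"
    and inj: "inj_on y {1..q}"
    and V_eq: "V = y ` {1..q} \<union> set Us \<union> set Ss"
    and disj: "y ` {1..q} \<inter> set Us = {}" "y ` {1..q} \<inter> set Ss = {}" "set Us \<inter> set Ss = {}"
    and dist: "distinct Us" "distinct Ss"
    and ne: "Us \<noteq> []" "Ss \<noteq> []"
    and cliqueU: "u \<in> set Us \<Longrightarrow> u' \<in> set Us \<Longrightarrow> u \<noteq> u' \<Longrightarrow> A u u'"
    and cliqueS: "s \<in> set Ss \<Longrightarrow> s' \<in> set Ss \<Longrightarrow> s \<noteq> s' \<Longrightarrow> A s s'"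
    and no_US: "u \<in> set Us \<Longrightarrow> s \<in> set Ss \<Longrightarrow> \<not> A u s" "u \<in> set Us \<Longrightarrow> s \<in> set Ss \<Longrightarrow> \<not> A s u"
    and step: "1 \<le> i \<Longrightarrow> i < q \<Longrightarrow> A (y i) (y (Suc i))"
    and inU: "u \<in> set Us \<Longrightarrow> 1 \<le> i \<Longrightarrow> i \<le> q \<Longrightarrow> A (y i) u \<longleftrightarrow> a i"
    and outU: "u \<in> set Us \<Longrightarrow> 1 \<le> i \<Longrightarrow> i < q \<Longrightarrow> A u (y (Suc i)) \<longleftrightarrow> \<not> a i"
    and outU1: "u \<in> set Us \<Longrightarrow> A u (y 1)"
    and inS: "s \<in> set Ss \<Longrightarrow> 1 \<le> i \<Longrightarrow> i \<le> q \<Longrightarrow> A (y i) s \<longleftrightarrow> e i"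
    and outS: "s \<in> set Ss \<Longrightarrow> 1 \<le> i \<Longrightarrow> i < q \<Longrightarrow> A s (y (Suc i)) \<longleftrightarrow> \<not> e i"
    and outS1: "s \<in> set Ss \<Longrightarrow> A s (y 1)"
    and aq: "a q" and eq: "e q"
    and same_count: "card {i \<in> {1..q}. a i} = card {i \<in> {1..q}. e i}"
    and nonham: "\<not> hamiltonian"
begin

text \<open>The cliques play symmetric roles, so every fact about \<open>a\<close> has a twin about
  \<open>e\<close>.\<close>

lemma swap: "config V A y q Ss Us e a"
  by unfold_locales (use q2 inj V_eq disj dist ne cliqueU cliqueS no_US step inU outU outU1 inS outS
      outS1 aq eq same_count nonham in auto)

definition seg :: "nat \<Rightarrow> nat \<Rightarrow> 'a list" where
  "seg i j = map y [i..<Suc j]"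

lemma seg_Nil [simp]: "seg i j = [] \<longleftrightarrow> j < i"
  by (auto simp: seg_def)

lemma length_seg [simp]: "length (seg i j) = Suc j - i"
  by (simp add: seg_def del: upt_Suc)

lemma hd_seg [simp]: "i \<le> j \<Longrightarrow> hd (seg i j) = y i"
  by (simp add: seg_def upt_conv_Cons del: upt_Suc)

lemma last_seg [simp]: "i \<le> j \<Longrightarrow> last (seg i j) = y j"
  by (simp add: seg_def)

lemma y_inj: "1 \<le> i \<Longrightarrow> i \<le> q \<Longrightarrow> 1 \<le> j \<Longrightarrow> j \<le> q \<Longrightarrow> y i = y j \<longleftrightarrow> i = j"
  using inj_on_eq_iff[OF inj] by simp

lemma mem_seg [simp]:
  "1 \<le> i \<Longrightarrow> j \<le> q \<Longrightarrow> 1 \<le> k \<Longrightarrow> k \<le> q \<Longrightarrow> y k \<in> set (seg i j) \<longleftrightarrow> i \<le> k \<and> k \<le> j"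
  using inj_on_image_mem_iff[OF inj, of k "{i..j}"]
  by (simp add: seg_def atLeastLessThanSuc_atLeastAtMost del: upt_Suc)

lemma walk_seg [simp]:
  assumes "1 \<le> i" "j \<le> q"
  shows "successively A (seg i j)"
  using assms by (auto simp: successively_conv_nth seg_def step simp del: upt_Suc)

lemma y_V [simp]: "1 \<le> k \<Longrightarrow> k \<le> q \<Longrightarrow> y k \<in> V" using V_eq by auto

lemma y_notin [simp]: "1 \<le> k \<Longrightarrow> k \<le> q \<Longrightarrow> y k \<notin> set Us" "1 \<le> k \<Longrightarrow> k \<le> q \<Longrightarrow> y k \<notin> set Ss"
  using disj by (metis IntI atLeastAtMost_iff empty_iff imageI)+

lemma walk_U [simp]: "successively A Us" and walk_S [simp]: "successively A Ss"
proof -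
  show "successively A Us"
  proof (rule successivelyI)
    fix ps x z qs assume "Us = ps @ x # z # qs"
    then show "A x z" using cliqueU[of x z] dist by auto
  qed
  show "successively A Ss"
  proof (rule successivelyI)
    fix ps x z qs assume "Ss = ps @ x # z # qs"
    then show "A x z" using cliqueS[of x z] dist by auto
  qed
qed

lemma U_ends [simp]: "hd Us \<in> set Us" "last Us \<in> set Us" "hd Ss \<in> set Ss" "last Ss \<in> set Ss"
  using ne by auto

lemma out_first [simp]: "u \<in> set Us \<Longrightarrow> A u (y (Suc 0))" "s \<in> set Ss \<Longrightarrow> A s (y (Suc 0))"
  using outU1 outS1 by simp_all

lemma y_neq [simp]: "1 \<le> k \<Longrightarrow> k \<le> q \<Longrightarrow> y k \<noteq> hd Us" "1 \<le> k \<Longrightarrow> k \<le> q \<Longrightarrow> hd Us \<noteq> y k"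
  using y_notin(1) by (metis U_ends(1))+

lemmas nbs [simp] = inU outU inS outS aq eq ne no_US

lemma card_V: "card V = q + length Us + length Ss"
proof -
  have "card V = card (y ` {1..q}) + card (set Us) + card (set Ss)"
    unfolding V_eq using disj by (subst card_Un_disjoint; (subst card_Un_disjoint)?) auto
  then show ?thesis using inj dist by (simp add: card_image distinct_card)
qed

lemma noham:
  assumes "successively A c" "A (last c) (hd c)" "length c = card V"
    "\<And>k. 1 \<le> k \<Longrightarrow> k \<le> q \<Longrightarrow> y k \<in> set c" "set Us \<subseteq> set c" "set Ss \<subseteq> set c"
  shows False
proof -
  have "V \<subseteq> set c" using assms(4-6) V_eq by auto
  moreover have "c \<noteq> []" using assms(3) card_V ne by auto
  ultimately have "cyc c" "set c = V" using cyc_of_cover[of c V] assms(1-3) by auto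
  with nonham show False by (auto simp: hamiltonian_def)
qed

text \<open>The number of arcs from the path to a fixed vertex of \<open>Us\<close>, and by
  \<open>same_count\<close> also to one of \<open>Ss\<close>. Such a vertex has q + 1 - bet arcs to
  the path.\<close>

definition bet :: nat where "bet = card {i \<in> {1..q}. a i}"

lemma card_zeros: "card {k \<in> {1..<q}. \<not> a k} + bet = q"
proof -
  have "k \<in> {1..q} \<longleftrightarrow> k \<in> {k \<in> {1..<q}. \<not> a k} \<union> {i \<in> {1..q}. a i}" for k
    using aq q2 by (cases "k = q") auto
  then have "{1..q} = {k \<in> {1..<q}. \<not> a k} \<union> {i \<in> {1..q}. a i}" by blast
  then have "q = card ({k \<in> {1..<q}. \<not> a k} \<union> {i \<in> {1..q}. a i})" by (metis card_atLeastAtMost diff_Suc_1)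
  also have "\<dots> = card {k \<in> {1..<q}. \<not> a k} + bet" unfolding bet_def
    by (rule card_Un_disjoint) auto
  finally show ?thesis by simp
qed

lemma V_cases: 
  assumes "x \<in> V" obtains k where "1 \<le> k" "k \<le> q" "x = y k" | "x \<in> set Us" | "x \<in> set Ss"
  using assms V_eq by auto

lemma card_nbs_le:
  assumes "\<And>z. P z \<Longrightarrow> z \<in> V" "\<And>k. 1 \<le> k \<Longrightarrow> k \<le> q \<Longrightarrow> P (y k) \<Longrightarrow> k \<in> X" "finite X"
    "\<And>z. z \<in> set Us \<Longrightarrow> P z \<Longrightarrow> b" "\<And>z. z \<in> set Ss \<Longrightarrow> P z \<Longrightarrow> d"
  shows "card {z. P z} \<le> card X + (if b then length Us else 0) + (if d then length Ss else 0)"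
proof -
  let ?U = "if b then set Us else {}" and ?S = "if d then set Ss else {}"
  have "{z. P z} \<subseteq> y ` X \<union> ?U \<union> ?S"
  proof
    fix z assume "z \<in> {z. P z}"
    then have z: "P z" by simp
    then have "z \<in> V" using assms(1) by simp
    then show "z \<in> y ` X \<union> ?U \<union> ?S" by (cases z rule: V_cases) (use z assms in auto)
  qed
  then have "card {z. P z} \<le> card (y ` X \<union> ?U \<union> ?S)"
    by (rule card_mono[rotated]) (use assms in auto)
  also have "\<dots> \<le> card (y ` X) + card ?U + card ?S"
    by (meson add_le_mono1 card_Un_le order_trans)
  also have "card (y ` X) \<le> card X" using assms by (simp add: card_image_le)
  finally show ?thesis using dist by (auto simp: distinct_card split: if_splits)
qed

lemma in_U_le: assumes "u \<in> set Us" shows "card {z. A z u} + 1 \<le> bet + length Us"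
proof -
  have "card {z. A z u \<or> z = u} \<le> card {i \<in> {1..q}. a i} + (if True then length Us else 0)
      + (if False then length Ss else 0)"
    by (rule card_nbs_le) (use arcD[of _ u] V_eq assms y_notin(1) disj(3) in auto)
  moreover have "{z. A z u \<or> z = u} = insert u {z. A z u}" by auto
  ultimately show ?thesis using fin_in[of u] by (simp add: bet_def)
qed

lemma out_U_le: assumes "u \<in> set Us" shows "card {z. A u z} + bet \<le> q + length Us"
proof -
  let ?Z = "{k \<in> {1..<q}. \<not> a k}"
  have "card {z. A u z \<or> z = u} \<le> card (insert 1 (Suc ` ?Z)) + (if True then length Us else 0)
      + (if False then length Ss else 0)"
  proof (rule card_nbs_le)
    fix k assume k: "1 \<le> k" "k \<le> q" "A u (y k) \<or> y k = u"
    show "k \<in> insert 1 (Suc ` ?Z)"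
    proof (cases "k = 1")
      case False
      then obtain k' where "k = Suc k'" "1 \<le> k'" using k by (cases k) auto
      then show ?thesis using k assms y_notin(1)[of k] by auto
    qed simp
  qed (use arcD[of u] V_eq assms disj(3) in auto)
  also have "card (insert 1 (Suc ` ?Z)) \<le> card ?Z + 1"
    by (rule order_trans[OF card_insert_le_m1]) (auto simp: card_image)
  finally have "card {z. A u z \<or> z = u} \<le> card ?Z + 1 + length Us" by simp
  moreover have "{z. A u z \<or> z = u} = insert u {z. A u z}" by auto
  ultimately have "card {z. A u z} \<le> card ?Z + length Us" using fin_out[of u] by simp
  then show ?thesis using card_zeros by linarith
qed

text \<open>Label 0 is a missing arc to \<open>Us\<close>, where indegrees are at most bet + |Us| -
  1. In the next lemma label 1 at \<open>i\<close> is used as a missing arc from \<open>Us\<close>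
  to \<open>y (Suc i)\<close>.\<close>

lemma out_ge_a: 
  assumes "1 \<le> i" "i \<le> q" "\<not> a i"
  shows "q + length Ss \<le> card {z. A (y i) z} + bet"
proof -
  have "card V \<le> card {z. A (y i) z} + card {z. A z (hd Us)} + 1"
    using assms ne y_notin(1)[of i] by (intro ore) (auto simp: V_eq)
  then show ?thesis using in_U_le[of "hd Us"] card_V by simp
qed

lemma in_ge_a: 
  assumes "1 \<le> i" "i < q" "a i"
  shows "bet + length Ss \<le> card {z. A z (y (Suc i))} + 1"
proof -
  have "card V \<le> card {z. A (hd Us) z} + card {z. A z (y (Suc i))} + 1"
    using assms ne y_notin(1)[of "Suc i"] by (intro ore) (auto simp: V_eq)
  then show ?thesis using out_U_le[of "hd Us"] card_V by simp
qed

lemma out_le: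
  assumes "1 \<le> i" "i \<le> q" "finite X" "\<And>k. 1 \<le> k \<Longrightarrow> k \<le> q \<Longrightarrow> A (y i) (y k) \<Longrightarrow> k \<in> X"
  shows "card {z. A (y i) z} \<le> card X + (if a i then length Us else 0) + (if e i then length Ss else 0)"
  by (rule card_nbs_le) (use arcD assms in auto)

lemma in_le_Suc:
  assumes "1 \<le> i" "i < q" "finite X" "\<And>k. 1 \<le> k \<Longrightarrow> k \<le> q \<Longrightarrow> A (y k) (y (Suc i)) \<Longrightarrow> k \<in> X"
  shows "card {z. A z (y (Suc i))} \<le> card X + (if a i then 0 else length Us) + (if e i then 0 else length Ss)"
proof -
  have "card {z. A z (y (Suc i))} \<le> card X + (if \<not> a i then length Us else 0) + (if \<not> e i then length Ss else 0)"
    by (rule card_nbs_le) (use arcD assms in auto)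
  then show ?thesis by (simp split: if_splits)
qed

lemma in_le_1:
  assumes "finite X" "\<And>k. 1 \<le> k \<Longrightarrow> k \<le> q \<Longrightarrow> A (y k) (y 1) \<Longrightarrow> k \<in> X"
  shows "card {z. A z (y 1)} \<le> card X + length Us + length Ss"
  using card_nbs_le[of "\<lambda>z. A z (y 1)" X True True] arcD assms by simp

text \<open>The chord skips the block from i + 1 to j. Label 0 at i lets \<open>Us\<close> enter
  this block, and label 1 at j would let it continue to \<open>Ss\<close>, which closes the cycle at
  \<open>y 1\<close>.\<close>

lemma forward_a:
  assumes "1 \<le> i" "i < j" "j < q" "A (y i) (y (Suc j))" "\<not> a i"
  shows "\<not> e j"
proof
  assume "e j"
  show False
    by (rule noham[of "seg 1 i @ seg (Suc j) q @ Us @ seg (Suc i) j @ Ss"])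
       (use assms \<open>e j\<close> card_V in \<open>auto simp: successively_append_iff\<close>)
qed

text \<open>With the chord the path up to j can be run from \<open>y (Suc l)\<close> to
  \<open>y j\<close> and on from \<open>y 1\<close> to \<open>y l\<close>. It is entered from
  \<open>Us\<close> and left to \<open>Ss\<close>, and label 0 at j would let \<open>Ss\<close> go
  on to \<open>y (Suc j)\<close>.\<close>

lemma back_a:
  assumes "1 \<le> l" "l < j" "j \<le> q" "A (y j) (y 1)" "\<not> a l" "e l"
  shows "e j"
proof (rule ccontr)
  assume "\<not> e j"
  then have "j < q" using eq assms(3) by (cases "j = q") auto
  show False
    by (rule noham[of "seg (Suc l) j @ seg 1 l @ Ss @ seg (Suc j) q @ Us"])
       (use assms \<open>\<not> e j\<close> \<open>j < q\<close> card_V in \<open>auto simp: successively_append_iff\<close>)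
qed

lemma forward_e:
  assumes "1 \<le> i" "i < j" "j < q" "A (y i) (y (Suc j))" "\<not> e i"
  shows "\<not> a j"
  using config.forward_a[OF swap] assms by blast

lemma back_e:
  assumes "1 \<le> l" "l < j" "j \<le> q" "A (y j) (y 1)" "\<not> e l" "a l"
  shows "a j"
  using config.back_a[OF swap] assms by blast

lemma bet_e: "bet = card {i \<in> {1..q}. e i}"
  unfolding bet_def by (rule same_count)

lemma out_ge_e:
  assumes "1 \<le> i" "i \<le> q" "\<not> e i"
  shows "q + length Us \<le> card {z. A (y i) z} + bet"
proof -
  interpret sw: config V A y q Ss Us e a by (rule swap)
  show ?thesis using sw.out_ge_a[OF assms] by (simp add: sw.bet_def bet_e)
qed

lemma in_ge_e:
  assumes "1 \<le> i" "i < q" "e i"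
  shows "bet + length Us \<le> card {z. A z (y (Suc i))} + 1"
proof -
  interpret sw: config V A y q Ss Us e a by (rule swap)
  show ?thesis using sw.in_ge_a[OF assms] by (simp add: sw.bet_def bet_e)
qed

lemma len_pos: "1 \<le> length Us" "1 \<le> length Ss"
  using ne by (simp_all add: Suc_leI)

text \<open>With both labels 0, \<open>forward_e\<close> lets \<open>y 1\<close> reach only
  successors of indices where \<open>a\<close> fails, and no clique. These are at most q - bet
  vertices, fewer than \<open>out_ge_a\<close> demands.\<close>

lemma first: "a 1 \<or> e 1"
proof (rule ccontr)
  assume n: "\<not> (a 1 \<or> e 1)"
  have "card {z. A (y 1) z} \<le> card (Suc ` {k \<in> {1..<q}. \<not> a k})
      + (if a 1 then length Us else 0) + (if e 1 then length Ss else 0)"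
  proof (rule out_le)
    fix k assume k: "1 \<le> k" "k \<le> q" "A (y 1) (y k)"
    then have "k \<noteq> 1" by auto
    then obtain k' where k': "k = Suc k'" "1 \<le> k'" using k by (cases k) auto
    then have "\<not> a k'" using forward_e[of 1 k'] k n by (cases "k' = 1") auto
    then show "k \<in> Suc ` {k \<in> {1..<q}. \<not> a k}" using k k' by auto
  qed (use q2 in auto)
  then have "card {z. A (y 1) z} + bet \<le> q" using n card_zeros by (simp add: card_image)
  then show False using out_ge_a[of 1] n q2 len_pos by simp
qed

text \<open>The dual of \<open>first\<close>: with both labels 1, all in-neighbours of the last path
  vertex have label \<open>a\<close> and no clique enters it, which leaves at most bet - 1 of
  them.\<close>

lemma last: assumes "1 \<le> p" "q = Suc p" shows "\<not> (a p \<and> e p)"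
proof
  assume p: "a p \<and> e p"
  have "card {z. A z (y (Suc p))} \<le> card ({i \<in> {1..q}. a i} - {q})
      + (if a p then 0 else length Us) + (if e p then 0 else length Ss)"
  proof (rule in_le_Suc)
    fix k assume k: "1 \<le> k" "k \<le> q" "A (y k) (y (Suc p))"
    then have "k \<noteq> q" using assms by auto
    moreover have "a k" using forward_a[of k p] k p assms calculation by (cases "k = p") auto
    ultimately show "k \<in> {i \<in> {1..q}. a i} - {q}" using k by auto
  qed (use assms in auto)
  moreover have "card ({i \<in> {1..q}. a i} - {q}) + 1 = bet"
    unfolding bet_def using aq q2 by (intro Suc_eq_plus1[symmetric, THEN trans] card.remove[symmetric]) auto
  ultimately show False using in_ge_a[of p] assms p len_pos by simp
qed

end

section \<open>Gaps with at least two vertices\<close>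

locale config_gap = config +
  assumes gap: "2 \<le> length Ss"
    and up: "1 \<le> i \<Longrightarrow> Suc i < q \<Longrightarrow> a i \<Longrightarrow> a (Suc i)"
    and long: "cyc c \<Longrightarrow> length c + length Us \<le> card V"
begin

text \<open>\<open>up\<close> is what the minimality of the gap yields: a fall of \<open>a\<close>
  would make one path vertex a shorter gap. So the word of \<open>a\<close> is a block of zeros
  followed by a block of ones.\<close>

lemma a_mono: "i \<le> j \<Longrightarrow> 1 \<le> i \<Longrightarrow> j \<le> q \<Longrightarrow> a i \<Longrightarrow> a j"
proof (induction j rule: dec_induct)
  case (step n)
  then show ?case using up[of n] by (cases "Suc n = q") auto
qed

lemma all_a_imp_e: 
  assumes "bet = q" "1 \<le> i" "i \<le> q" shows "a i" "e i"
proof -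
  have "{i \<in> {1..q}. a i} = {1..q}" "{i \<in> {1..q}. e i} = {1..q}"
    using assms(1) bet_e unfolding bet_def by (intro card_subset_eq; force)+
  then show "a i" "e i" using assms by (auto simp: set_eq_iff)
qed

text \<open>If all labels were 1, no clique would enter \<open>y 2\<close>; its indegree would be at
  most q - 1, but \<open>in_ge_a\<close> asks for q + |Ss| - 1.\<close>

lemma bet_lt: "bet < q"
proof (rule ccontr)
  assume "\<not> bet < q"
  then have b: "bet = q" using card_zeros by linarith
  note ae = all_a_imp_e[OF b]
  have "card {z. A z (y (Suc 1))} \<le> card ({1..q} - {Suc 1})
      + (if a 1 then 0 else length Us) + (if e 1 then 0 else length Ss)"
    by (rule in_le_Suc) (use q2 in \<open>auto intro: Suc_leI\<close>)
  also have "\<dots> = q - 1" using q2 ae by simp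
  finally show False using in_ge_a[of 1] q2 ae[of 1] b gap by simp
qed

lemma not_a1: "\<not> a 1"
proof
  assume "a 1"
  then have "{i \<in> {1..q}. a i} = {1..q}" using a_mono[of 1] by (simp add: set_eq_iff Suc_le_eq) (metis One_nat_def Suc_leI)
  then show False using bet_lt by (simp add: bet_def)
qed

lemma e1: "e 1" using first not_a1 by blast

text \<open>Where \<open>e\<close> falls, \<open>Ss\<close> can replace one path vertex. For |Us| >=
  2 the resulting cycle violates \<open>long\<close>, so \<open>e\<close> would never fall; since it
  starts with 1, all labels would be 1, against \<open>bet_lt\<close>.\<close>

lemma single: "length Us = 1"
proof (rule ccontr)
  assume "length Us \<noteq> 1"
  then have n2: "2 \<le> length Us" using len_pos by linarith
  have up_e: "e (Suc i)" if "1 \<le> i" "Suc i < q" "e i" for i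
  proof (rule ccontr)
    assume ns: "\<not> e (Suc i)"
    let ?c = "seg 1 i @ Ss @ seg (Suc (Suc i)) q @ Us"
    have "y k \<in> y ` {1..i} \<longleftrightarrow> k \<in> {1..i}" "y k \<in> y ` {Suc (Suc i)..q} \<longleftrightarrow> k \<in> {Suc (Suc i)..q}" 
      if "1 \<le> k" "k \<le> q" for k
      using that \<open>Suc i < q\<close> by (auto simp: inj_on_image_mem_iff[OF inj])
    have "cyc ?c" unfolding cyc_def
    proof (intro conjI)
      show "distinct ?c" 
        using dist disj that inj
        by (auto simp: seg_def distinct_map inj_on_subset[OF inj] atLeastLessThanSuc_atLeastAtMost y_inj disjoint_iff
            simp del: upt_Suc)
      show "set ?c \<subseteq> V" using that by (auto simp: seg_def V_eq simp del: upt_Suc)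
      show "successively A ?c" using that ns by (auto simp: successively_append_iff)
    qed (use that in auto)
    from long[OF this] show False using n2 that card_V by simp
  qed
  have "e k" if "1 \<le> k" "k \<le> q" for k
    using that
  proof (induction k rule: dec_induct)
    case (step n)
    then show ?case using up_e[of n] by (cases "Suc n = q") auto
  qed (use e1 in auto)
  then have "{i \<in> {1..q}. e i} = {1..q}" by auto
  then show False using bet_lt by (simp add: bet_e)
qed

definition t :: nat where "t = (LEAST i. 1 \<le> i \<and> a i)"

lemma t: "2 \<le> t" "t \<le> q" "1 \<le> i \<Longrightarrow> i \<le> q \<Longrightarrow> a i \<longleftrightarrow> t \<le> i"
proof -
  have q: "1 \<le> q \<and> a q" using q2 by simp
  have t1: "1 \<le> t \<and> a t" unfolding t_def by (rule LeastI[of "\<lambda>i. 1 \<le> i \<and> a i", OF q])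
  then show "2 \<le> t" using not_a1 by (cases "t = 1") auto
  show tq: "t \<le> q" unfolding t_def by (rule Least_le[of "\<lambda>i. 1 \<le> i \<and> a i", OF q])
  have "t \<le> i" if "1 \<le> i" "a i" for i unfolding t_def by (rule Least_le) (use that in auto)
  then show "1 \<le> i \<Longrightarrow> i \<le> q \<Longrightarrow> a i \<longleftrightarrow> t \<le> i" using a_mono[of t i] t1 by auto
qed

lemma bet_t: "bet + t = q + 1"
proof -
  have "{i \<in> {1..q}. a i} = {t..q}" using t by auto
  then show ?thesis using t(1,2) by (simp add: bet_def)
qed

text \<open>Two zeros at \<open>i\<close> confine forward chords to indices up to \<open>t\<close>.
  The outdegree is then at most t - 1, below the required t - 1 + |Ss|.\<close>

lemma no_00: assumes "1 \<le> i" "i < t" shows "e i"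
proof (rule ccontr)
  assume n: "\<not> e i"
  have na: "\<not> a i" using assms t by auto
  have "card {z. A (y i) z} \<le> card ({1..<i} \<union> {Suc i..t})
      + (if a i then length Us else 0) + (if e i then length Ss else 0)"
  proof (rule out_le)
    fix k assume k: "1 \<le> k" "k \<le> q" "A (y i) (y k)"
    then have "k \<noteq> i" by auto
    moreover have "k \<le> t" if "i < k"
    proof -
      obtain k' where k': "k = Suc k'" "i \<le> k'" using \<open>i < k\<close> by (cases k) auto
      then have "\<not> a k'" using forward_e[of i k'] k n na assms by (cases "k' = i") auto
      then show ?thesis using t(3)[of k'] k k' assms by auto
    qed
    ultimately show "k \<in> {1..<i} \<union> {Suc i..t}" using k by auto
  qed (use assms t in auto)
  also have "card ({1..<i} \<union> {Suc i..t}) = t - 1"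
    using assms by (subst card_Un_disjoint) auto
  finally show False using out_ge_a[of i] n na assms t bet_t len_pos by simp
qed

text \<open>Dually, two ones at \<open>i\<close> confine the in-neighbours of
  \<open>y (Suc i)\<close> to indices from \<open>t\<close> on, at most q - t of them.\<close>

lemma no_11: assumes "t \<le> i" "i < q" shows "\<not> e i"
proof
  assume n: "e i"
  have ai: "a i" using assms t by auto
  have "card {z. A z (y (Suc i))} \<le> card ({t..i} \<union> {Suc (Suc i)..q})
      + (if a i then 0 else length Us) + (if e i then 0 else length Ss)"
  proof (rule in_le_Suc)
    fix k assume k: "1 \<le> k" "k \<le> q" "A (y k) (y (Suc i))"
    then have "k \<noteq> Suc i" by auto
    moreover have "t \<le> k" if "k < i"
      using forward_a[of k i] k n that assms t(3)[of k] by auto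
    moreover have "k < i \<or> k = i \<or> Suc i < k" using calculation(1) by linarith
    ultimately show "k \<in> {t..i} \<union> {Suc (Suc i)..q}" using k assms by auto
  qed (use assms t in auto)
  also have "card ({t..i} \<union> {Suc (Suc i)..q}) = q - t"
    using assms by (subst card_Un_disjoint) auto
  finally show False using in_ge_a[of i] n ai assms t bet_t gap by simp
qed

lemma e_iff: "1 \<le> i \<Longrightarrow> i \<le> q \<Longrightarrow> e i \<longleftrightarrow> i < t \<or> i = q"
  using no_00 no_11 by (metis eq not_less order_le_less)

text \<open>Equate the numbers of ones: \<open>e\<close> has t of them and \<open>a\<close> has q +
  1 - t.\<close>

lemma q_t: "q + 1 = 2 * t"
proof -
  have "{i \<in> {1..q}. e i} = insert q {1..<t}" using e_iff t by auto
  then have "bet = t" using t by (simp add: bet_e)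
  then show ?thesis using bet_t by simp
qed

text \<open>For larger t the vertex \<open>y t\<close> has label 1 for \<open>Us\<close> and 0 for
  \<open>Ss\<close>, and counting gives it arcs back to all earlier vertices except
  \<open>y 1\<close>. This leaves only t = 3, q = 5, where another Hamilton cycle exists.\<close>

lemma t2: "t = 2"
proof (rule ccontr)
  assume "t \<noteq> 2"
  then have t3: "3 \<le> t" and tq: "t < q" using t q_t by linarith+
  have et: "\<not> e t" and at: "a t" using e_iff[of t] t(3)[of t] t tq by auto
  let ?X = "{2..<t} \<union> {Suc t}"
  have X: "k \<in> ?X" if k: "1 \<le> k" "k \<le> q" "A (y t) (y k)" for k
  proof -
    have "k \<noteq> t" "k \<noteq> 1" using k back_a[of 1 t] e1 not_a1 et t3 tq by auto
    moreover have "k = Suc t" if "t < k"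
    proof (rule ccontr)
      assume "k \<noteq> Suc t"
      then obtain k' where k': "k = Suc k'" "t < k'"
        using \<open>t < k\<close> \<open>k \<noteq> Suc t\<close> by (cases k) auto
      then show False using forward_e[of t k'] k et t3 t(3)[of k'] by auto
    qed
    ultimately show ?thesis using k by auto
  qed
  have cX: "card ?X = t - 1" using t3 by (subst card_Un_disjoint) auto
  have lo: "q + 1 \<le> card {z. A (y t) z} + bet" using out_ge_e[of t] et t t3 single by simp
  have hi: "card {z. A (y t) z} \<le> card ?X + (if a t then length Us else 0) + (if e t then length Ss else 0)"
    by (rule out_le) (use t X in auto)
  \<comment> \<open>The lower bound for the outdegree equals the number of candidates, so none may
    be missing.\<close>
  have all: "A (y t) (y i)" if i: "2 \<le> i" "i < t" for i
  proof (rule ccontr)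
    assume n: "\<not> A (y t) (y i)"
    have "card {z. A (y t) z} \<le> card (?X - {i}) + (if a t then length Us else 0) + (if e t then length Ss else 0)"
      by (rule out_le) (use t X n in auto)
    moreover have "card (?X - {i}) < card ?X" using i by (intro card_Diff1_less) auto
    ultimately show False using lo cX bet_t et at single t3 by simp
  qed
  have nb: "\<not> A (y i) (y 1)" if i: "2 \<le> i" "i < t" for i
  proof
    assume b: "A (y i) (y 1)"
    obtain i' where i': "i = Suc i'" "1 \<le> i'" using i by (cases i) auto
    have lab: "\<not> a i" "e i'" using i i' t(3)[of i] e_iff[of i'] tq by auto
    show False
      by (rule noham[of "seg (Suc i) t @ seg i i @ seg 1 i' @ Ss @ seg (Suc t) q @ Us"])
        (use i i' lab b all[OF i] et tq card_V in \<open>auto simp: successively_append_iff\<close>)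
  qed
  have X1: "k \<in> {q}" if k: "1 \<le> k" "k \<le> q" "A (y k) (y 1)" for k
  proof -
    have "k \<noteq> 1" using k by auto
    then show ?thesis using k nb[of k] back_a[of 1 k] e1 not_a1 e_iff[of k] by auto
  qed
  \<comment> \<open>Only the last path vertex can still have an arc to \<open>y 1\<close>, so this
    condition gives t <= 3.\<close>
  have "card V \<le> card {z. A (y t) z} + card {z. A z (y 1)} + 1"
    using t tq y_inj[of t 1] back_a[of 1 t] e1 not_a1 et by (intro ore) auto
  then have lo1: "t + length Ss \<le> card {z. A z (y 1)} + 1"
    using hi cX et at single card_V q_t t3 by simp
  have "card {z. A z (y 1)} \<le> card {q} + length Us + length Ss"
    by (rule in_le_1) (use X1 in auto)
  then have tt: "t = 3" "q = 5" using lo1 t3 single q_t by simp_all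
  have "A (y q) (y 1)"
  proof (rule ccontr)
    assume "\<not> A (y q) (y 1)"
    then have "card {z. A z (y 1)} \<le> card ({} :: nat set) + length Us + length Ss"
      by (intro in_le_1) (use X1 in auto)
    then show False using lo1 single tt by simp
  qed
  \<comment> \<open>The cycle visits \<open>Ss\<close> twice, which takes two nonempty
    pieces.\<close>
  moreover obtain s rest where Ss: "Ss = s # rest" "rest \<noteq> []"
    using gap by (cases Ss; cases "tl Ss") auto
  ultimately have ham: "A (y 5) (y 1)" "A (y 3) (y 2)" "\<not> a 1" "\<not> a 2" "a 3" "a 4" "e 1" "e 2" "\<not> e 3" "\<not> e 4"
    using tt all[of 2] t(3) e_iff by auto
  have rs: "hd rest \<in> set Ss" "last rest \<in> set Ss" "s \<in> set Ss" "successively A rest"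
    using Ss walk_S by (auto simp: successively_Cons)
  show False
    by (rule noham[of "Us @ seg 3 3 @ seg 2 2 @ rest @ seg 5 5 @ seg 1 1 @ [s] @ seg 4 4"])
      (use ham rs Ss(2) tt card_V Ss in \<open>auto simp: successively_append_iff successively_Cons outS[of _ 3, simplified] outS[of _ 4, simplified] outU[of _ 2, simplified]\<close>)
qed

text \<open>The ends of the three-vertex path form the optional pair, \<open>Ss\<close> is
  \<open>K\<close>, and \<open>u\<close> and \<open>y 2\<close> are the other two vertices.\<close>

lemma class3: "class3_digraph V A"
proof -
  have q3: "q = 3" using t2 q_t by simp
  have lab: "\<not> a 1" "a 2" "a 3" "e 1" "\<not> e 2" "e 3"
    using t(3)[of 1] t(3)[of 2] e_iff[of 1] e_iff[of 2] t2 q3 aq eq by auto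
  obtain u where u: "Us = [u]" using single by (cases Us) auto
  have uS: "u \<in> set Us" using u by simp
  have steps: "A (y 1) (y 2)" "A (y 2) (y 3)" using step[of 1] step[of 2] q3 by (simp_all add: numeral_eq_Suc)
  have b21: "\<not> A (y 2) (y 1)" using back_a[of 1 2] lab q3 by auto
  have b32: "\<not> A (y 3) (y 2)"
  proof
    assume b: "A (y 3) (y 2)"
    show False
      by (rule noham[of "seg 1 1 @ Ss @ seg 3 3 @ seg 2 2 @ Us"])
        (use lab b q3 card_V outS[of "last Ss" 2] inU[of _ 2] in \<open>auto simp: successively_append_iff numeral_eq_Suc\<close>)
  qed
  have yd: "y 1 \<noteq> y 2" "y 1 \<noteq> y 3" "y 2 \<noteq> y 3" using y_inj q3 by auto
  have yV: "y ` {1..q} = {y 1, y 2, y 3}" unfolding q3 by (auto simp: numeral_eq_Suc atLeastAtMostSuc_conv)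
  have Su: "A (y 1) s" "\<not> A (y 2) s" "A (y 3) s" "A s (y 1)" "\<not> A s (y 2)" "A s (y 3)" "\<not> A s u" "\<not> A u s"
    if "s \<in> set Ss" for s
    using that inS[OF that, of 1] inS[OF that, of 2] inS[OF that, of 3] outS[OF that, of 1] outS[OF that, of 2] outS1[OF that]
      lab q3 no_US[OF uS that] by (auto simp: numeral_eq_Suc)
  have Uu: "\<not> A (y 1) u" "A (y 2) u" "A (y 3) u" "A u (y 1)" "A u (y 2)" "\<not> A u (y 3)"
    using inU[OF uS, of 1] inU[OF uS, of 2] inU[OF uS, of 3] outU[OF uS, of 1] outU[OF uS, of 2] outU1[OF uS]
      lab q3 by (auto simp: numeral_eq_Suc)
  have nin: "u \<notin> set Ss" "y 1 \<notin> set Ss" "y 2 \<notin> set Ss" "y 3 \<notin> set Ss" "u \<noteq> y 1" "u \<noteq> y 2" "u \<noteq> y 3"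
    using disj y_notin(1)[of 1] y_notin(1)[of 2] y_notin(1)[of 3] y_notin(2)[of 1] y_notin(2)[of 2] y_notin(2)[of 3] q3 u by auto
  have Veq: "V = {y 1, y 3, u, y 2} \<union> set Ss" using V_eq yV u by auto
  show ?thesis
  proof (rule class3I[OF Veq])
    show "distinct [y 1, y 3, u, y 2]" using nin yd by simp
    show "{y 1, y 3, u, y 2} \<inter> set Ss = {}" using nin by simp
    show "A y1 s'" if "y1 \<in> set Ss" "s' \<in> set Ss" "y1 \<noteq> s'" for y1 s' using cliqueS that by simp
    show "A y1 s' \<Longrightarrow> y1 \<in> V \<and> s' \<in> V \<and> y1 \<noteq> s'" for y1 s' by (rule arcD)
  qed (use Su Uu steps b21 b32 ne in simp_all)
qed

end

section \<open>Cycles missing one vertex\<close>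

lemma (in ore_digraph) configI:
  assumes "2 \<le> length Q" "distinct Q" "successively A Q" "V = set Q \<union> set Us \<union> set Ss"
    "set Q \<inter> set Us = {}" "set Q \<inter> set Ss = {}" "set Us \<inter> set Ss = {}" "distinct Us" "distinct Ss"
    and us: "u \<in> set Us" "s \<in> set Ss"
    and cliques: "\<And>x z. x \<in> set Us \<Longrightarrow> z \<in> set Us \<Longrightarrow> x \<noteq> z \<Longrightarrow> A x z"
      "\<And>x z. x \<in> set Ss \<Longrightarrow> z \<in> set Ss \<Longrightarrow> x \<noteq> z \<Longrightarrow> A x z"
    and apart: "\<And>x z. x \<in> set Us \<Longrightarrow> z \<in> set Ss \<Longrightarrow> \<not> A x z \<and> \<not> A z x"
    and xor: "\<And>v v'. v \<in> set Us \<and> v' \<in> set Us \<or> v \<in> set Ss \<and> v' \<in> set Ss \<Longrightarrow>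
      A v' (hd Q) \<and> A (last Q) v \<and> successively (\<lambda>x y. A x v \<noteq> A v' y) Q"
    and count: "card {x \<in> set Q. A x u} = card {x \<in> set Q. A x s}"
    and nonham: "\<not> hamiltonian"
  shows "config V A (\<lambda>i. Q ! (i - 1)) (length Q) Us Ss (\<lambda>i. A (Q ! (i - 1)) u) (\<lambda>i. A (Q ! (i - 1)) s)"
proof -
  let ?y = "\<lambda>i. Q ! (i - 1)"
  let ?twins = "\<lambda>v v'. v \<in> set Us \<and> v' \<in> set Us \<or> v \<in> set Ss \<and> v' \<in> set Ss"
  have Q: "Q \<noteq> []" using assms(1) by auto
  have nx: "A (?y i) v \<noteq> A v' (Q ! i)" if "?twins v v'" "1 \<le> i" "i < length Q" for i v v'
    using xor[OF that(1)] that(2,3) by (auto simp: successively_conv_nth dest!: conjunct2 spec[of _ "i - 1"])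
  have ends: "A (Q ! (length Q - 1)) v" "A v (Q ! 0)" if "?twins v v" for v
    using xor[OF that] Q by (auto simp: last_conv_nth hd_conv_nth)
  \<comment> \<open>Before the end both labels are the negation of the same arc, from
    \<open>v'\<close> to the next vertex; at the end both are true.\<close>
  have twin: "A (?y i) v = A (?y i) v'" if "?twins v v'" "1 \<le> i" "i \<le> length Q" for v v' i
  proof (cases "i = length Q")
    case True
    then show ?thesis using ends[of v] ends[of v'] that by auto
  next
    case False
    then show ?thesis using nx[of v v' i] nx[of v' v' i] that by auto
  qed
  show ?thesis
  proof
    show "inj_on ?y {1..length Q}" using assms(2) by (auto simp: inj_on_def nth_eq_iff_index_eq)
    show "V = ?y ` {1..length Q} \<union> set Us \<union> set Ss" "?y ` {1..length Q} \<inter> set Us = {}"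
      "?y ` {1..length Q} \<inter> set Ss = {}"
      unfolding image_nth_pred by fact+
    show "A (?y i) (Q ! (Suc i - 1))" if "1 \<le> i" "i < length Q" for i
      using assms(3) that by (auto simp: successively_conv_nth dest!: spec[of _ "i - 1"])
    show "A (?y i) v = A (?y i) u" if "v \<in> set Us" "1 \<le> i" "i \<le> length Q" for v i
      using twin that us by blast
    show "A (?y i) v = A (?y i) s" if "v \<in> set Ss" "1 \<le> i" "i \<le> length Q" for v i
      using twin that us by blast
    show "A v (Q ! (Suc i - 1)) = (\<not> A (?y i) u)" if "v \<in> set Us" "1 \<le> i" "i < length Q" for v i
      using nx[of u v i] that us by auto
    show "A v (Q ! (Suc i - 1)) = (\<not> A (?y i) s)" if "v \<in> set Ss" "1 \<le> i" "i < length Q" for v i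
      using nx[of s v i] that us by auto
    show "card {i \<in> {1..length Q}. A (?y i) u} = card {i \<in> {1..length Q}. A (?y i) s}"
      unfolding card_nth_pred[OF assms(2), of "\<lambda>x. A x _"] by (rule count)
  qed (use assms ends in auto)
qed

context min_split
begin

lemma config:
  assumes "2 \<le> length Q" "u \<in> R" "s \<in> set S" "set P = R" "distinct P" "\<not> hamiltonian"
  shows "config V A (\<lambda>i. Q ! (i - 1)) (length Q) P S (\<lambda>i. A (Q ! (i - 1)) u) (\<lambda>i. A (Q ! (i - 1)) s)"
proof (rule configI)
  show "card {x \<in> set Q. A x u} = card {x \<in> set Q. A x s}" using tight(4)[OF assms(3,2)] by simp
  show "A v' (hd Q) \<and> A (last Q) v \<and> successively (\<lambda>x y. A x v \<noteq> A v' y) Q"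
    if "v \<in> set P \<and> v' \<in> set P \<or> v \<in> set S \<and> v' \<in> set S" for v v'
    using xor_R[of v v'] xor_S[of v v'] that assms(4) by blast
  show "V = set Q \<union> set P \<union> set S" using assms(4) QS(2) CV by auto
qed (use assms QS(2,4-7) clique_S clique_R no_SR in auto)

lemma length_S_1:
  assumes "\<not> hamiltonian" "\<not> class1_digraph V A" "\<not> class3_digraph V A"
  shows "length S = 1" "card R = 1"
proof -
  obtain P where P: "set P = R" "distinct P" using finite_distinct_list[OF fin_R] by blast
  obtain u s where us: "u \<in> R" "s \<in> set S" using R_ne S_ne by (metis ex_in_conv hd_in_set)
  have "length Q \<noteq> 1" using class1_of_length assms by blast
  moreover have "length Q \<noteq> 0" using QS(3) by simp
  ultimately have q2: "2 \<le> length Q" by linarith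
  note c = config[OF q2 us P assms(1)]
  have "\<not> 2 \<le> length S"
  proof
    assume g: "2 \<le> length S"
    \<comment> \<open>A fall of the label would give arcs to and from \<open>u\<close> on both sides
      of a single vertex, contrary to \<open>gap\<close>.\<close>
    have up: "A (Q ! (Suc i - 1)) u" if i: "1 \<le> i" "Suc i < length Q" "A (Q ! (i - 1)) u" for i
    proof (rule ccontr)
      assume n: "\<not> A (Q ! (Suc i - 1)) u"
      obtain j where j: "i = Suc j" using i by (cases i) auto
      have "Q = take j Q @ Q ! j # Q ! Suc j # Q ! Suc (Suc j) # drop (Suc (Suc (Suc j))) Q"
        using i j by (metis Cons_nth_drop_Suc Suc_lessD append_take_drop_id)
      moreover have "A u (Q ! Suc (Suc j))"
        using xor_R[OF us(1) us(1)] n i j by (auto simp: successively_conv_nth)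
      ultimately show False using gap[OF g us(1)] i j by auto
    qed
    interpret cg: config_gap V A "\<lambda>i. Q ! (i - 1)" "length Q" P S
      "\<lambda>i. A (Q ! (i - 1)) u" "\<lambda>i. A (Q ! (i - 1)) s"
    proof (intro config_gap.intro config_gap_axioms.intro c)
      show "length c + length P \<le> card V" if "cyc c" for c
        using longest[OF that] card_V P by (metis add_le_cancel_right distinct_card)
    qed (use g up in auto)
    show False using cg.class3 assms by blast
  qed
  moreover have "length S \<noteq> 0" using S_ne by simp
  ultimately show "length S = 1" by linarith
  then show "card R = 1" using card_R_le R_ne fin_R by (metis One_nat_def Suc_leI card_gt_0_iff le_antisym)
qed

end

lemma (in longest_cycle) ex_min_split: "\<exists>Q S. min_split V A C Q S"
proof -
  obtain Q0 S0 where "split Q0 S0" using ex_split by blast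
  then have ex: "\<exists>n. \<exists>Q S. split Q S \<and> length S = n" by blast
  define n where "n = (LEAST n. \<exists>Q S. split Q S \<and> length S = n)"
  obtain Q S where QS: "split Q S" "length S = n" using LeastI_ex[OF ex] unfolding n_def by blast
  have "length S \<le> length S'" if "split Q' S'" for Q' S'
    unfolding QS(2) n_def by (rule Least_le) (use that in blast)
  then show ?thesis using QS(1) longest_cycle_axioms
    by (auto simp: min_split_def min_split_axioms_def)
qed

text \<open>The condition speaks of all cycles missing one vertex, hence it is available again after
  the missed vertex is exchanged. By rotation the closing gap stands for every gap.\<close>

locale critical = ore_digraph +
  assumes nonham: "\<not> hamiltonian"
    and miss: "cyc c \<Longrightarrow> w \<in> V \<Longrightarrow> set c = V - {w} \<Longrightarrow> A (last c) w \<noteq> A w (hd c)"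

definition (in ore_digraph) alternating :: bool where
  "alternating \<longleftrightarrow> (\<exists>c w. cyc c \<and> w \<in> V \<and> set c = V - {w} \<and> (\<forall>x\<in>set c. A x w \<longleftrightarrow> A w x))"

lemma (in ore_digraph) critical:
  assumes "\<not> hamiltonian" "\<not> class1_digraph V A" "\<not> class3_digraph V A"
  shows "critical V A" "\<exists>c w. cyc c \<and> w \<in> V \<and> set c = V - {w}"
proof -
  obtain C0 where C0: "cyc C0" "\<And>c. cyc c \<Longrightarrow> length c \<le> length C0" using ex_longest_cyc by blast
  have "set C0 \<noteq> V" using C0(1) assms(1) by (auto simp: hamiltonian_def)
  then interpret l0: longest_cycle V A C0 using C0 by unfold_locales auto
  obtain Q0 S0 where "min_split V A C0 Q0 S0" using l0.ex_min_split by blast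
  then interpret m0: min_split V A C0 Q0 S0 .
  obtain w0 where "V - set C0 = {w0}" using m0.length_S_1(2)[OF assms] by (auto simp: card_1_singleton_iff)
  then show "\<exists>c w. cyc c \<and> w \<in> V \<and> set c = V - {w}" using C0(1) l0.CV by (intro exI[of _ C0] exI[of _ w0]) auto
  show "critical V A"
  proof
    show "\<not> hamiltonian" by fact
    fix c w assume c: "cyc c" "w \<in> V" "set c = V - {w}"
    have len: "length c + 1 = card V" using c fin_V 
      by (metis Suc_eq_plus1 card.remove cyc_def distinct_card)
    interpret l: longest_cycle V A c
      using c len cyc_length_lt[OF assms(1)] by unfold_locales (auto simp: less_Suc_eq_le simp flip: len)
    obtain Q S where "min_split V A c Q S" using l.ex_min_split by blast
    then interpret m: min_split V A c Q S .
    have R: "V - set c = {w}" using c by auto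
    obtain s where s: "S = [s]" using m.length_S_1(1)[OF assms] by (cases S) auto
    have ns: "\<not> A s w" "\<not> A w s" using m.no_SR[of s w] s R by auto
    \<comment> \<open>The gap vertex \<open>s\<close> is not adjacent to \<open>w\<close>, so the
      |Q| + 1 arcs between \<open>w\<close> and \<open>Q\<close> are all there are, and |Q| + 1 is
      the length of \<open>c\<close>. Every gap is then charged, the closing one included.\<close>
    have cs: "card {z \<in> set c. A z w} + card {z \<in> set c. A w z} = length c"
    proof -
      have "{z \<in> set c. A z w} = {z \<in> set Q. A z w}" "{z \<in> set c. A w z} = {z \<in> set Q. A w z}"
        using m.QS(2) s ns by auto
      then show ?thesis using m.tight(5)[of s w] s R m.len_QS by simp
    qed
    have d: "distinct c" "c \<noteq> []" using c(1) by (auto simp: cyc_def)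
    have P: "l.rpath [w] w w" using R by (auto simp: l.rpath_def)
    have "successively (\<lambda>x y. \<not> (A x w \<and> A w y)) c"
    proof (rule successivelyI)
      fix ps x y qs assume s: "c = ps @ x # y # qs"
      then have "cyc ((ps @ [x]) @ (y # qs))" using c(1) by simp
      from l.no_insertion'[OF P cyc_rotate[OF this]] show "\<not> (A x w \<and> A w y)"
        using s by auto
    qed
    from length_filter_adjacent[OF d(2) this] l.no_insertion'[OF P c(1) refl] cs
    show "A (last c) w \<noteq> A w (hd c)"
      by (cases "A (last c) w"; cases "A w (hd c)"; simp add: length_filter_eq_card[OF d(1)])
  qed
qed

context critical
begin

lemma xor_path: assumes "cyc c" "w \<in> V" "set c = V - {w}"
  shows "successively (\<lambda>x y. A x w \<noteq> A w y) c"
proof (rule successivelyI)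
  fix ps x y qs assume s: "c = ps @ x # y # qs"
  then have "cyc ((ps @ [x]) @ (y # qs))" using assms(1) by simp
  from miss[OF cyc_rotate[OF this] assms(2)] s assms(3) show "A x w \<noteq> A w y" by auto
qed

text \<open>Each gap of the cycle, the closing one included, contributes exactly one arc at
  \<open>w\<close>.\<close>

lemma deg_sum: assumes "cyc c" "w \<in> V" "set c = V - {w}"
  shows "card {z. A w z} + card {z. A z w} + 1 = card V"
proof -
  have d: "distinct c" "c \<noteq> []" using assms(1) by (auto simp: cyc_def)
  have len: "length c + 1 = card V" using assms fin_V d
    by (metis Suc_eq_plus1 card.remove distinct_card)
  have "{z. A w z} = {z \<in> set c. A w z}" "{z. A z w} = {z \<in> set c. A z w}"
    using assms(3) arcD[of w] arcD[of _ w] by blast+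
  then have "card {z. A w z} = length (filter (A w) c)" "card {z. A z w} = length (filter (\<lambda>x. A x w) c)"
    using length_filter_eq_card[OF d(1)] by metis+
  moreover have "length (filter (\<lambda>x. A x w) c) + length (filter (A w) c) = length c"
    using length_filter_xor[OF d(2) xor_path[OF assms]] miss[OF assms]
    by (cases "A (last c) w"; cases "A w (hd c)"; simp)
  ultimately show ?thesis using len by linarith
qed

text \<open>Closing \<open>Q\<close> with \<open>w\<close> in place of \<open>s\<close> gives a
  cycle missing \<open>s\<close>, so \<open>s\<close> satisfies the same alternation. The two degree
  sums and the condition in both directions force equal indegrees.\<close>

lemma config_pair:
  assumes "cyc (s # Q)" "w \<in> V" "set (s # Q) = V - {w}" "\<not> A s w" "\<not> A w s" "2 \<le> length Q"
  shows "config V A (\<lambda>i. Q ! (i - 1)) (length Q) [w] [s] (\<lambda>i. A (Q ! (i - 1)) w) (\<lambda>i. A (Q ! (i - 1)) s)"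
proof -
  have "Q \<noteq> []" using assms(6) by auto
  then have Q: "Q \<noteq> []" "distinct Q" "s \<notin> set Q" "w \<notin> set Q" "w \<noteq> s" "s \<in> V" "set Q \<subseteq> V"
    "successively A Q" "A s (hd Q)" "A (last Q) s"
    using assms by (auto simp: cyc_def successively_Cons)
  have xw: "successively (\<lambda>x y. A x w \<noteq> A w y) (s # Q)" "A (last Q) w"
    using xor_path[OF assms(1-3)] miss[OF assms(1-3)] assms(4,5) Q(1) by auto
  then have xwQ: "successively (\<lambda>x y. A x w \<noteq> A w y) Q" "A w (hd Q)"
    using Q(1) assms(4) by (auto simp: successively_Cons)
  have cw: "cyc (Q @ [w])" "set (Q @ [w]) = V - {s}"
    using Q xw xwQ assms(2,3) by (auto simp: cyc_def successively_append_iff)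
  have xsQ: "successively (\<lambda>x y. A x s \<noteq> A s y) Q"
    using xor_path[OF cw(1) Q(6) cw(2)] by (auto simp: successively_append_iff)
  have arcs: "{z. A w z} = {z \<in> set Q. A w z}" "{z. A z w} = {z \<in> set Q. A z w}"
    "{z. A s z} = {z \<in> set Q. A s z}" "{z. A z s} = {z \<in> set Q. A z s}"
  proof -
    have "z \<in> set Q \<or> z = s \<or> z = w" if "z \<in> V" for z using that assms(3) by auto
    then show "{z. A w z} = {z \<in> set Q. A w z}" "{z. A z w} = {z \<in> set Q. A z w}"
      "{z. A s z} = {z \<in> set Q. A s z}" "{z. A z s} = {z \<in> set Q. A z s}"
      using arcD assms(4,5) arc_irrefl by blast+
  qed
  have N: "card V = length Q + 2"
  proof -
    have "V = insert w (insert s (set Q))" using assms(2,3) by auto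
    then have "card V = card (insert w (insert s (set Q)))" by (rule arg_cong)
    then show ?thesis using Q(2-5) by (simp add: distinct_card)
  qed
  note ds = deg_sum[OF assms(1-3)] deg_sum[OF cw(1) Q(6) cw(2)]
  have "card V \<le> card {z. A w z} + card {z. A z s} + 1" "card V \<le> card {z. A s z} + card {z. A z w} + 1"
    using ore[of w s] ore[of s w] assms(2,4,5) Q(5,6) by auto
  with ds have eq: "card {z. A z w} = card {z. A z s}" by linarith
  show ?thesis
  proof (rule configI)
    show "A v' (hd Q) \<and> A (last Q) v \<and> successively (\<lambda>x y. A x v \<noteq> A v' y) Q"
      if "v \<in> set [w] \<and> v' \<in> set [w] \<or> v \<in> set [s] \<and> v' \<in> set [s]" for v v'
      using that xw xwQ xsQ Q(9,10) by auto
    show "card {x \<in> set Q. A x w} = card {x \<in> set Q. A x s}" using eq arcs by simp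
    show "V = set Q \<union> set [w] \<union> set [s]" using assms(2,3) by auto
  qed (use assms(4-6) Q nonham in auto)
qed

lemma last_in_one:
  assumes "cyc (s # Q)" "w \<in> V" "set (s # Q) = V - {w}" "\<not> A s w" "\<not> A w s" "2 \<le> length Q"
  shows "A w (last Q) \<or> A s (last Q)"
proof -
  interpret c: config V A "\<lambda>i. Q ! (i - 1)" "length Q" "[w]" "[s]" "\<lambda>i. A (Q ! (i - 1)) w" "\<lambda>i. A (Q ! (i - 1)) s"
    by (rule config_pair[OF assms])
  have "length Q = Suc (length Q - 1)" "1 \<le> length Q - 1" "Q \<noteq> []" using assms(6) by auto
  with c.last[of "length Q - 1"] c.outU[of w "length Q - 1"] c.outS[of s "length Q - 1"]
  show ?thesis using assms(6) by (auto simp: last_conv_nth)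
qed

end

section \<open>The missed vertex compared with a cycle vertex not adjacent to it\<close>

lemma one_le_card: "x \<in> S \<Longrightarrow> finite S \<Longrightarrow> 1 \<le> card S"
  by (metis One_nat_def Suc_leI card_gt_0_iff empty_iff)

text \<open>By \<open>not_a1\<close> the first path vertex is entered from \<open>u\<close> without
  an arc back; this asymmetry drives the whole analysis.\<close>

locale config_one = config V A y q "[u]" "[s]" a e + critical V A
  for V :: "'a set" and A y q u s a e +
  assumes not_a1: "\<not> a 1"
begin

lemma e1: "e 1" using first not_a1 by blast

lemma arcs_us [simp]:
  "1 \<le> i \<Longrightarrow> i \<le> q \<Longrightarrow> A (y i) u \<longleftrightarrow> a i" "1 \<le> i \<Longrightarrow> i < q \<Longrightarrow> A u (y (Suc i)) \<longleftrightarrow> \<not> a i"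
  "1 \<le> i \<Longrightarrow> i \<le> q \<Longrightarrow> A (y i) s \<longleftrightarrow> e i" "1 \<le> i \<Longrightarrow> i < q \<Longrightarrow> A s (y (Suc i)) \<longleftrightarrow> \<not> e i"
  "A u (y (Suc 0))" "A s (y (Suc 0))" "\<not> A u s" "\<not> A s u"
  using inU[of u] outU[of u] inS[of s] outS[of s] outU1[of u] outS1[of s] no_US[of u s] by simp_all

lemma us_V [simp]: "u \<in> V" "s \<in> V" "u \<noteq> s" "s \<noteq> u"
  using V_eq disj by auto

lemma y_ne_us [simp]: "1 \<le> k \<Longrightarrow> k \<le> q \<Longrightarrow> y k \<noteq> u" "1 \<le> k \<Longrightarrow> k \<le> q \<Longrightarrow> y k \<noteq> s"
  "1 \<le> k \<Longrightarrow> k \<le> q \<Longrightarrow> u \<noteq> y k" "1 \<le> k \<Longrightarrow> k \<le> q \<Longrightarrow> s \<noteq> y k"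
  using y_notin[of k] by auto

lemma us_notin_seg [simp]: "1 \<le> i \<Longrightarrow> j \<le> q \<Longrightarrow> u \<notin> set (seg i j)" "1 \<le> i \<Longrightarrow> j \<le> q \<Longrightarrow> s \<notin> set (seg i j)"
  by (auto simp: seg_def simp del: upt_Suc)

lemma noham1:
  assumes "successively A c" "A (last c) (hd c)" "length c = q + 2"
    "\<And>k. 1 \<le> k \<Longrightarrow> k \<le> q \<Longrightarrow> y k \<in> set c" "u \<in> set c" "s \<in> set c"
  shows False
  by (rule noham[of c]) (use assms card_V in auto)

lemma cyc_missing:
  assumes "successively A c" "A (last c) (hd c)" "length c = q + 1" "1 \<le> n" "n \<le> q"
    "\<And>k. 1 \<le> k \<Longrightarrow> k \<le> q \<Longrightarrow> y k \<in> set c \<longleftrightarrow> k \<noteq> n" "u \<in> set c" "s \<in> set c"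
  shows "cyc c" "set c = V - {y n}"
proof -
  have sub: "V - {y n} \<subseteq> set c"
  proof
    fix x assume x: "x \<in> V - {y n}"
    then have "x \<in> V" by simp
    then show "x \<in> set c" by (cases x rule: V_cases) (use x assms(6-8) in auto)
  qed
  have "card (V - {y n}) = q + 1" using card_V y_V[OF assms(4,5)] by simp
  moreover have "c \<noteq> []" using assms(3) by auto
  ultimately show "cyc c" "set c = V - {y n}"
    using cyc_of_cover[OF assms(1,2) _ _ sub] assms(3) by auto
qed

lemma bet_pos: "1 \<le> bet" "bet + 1 \<le> q"
proof -
  show "1 \<le> bet" unfolding bet_def by (rule one_le_card[of q]) (use aq q2 in auto)
  have "1 \<le> card {k \<in> {1..<q}. \<not> a k}" by (rule one_le_card[of 1]) (use not_a1 q2 in auto)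
  then show "bet + 1 \<le> q" using card_zeros by linarith
qed

lemma card_zeros_e: "card {k \<in> {1..<q}. \<not> e k} + bet = q"
proof -
  interpret sw: config V A y q "[s]" "[u]" e a by (rule swap)
  show ?thesis using sw.card_zeros by (simp add: sw.bet_def bet_e)
qed

lemma back1: "2 \<le> j \<Longrightarrow> j \<le> q \<Longrightarrow> A (y j) (y 1) \<Longrightarrow> e j"
  using back_a[of 1 j] not_a1 e1 by simp

lemma forward1: "2 \<le> k \<Longrightarrow> k < q \<Longrightarrow> A (y 1) (y (Suc k)) \<Longrightarrow> \<not> e k"
  using forward_a[of 1 k] not_a1 by simp

lemma ends_before:
  assumes "i < j" "e i" "\<not> e j" obtains p where "i \<le> p" "p < j" "e p" "\<not> e (Suc p)"
proof -
  have "\<exists>p. i \<le> p \<and> p < j \<and> e p \<and> \<not> e (Suc p)"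
  proof (rule ccontr)
    assume "\<not> ?thesis"
    then have *: "\<And>p. i \<le> p \<Longrightarrow> p < j \<Longrightarrow> e p \<Longrightarrow> e (Suc p)" by blast
    have "k \<le> j \<Longrightarrow> e k" if "i \<le> k" for k
      using that by (induction k rule: dec_induct) (use assms * in auto)
    then show False using assms by auto
  qed
  then show ?thesis using that by blast
qed

text \<open>Where \<open>e\<close> falls, \<open>s\<close> can replace \<open>y (Suc p)\<close>, so
  criticality applies to that vertex too.\<close>

lemma descent_cyc:
  assumes "1 \<le> p" "e p" "\<not> e (Suc p)" "Suc p < q"
  defines "c \<equiv> seg 1 p @ [s] @ seg (Suc (Suc p)) q @ [u]"
  shows "cyc c" "set c = V - {y (Suc p)}"
proof -
  have "successively A c" "A (last c) (hd c)" "length c = q + 1"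
    "\<And>k. 1 \<le> k \<Longrightarrow> k \<le> q \<Longrightarrow> y k \<in> set c \<longleftrightarrow> k \<noteq> Suc p" "u \<in> set c" "s \<in> set c"
    using assms by (auto simp: c_def successively_append_iff successively_Cons)
  then show "cyc c" "set c = V - {y (Suc p)}"
    using cyc_missing[of c "Suc p"] assms(4) by auto
qed

text \<open>After a descent \<open>y (Suc p)\<close> has no arc to \<open>y 1\<close>, and its
  degrees sum to N - 1. The condition therefore transfers its indegree, at least bet, to
  \<open>y 1\<close>.\<close>

lemma in_1: "bet \<le> card {z. A z (y 1)}"
proof -
  have "\<exists>k. 1 \<le> k \<and> k < q \<and> \<not> e k"
  proof (rule ccontr)
    assume "\<not> ?thesis"
    then have "{k \<in> {1..<q}. \<not> e k} = {}" by auto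
    then have "card {k \<in> {1..<q}. \<not> e k} = 0" by (simp only: card.empty)
    then show False using card_zeros_e bet_pos by linarith
  qed
  then obtain k where k: "1 \<le> k" "k < q" "\<not> e k" by blast
  then have "1 < k" using e1 by (cases "k = 1") auto
  then obtain p where p: "1 \<le> p" "p < k" "e p" "\<not> e (Suc p)" using ends_before[of 1 k] e1 k by blast
  then have sp: "Suc p < q" using k by simp
  have na: "\<not> A (y (Suc p)) (y 1)" using back1[of "Suc p"] p sp by auto
  have "card V \<le> card {z. A (y (Suc p)) z} + card {z. A z (y 1)} + 1"
    by (rule ore) (use sp na p y_inj[of "Suc p" 1] in auto)
  moreover have "card {z. A (y (Suc p)) z} + card {z. A z (y (Suc p))} + 1 = card V"
    using deg_sum[OF descent_cyc(1)[OF p(1,3,4) sp] _ descent_cyc(2)[OF p(1,3,4) sp]] sp by simp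
  moreover have "bet \<le> card {z. A z (y (Suc p))}" using in_ge_e[of p] p sp by simp
  ultimately show ?thesis by linarith
qed

text \<open>By \<open>back1\<close> only \<open>u\<close>, \<open>s\<close> and the bet - 1 later
  path vertices with label \<open>e\<close> can have arcs to \<open>y 1\<close>. As the indegree is
  at least bet, at most one of these bet + 1 candidates fails.\<close>

lemma miss_in:
  assumes "2 \<le> j" "j \<le> q" "e j" "2 \<le> k" "k \<le> q" "e k" "j \<noteq> k"
  shows "A (y j) (y 1) \<or> A (y k) (y 1)"
proof (rule ccontr)
  assume n: "\<not> ?thesis"
  let ?X = "{i \<in> {1..q}. e i} - {1, j, k}"
  have "card {z. A z (y 1)} \<le> card ?X + length [u] + length [s]"
  proof (rule in_le_1)
    fix i assume i: "1 \<le> i" "i \<le> q" "A (y i) (y 1)"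
    then have "i \<noteq> 1" by auto
    then show "i \<in> ?X" using i n back1[of i] by auto
  qed auto
  moreover have "card ?X = bet - 3"
    unfolding bet_e using assms e1 q2 by (subst card_Diff_subset) auto
  moreover have "3 \<le> bet"
  proof -
    have "card {1, j, k} \<le> bet" unfolding bet_e by (rule card_mono) (use assms e1 q2 in auto)
    then show ?thesis using assms by auto
  qed
  ultimately show False using in_1 by simp
qed

text \<open>The dual count: the out-neighbours of \<open>y 1\<close> are among \<open>s\<close>,
  \<open>y 2\<close> and the successors of zeros of \<open>e\<close>, and only one candidate may
  fail.\<close>

lemma miss_out:
  assumes "2 \<le> j" "j < q" "\<not> e j" "2 \<le> k" "k < q" "\<not> e k" "j \<noteq> k"
  shows "A (y 1) (y (Suc j)) \<or> A (y 1) (y (Suc k))"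
proof (rule ccontr)
  assume n: "\<not> ?thesis"
  let ?Z = "{i \<in> {1..<q}. \<not> e i}"
  let ?X = "insert 2 (Suc ` (?Z - {j, k}))"
  have "card {z. A (y 1) z} \<le> card ?X + (if a 1 then length [u] else 0) + (if e 1 then length [s] else 0)"
  proof (rule out_le)
    fix i assume i: "1 \<le> i" "i \<le> q" "A (y 1) (y i)"
    then have "i \<noteq> 1" by auto
    then obtain i' where i': "i = Suc i'" "1 \<le> i'" using i by (cases i) auto
    show "i \<in> ?X"
    proof (cases "i' = 1")
      case False
      then show ?thesis using i i' n forward1[of i'] by auto
    qed (use i' in auto)
  qed (use q2 in auto)
  moreover have "card ?X \<le> card (?Z - {j, k}) + 1"
    by (rule order_trans[OF card_insert_le_m1]) (auto simp: card_image)
  moreover have "card (?Z - {j, k}) + 2 = card ?Z"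
  proof -
    have "card {j, k} \<le> card ?Z" by (rule card_mono) (use assms in auto)
    then show ?thesis using assms by (subst card_Diff_subset) auto
  qed
  moreover have "q + 1 \<le> card {z. A (y 1) z} + bet" using out_ge_a[of 1] not_a1 q2 by simp
  ultimately show False using card_zeros_e not_a1 e1 by simp
qed

text \<open>Neither \<open>y 1\<close> nor \<open>s\<close> is adjacent to \<open>y (Suc p)\<close>,
  so they are never consecutive on a cycle missing it. Each of the two excluded arcs would create
  such a cycle. The labels are read off the cycle of \<open>descent_cyc\<close>.\<close>

lemma descent:
  assumes "2 \<le> p" "e p" "\<not> e (Suc p)" "Suc p < q"
  shows "\<not> A (y p) (y 1)" "\<not> A (y 1) (y (Suc (Suc p)))" "\<not> a p" "a (Suc p)"
proof -
  let ?n = "Suc p"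
  have nn: "\<not> A (y 1) (y ?n)" "\<not> A (y ?n) (y 1)" "\<not> A s (y ?n)" "\<not> A (y ?n) s"
    using forward1[of p] back1[of ?n] assms by auto
  show "\<not> A (y p) (y 1)"
  proof
    assume b: "A (y p) (y 1)"
    let ?c = "[s] @ seg (Suc ?n) q @ [u] @ seg 2 p @ [y 1]"
    have "successively A ?c" "A (last ?c) (hd ?c)" "length ?c = q + 1"
      "\<And>k. 1 \<le> k \<Longrightarrow> k \<le> q \<Longrightarrow> y k \<in> set ?c \<longleftrightarrow> k \<noteq> ?n" "u \<in> set ?c" "s \<in> set ?c"
      using assms b not_a1 e1 arcs_us(2)[of 1] by (auto simp: successively_append_iff successively_Cons y_inj numeral_2_eq_2)
    from cyc_missing[OF this(1-3) _ _ this(4-6)] have "cyc ?c" "set ?c = V - {y ?n}" using assms by auto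
    from miss[OF this(1) _ this(2)] show False using nn assms by simp
  qed
  show "\<not> A (y 1) (y (Suc ?n))"
  proof
    assume b: "A (y 1) (y (Suc ?n))"
    let ?c = "[y 1] @ seg (Suc ?n) q @ [u] @ seg 2 p @ [s]"
    have "successively A ?c" "A (last ?c) (hd ?c)" "length ?c = q + 1"
      "\<And>k. 1 \<le> k \<Longrightarrow> k \<le> q \<Longrightarrow> y k \<in> set ?c \<longleftrightarrow> k \<noteq> ?n" "u \<in> set ?c" "s \<in> set ?c"
      using assms b not_a1 e1 arcs_us(2)[of 1] by (auto simp: successively_append_iff successively_Cons y_inj numeral_2_eq_2)
    from cyc_missing[OF this(1-3) _ _ this(4-6)] have "cyc ?c" "set ?c = V - {y ?n}" using assms by auto
    from miss[OF this(1) _ this(2)] show False using nn assms by simp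
  qed
  have "1 \<le> p" using assms by simp
  note dc = descent_cyc[OF this assms(2-4)]
  show "\<not> a p" using miss[OF dc(1) _ dc(2)] nn assms by auto
  have eq: "seg 1 p @ [s] @ seg (Suc ?n) q @ [u] = y 1 # (seg 2 p @ [s] @ seg (Suc ?n) q @ [u])"
    using assms by (auto simp: seg_def upt_conv_Cons numeral_2_eq_2 simp del: upt_Suc)
  \<comment> \<open>Now \<open>y (Suc p)\<close> is the missed vertex, \<open>y 1\<close> the one
    not adjacent to it, and the path between ends in \<open>u\<close>.\<close>
  from last_in_one[OF dc(1)[unfolded eq] _ dc(2)[unfolded eq]] show "a ?n" using nn assms not_a1 q2 by auto
qed

text \<open>A descent uses up the one exception that \<open>miss_in\<close> tolerates.\<close>

lemma descent_unique:
  assumes "2 \<le> p" "e p" "\<not> e (Suc p)" "Suc p < q" "2 \<le> p'" "e p'" "\<not> e (Suc p')" "Suc p' < q"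
  shows "p = p'"
  using miss_in[of p p'] descent(1)[of p] descent(1)[of p'] assms by (metis Suc_leD less_imp_le_nat)

text \<open>If the last label before q were 1, that vertex would have an arc to \<open>y 1\<close>,
  hence label \<open>a\<close> by \<open>back_e\<close>, against \<open>last\<close>. A 1 further
  left would lead to a second descent.\<close>

lemma descent_tail:
  assumes "2 \<le> p" "e p" "\<not> e (Suc p)" "Suc p < q" "Suc p \<le> k" "k < q"
  shows "\<not> e k"
proof
  assume ek: "e k"
  obtain r where r: "q = Suc r" using q2 by (cases q) auto
  have er: "\<not> e r"
  proof
    assume e: "e r"
    then have pr: "Suc p < r" using assms r by (cases "r = Suc p") auto
    have "A (y r) (y 1)" using miss_in[of p r] descent(1)[OF assms(1-4)] assms(1-4) pr r e by auto
    then have "a r" using back_e[of "Suc p" r] descent(4)[OF assms(1-4)] assms(3) pr r by auto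
    then show False using last[of r] e pr r by auto
  qed
  have "k < r" using er assms ek r by (cases "k = r") auto
  from ends_before[OF this ek er] obtain p' where "k \<le> p'" "p' < r" "e p'" "\<not> e (Suc p')" by blast
  then show False using descent_unique[OF assms(1-4), of p'] assms r by simp
qed

lemma in_1_all: 
  assumes "2 \<le> p" "e p" "\<not> e (Suc p)" "Suc p < q" "2 \<le> j" "j \<le> q" "e j" "j \<noteq> p"
  shows "A (y j) (y 1)"
  using miss_in[of p j] descent(1)[of p] assms by auto

text \<open>The descent uses up the exception in \<open>miss_out\<close>, so \<open>y 1\<close> has
  an arc to \<open>y (Suc j)\<close>, and a backward arc would complete a Hamilton cycle. For k > 2
  the label at k - 1 lets \<open>y 1\<close> follow \<open>y (k - 1)\<close>.\<close>

lemma no_back: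
  assumes "2 \<le> p" "e p" "\<not> e (Suc p)" "Suc p < j" "j < q" "\<not> e j" "2 \<le> k" "k \<le> p" "k = 2 \<or> e (k - 1)"
  shows "\<not> A (y j) (y k)"
proof
  assume b: "A (y j) (y k)"
  have sp: "Suc p < q" using assms by simp
  note d = descent[OF assms(1-3) sp]
  have j1: "A (y 1) (y (Suc j))" using miss_out[of "Suc p" j] d(2) assms by auto
  show False
  proof (cases "k = 2")
    case True
    show False
      by (rule noham1[of "[u] @ seg 1 1 @ seg (Suc j) q @ [s] @ seg (Suc (Suc p)) j @ seg 2 (Suc p)"])
        (use assms b d j1 True in \<open>auto simp: successively_append_iff successively_Cons\<close>)
  next
    case False
    then obtain k' where k': "k = Suc k'" "2 \<le> k'" using assms(7) by (cases k) auto
    then have "A (y k') (y 1)" using in_1_all[OF assms(1-3) sp, of k'] assms False by auto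
    then show False
      by (intro noham1[of "[u] @ seg 2 k' @ seg 1 1 @ seg (Suc j) q @ [s] @ seg (Suc (Suc p)) j @ seg k (Suc p)"])
        (use assms b d j1 k' not_a1 arcs_us(2)[of 1] in \<open>auto simp: successively_append_iff successively_Cons numeral_2_eq_2\<close>)
  qed
qed

lemma card_labels: "card {i \<in> {1..q}. a i \<and> \<not> e i} = card {i \<in> {1..q}. \<not> a i \<and> e i}"
proof -
  have "card {i \<in> {1..q}. a i} = card {i \<in> {1..q}. a i \<and> e i} + card {i \<in> {1..q}. a i \<and> \<not> e i}"
    by (subst card_Un_disjoint[symmetric]) (auto intro!: arg_cong[where f = card])
  moreover have "card {i \<in> {1..q}. e i} = card {i \<in> {1..q}. a i \<and> e i} + card {i \<in> {1..q}. \<not> a i \<and> e i}"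
    by (subst card_Un_disjoint[symmetric]) (auto intro!: arg_cong[where f = card])
  ultimately show ?thesis using same_count by simp
qed

text \<open>The path closed by \<open>u\<close> misses \<open>s\<close>. If \<open>e\<close>
  alternates, the arc from \<open>s\<close> to a path vertex is present exactly when the opposite
  arc is.\<close>

lemma alternating_s:
  assumes "\<And>i. 1 \<le> i \<Longrightarrow> i < q \<Longrightarrow> e (Suc i) \<longleftrightarrow> \<not> e i"
  shows alternating
  unfolding alternating_def
proof (intro exI[of _ "seg 1 q @ [u]"] exI[of _ s] conjI ballI)
  have q1: "1 \<le> q" using q2 by simp
  have "distinct (seg 1 q)" "set (seg 1 q) \<subseteq> V" "u \<notin> set (seg 1 q)"
    using inj V_eq q1 by (auto simp: seg_def distinct_map atLeastLessThanSuc_atLeastAtMost simp del: upt_Suc)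
  then show "cyc (seg 1 q @ [u])" unfolding cyc_def
    using q1 by (auto simp: successively_append_iff)
  show "set (seg 1 q @ [u]) = V - {s}"
    using V_eq disj by (auto simp: seg_def atLeastLessThanSuc_atLeastAtMost simp del: upt_Suc)
  fix x assume "x \<in> set (seg 1 q @ [u])"
  then consider "x = u" | k where "x = y k" "1 \<le> k" "k \<le> q" by (auto simp: seg_def simp del: upt_Suc)
  then show "A x s \<longleftrightarrow> A s x"
  proof cases
    case (2 k)
    then show ?thesis using assms[of "k - 1"] e1 by (cases "k = 1"; cases k) auto
  qed simp
qed simp

end

section \<open>Determining the labels\<close>

context config_one
begin

lemma ex_zero: "\<exists>k. 1 < k \<and> k < q \<and> \<not> e k"
proof (rule ccontr)
  assume *: "\<not> ?thesis"
  have "e k" if "1 \<le> k" "k < q" for k using * e1 that by (cases "k = 1") auto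
  then have "{k \<in> {1..<q}. \<not> e k} = {}" by auto
  then have "card {k \<in> {1..<q}. \<not> e k} = 0" by (simp only: card.empty)
  then show False using card_zeros_e bet_pos by linarith
qed

lemma card_in_y_a:
  assumes "1 \<le> i" "i < q" "a i" "e i" "finite X" "\<And>k. 1 \<le> k \<Longrightarrow> k \<le> q \<Longrightarrow> A (y k) (y (Suc i)) \<Longrightarrow> k \<in> X"
  shows "bet \<le> card X"
  using in_ge_a[OF assms(1-3)] in_le_Suc[OF assms(1,2,5,6)] assms(3,4) by simp

lemma card_out_y:
  assumes "1 \<le> i" "i \<le> q" "\<not> e i" "finite X" "\<And>k. 1 \<le> k \<Longrightarrow> k \<le> q \<Longrightarrow> A (y i) (y k) \<Longrightarrow> k \<in> X"
  shows "q + 1 \<le> card X + (if a i then 1 else 0) + bet"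
  using out_ge_e[OF assms(1-3)] out_le[OF assms(1,2,4,5)] assms(3) by (cases "a i") simp_all

text \<open>Here \<open>e\<close> is a block of ones, a block of zeros and a final 1. Counting
  shrinks it to 1, 1, 0, 0, 1 with 0, 0, 1, 1, 1 for \<open>a\<close>, and then \<open>y 3\<close>
  is the missed vertex that exhibits the alternation.\<close>

lemma case_e2:
  assumes e2: "e 2"
  shows alternating
proof -
  obtain k where k: "1 < k" "k < q" "\<not> e k" using ex_zero by blast
  define n where "n = (LEAST k. 1 < k \<and> k < q \<and> \<not> e k)"
  have n: "1 < n" "n < q" "\<not> e n" using LeastI[of "\<lambda>k. 1 < k \<and> k < q \<and> \<not> e k" k] k by (auto simp: n_def)
  have below: "e k" if "1 \<le> k" "k < n" for k
    using not_less_Least[of k "\<lambda>k. 1 < k \<and> k < q \<and> \<not> e k"] that n e1 by (cases "k = 1") (auto simp: n_def)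
  have "n \<noteq> 2" using e2 n by auto
  then obtain p where p: "n = Suc p" "2 \<le> p" using n by (cases n) auto
  have ep: "e p" "\<not> e (Suc p)" "Suc p < q" using below n p by auto
  note d = descent[OF p(2) ep]
  have zeros: "\<not> e k" if "n \<le> k" "k < q" for k
    using descent_tail[OF p(2) ep] that p(1) by simp
  have e_set: "{i \<in> {1..q}. e i} = insert q {1..p}" 
  proof (rule set_eqI)
    fix i show "i \<in> {i \<in> {1..q}. e i} \<longleftrightarrow> i \<in> insert q {1..p}"
      using below[of i] zeros[of i] p n eq by (cases "i = q"; cases "i < n") auto
  qed
  have bet: "bet = n" unfolding bet_e e_set using n p by simp
  have P01: "1 \<in> {i \<in> {1..q}. \<not> a i \<and> e i}" "p \<in> {i \<in> {1..q}. \<not> a i \<and> e i}"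
    using e1 not_a1 d ep p n by auto
  \<comment> \<open>Two indices where only \<open>e\<close> holds require two where only
    \<open>a\<close> holds, and these lie between n and q.\<close>
  have "2 \<le> card {i \<in> {1..q}. \<not> a i \<and> e i}"
    using card_mono[of "{i \<in> {1..q}. \<not> a i \<and> e i}" "{1, p}"] P01 p by auto
  then have c10: "2 \<le> card {i \<in> {1..q}. a i \<and> \<not> e i}" by (simp only: card_labels)
  have sub10: "{i \<in> {1..q}. a i \<and> \<not> e i} \<subseteq> {n..<q}"
  proof
    fix i assume "i \<in> {i \<in> {1..q}. a i \<and> \<not> e i}"
    then show "i \<in> {n..<q}" using below[of i] eq by (cases "i = q"; cases "i < n") auto
  qed
  have q_n: "Suc n < q" using c10 card_mono[OF _ sub10] by simp
  have nb: "\<not> A (y j) (y k)" if "n < j" "j < q" "2 \<le> k" "k \<le> p" for j k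
    using no_back[OF p(2) ep(1,2), of j k] that zeros[of j] p below[of "k - 1"] by auto
  have target: "n \<le> k" if "n < j" "j < q" "1 \<le> k" "k \<le> q" "A (y j) (y k)" for j k
  proof (rule ccontr)
    assume "\<not> n \<le> k"
    then show False using nb[of j k] back1[of j] zeros[of j] that p by (cases "k = 1") auto
  qed
  have aj: "a j" if j: "n < j" "j < q" for j
  proof (rule ccontr)
    assume na: "\<not> a j"
    have "q + 1 \<le> card ({n..q} - {j}) + (if a j then 1 else 0) + bet"
    proof (rule card_out_y)
      fix k assume "1 \<le> k" "k \<le> q" "A (y j) (y k)"
      then show "k \<in> {n..q} - {j}" using target[OF j] by auto
    qed (use j zeros[of j] in auto)
    then show False using na bet j by simp
  qed
  \<comment> \<open>All labels \<open>a\<close> beyond j are 1, which excludes forward chords from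
    \<open>y j\<close>; it has enough out-neighbours only if j + 1 = q.\<close>
  have long: "q \<le> Suc j" if j: "n < j" "j < q" for j
  proof -
    have "q + 1 \<le> card ({n..<j} \<union> {Suc j}) + (if a j then 1 else 0) + bet"
    proof (rule card_out_y)
      fix k assume k: "1 \<le> k" "k \<le> q" "A (y j) (y k)"
      have "k \<le> Suc j"
      proof (rule ccontr)
        assume "\<not> k \<le> Suc j"
        then obtain k' where k': "k = Suc k'" "j < k'" by (cases k) auto
        then show False using forward_e[of j k'] aj[of k'] zeros[of j] k j by auto
      qed
      then show "k \<in> {n..<j} \<union> {Suc j}" using target[OF j k] k by (cases "k = j") auto
    qed (use j zeros[of j] in auto)
    then show ?thesis using bet j by (simp split: if_splits)
  qed
  have q_eq: "q = Suc (Suc n)" using long[of "Suc n"] q_n by simp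
  \<comment> \<open>Otherwise both labels at i = p - 1 are 1, and \<open>y p\<close> has at most i +
    1 in-neighbours on the path where bet = i + 2 are needed.\<close>
  have "p = 2"
  proof (rule ccontr)
    assume "p \<noteq> 2"
    then obtain i where i: "p = Suc i" "2 \<le> i" using p by (cases p) auto
    have "card {i \<in> {1..q}. a i \<and> \<not> e i} \<le> 2" using card_mono[OF _ sub10] q_eq by simp
    then have c01: "card {i \<in> {1..q}. \<not> a i \<and> e i} \<le> 2" by (simp only: card_labels)
    have ei: "e i" using below i p by simp
    have ai: "a i"
    proof (rule ccontr)
      assume "\<not> a i"
      then have "{1, p, i} \<subseteq> {i \<in> {1..q}. \<not> a i \<and> e i}" using P01 ei i p n by auto
      from card_mono[OF _ this] have "card {1, p, i} \<le> 2" using c01 by simp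
      then show False using i by simp
    qed
    have "bet \<le> card ({2..i} \<union> {n, q})"
    proof (rule card_in_y_a[of i])
      fix k assume k: "1 \<le> k" "k \<le> q" "A (y k) (y (Suc i))"
      have "k \<noteq> 1" using forward1[of i] ei i k p n by auto
      moreover have "k \<noteq> p" using k i by auto
      moreover have "k \<noteq> Suc n" using nb[of "Suc n" p] k i p q_n by auto
      ultimately show "k \<in> {2..i} \<union> {n, q}" using k i p q_eq by auto
    qed (use i p n ai ei in auto)
    also have "card ({2..i} \<union> {n, q}) \<le> card {2..i} + card {n, q}" by (rule card_Un_le)
    also have "\<dots> = i + 1" using i n by simp
    finally show False using bet i p by simp
  qed
  then have n3: "n = 3" "q = 5" "p = 2" using p q_eq by simp_all
  have lab: "\<not> a 1" "\<not> a 2" "a 3" "a 4" "e 1" "e 2" "\<not> e 3" "\<not> e 4"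
    using not_a1 d aj[of 4] e1 ep zeros[of 3] zeros[of 4] n3 by (auto simp: numeral_eq_Suc)
  have sts: "A (y 2) (y 3)" "A (y 3) (y 4)" using step[of 2] step[of 3] n3 by (auto simp: numeral_eq_Suc)
  have dc: "cyc (seg 1 2 @ [s] @ seg 4 5 @ [u])" "set (seg 1 2 @ [s] @ seg 4 5 @ [u]) = V - {y 3}"
    using descent_cyc[of 2] lab n3 by (simp_all add: numeral_eq_Suc)
  have y3: "y 3 \<in> V" using n3 by simp
  have u3: "A u (y 3)" "A (y 3) u" "\<not> A s (y 3)" "\<not> A (y 3) s"
    using arcs_us(1,3)[of 3] arcs_us(2,4)[of 2] lab n3 by (simp_all add: numeral_eq_Suc)
  have y13: "\<not> A (y 1) (y 3)" "\<not> A (y 3) (y 1)"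
    using forward1[of 2] back1[of 3] lab n3 by (auto simp: numeral_eq_Suc)
  have sg: "seg 1 2 = [y 1, y 2]" "seg 4 5 = [y 4, y 5]" by (simp_all add: seg_def numeral_eq_Suc)
  from xor_path[OF dc(1) y3 dc(2)] have y23: "A (y 3) (y 2)" and y53: "\<not> A (y 5) (y 3)"
    using y13 u3 unfolding sg by auto
  have y35: "\<not> A (y 3) (y 5)" using forward_e[of 3 4] lab n3 by (auto simp: numeral_eq_Suc)
  have y43: "A (y 4) (y 3)"
  proof (rule ccontr)
    assume nA: "\<not> A (y 4) (y 3)"
    have "q + 1 \<le> card {5::nat} + (if a 4 then 1 else 0) + bet"
    proof (rule card_out_y)
      fix k assume k: "1 \<le> k" "k \<le> q" "A (y 4) (y k)"
      then have "k \<noteq> 3" "k \<noteq> 4" using nA by auto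
      then show "k \<in> {5}" using target[of 4 k] k n3 by auto
    qed (use n3 lab in auto)
    then show False using bet n3 by (simp split: if_splits)
  qed
  show ?thesis unfolding alternating_def
  proof (intro exI conjI ballI)
    fix x assume "x \<in> set (seg 1 2 @ [s] @ seg 4 5 @ [u])"
    then have "x = y 1 \<or> x = y 2 \<or> x = s \<or> x = y 4 \<or> x = y 5 \<or> x = u" unfolding sg by auto
    then show "A x (y 3) \<longleftrightarrow> A (y 3) x"
      by (elim disjE) (simp_all only: u3 y13 y23 y53 y35 y43 sts)
  qed (rule dc y3)+
qed

text \<open>If \<open>a\<close> failed at i too, a forward chord could end only after a zero of
  \<open>e\<close>. The targets would then inject into the zeros of \<open>e\<close>: at most q -
  bet of them, one too few.\<close>

lemma zeros_run:
  assumes "2 \<le> i" "i < q" "\<And>j. 2 \<le> j \<Longrightarrow> j \<le> i \<Longrightarrow> \<not> e j"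
  shows "a i"
proof (rule ccontr)
  assume na: "\<not> a i"
  have ne: "\<not> e i" using assms by simp
  let ?Z = "{k \<in> {i..<q}. \<not> e k}"
  have "q + 1 \<le> card ({2..<i} \<union> Suc ` ?Z) + (if a i then 1 else 0) + bet"
  proof (rule card_out_y)
    fix k assume k: "1 \<le> k" "k \<le> q" "A (y i) (y k)"
    have "k \<noteq> 1" using back1[of i] ne k assms by auto
    moreover have "k \<noteq> i" using k by auto
    moreover have "k \<in> Suc ` ?Z" if "i < k"
    proof -
      obtain k' where k': "k = Suc k'" "i \<le> k'" using \<open>i < k\<close> by (cases k) auto
      then have "\<not> e k'" using forward_a[of i k'] k na ne assms by (cases "k' = i") auto
      then show ?thesis using k k' by auto
    qed
    ultimately show "k \<in> {2..<i} \<union> Suc ` ?Z" using k by (cases "i < k") auto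
  qed (use assms ne in auto)
  also have "card ({2..<i} \<union> Suc ` ?Z) \<le> card {2..<i} + card ?Z"
    by (rule order_trans[OF card_Un_le]) (simp add: card_image)
  also have "card {2..<i} + card ?Z = card ({2..<i} \<union> ?Z)" by (subst card_Un_disjoint) auto
  also have "\<dots> \<le> card {k \<in> {1..<q}. \<not> e k}" by (rule card_mono) (use assms in auto)
  finally show False using na card_zeros_e by simp
qed

text \<open>Since \<open>a 2\<close> holds, \<open>back_e\<close> gives label \<open>a\<close> to
  all later vertices with an arc to \<open>y 1\<close>. By \<open>miss_in\<close> there are then at
  most two indices of either mixed kind. The words of \<open>e\<close> that survive are 1, 0, 1 and
  1, 0, 1, 0, 1, both alternating; 1, 0, 0, 1, 1 is refuted at the end.\<close>

lemma case_not_e2: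
  assumes e2: "\<not> e 2"
  shows alternating
proof -
  have q3: "3 \<le> q" using e2 eq q2 by (cases "q = 2") auto
  have a2: "a 2"
  proof (rule zeros_run)
    fix j :: nat assume "2 \<le> j" "j \<le> 2"
    then have "j = 2" by simp
    then show "\<not> e j" using e2 by simp
  qed (use q3 in auto)
  let ?P10 = "{i \<in> {1..q}. a i \<and> \<not> e i}" and ?P01 = "{i \<in> {1..q}. \<not> a i \<and> e i}"
  have in10: "2 \<in> ?P10" and in01: "1 \<in> ?P01" using a2 e2 q3 e1 not_a1 by auto
  have in1_a: "a j" if "3 \<le> j" "j \<le> q" "A (y j) (y 1)" for j
    using back_e[of 2 j] a2 e2 that by auto
  have uniq: "j = k" if "3 \<le> j" "j \<le> q" "e j" "\<not> a j" "3 \<le> k" "k \<le> q" "e k" "\<not> a k" for j k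
    using miss_in[of j k] in1_a[of j] in1_a[of k] that by auto
  have c01: "card ?P01 \<le> 2"
  proof (cases "\<exists>z\<ge>3. z \<le> q \<and> e z \<and> \<not> a z")
    case True
    then obtain z where z: "3 \<le> z" "z \<le> q" "e z" "\<not> a z" by blast
    have "?P01 \<subseteq> {1, z}"
    proof
      fix i assume i: "i \<in> ?P01"
      then have "i \<noteq> 2" using a2 by auto
      then show "i \<in> {1, z}" using i uniq[OF z, of i] by (cases "i = 1") auto
    qed
    then have "card ?P01 \<le> card {1, z}" by (rule card_mono[rotated]) simp
    also have "\<dots> \<le> 2" by (simp add: card_insert_if)
    finally show ?thesis .
  next
    case False
    have "?P01 \<subseteq> {1}"
    proof
      fix i assume i: "i \<in> ?P01"
      then have "i \<noteq> 2" using a2 by auto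
      then show "i \<in> {1}" using i False by (cases "i = 1") auto
    qed
    then have "card ?P01 \<le> card {1::nat}" by (rule card_mono[rotated]) simp
    then show ?thesis by simp
  qed
  have c10: "card ?P10 \<le> 2" using c01 by (simp only: card_labels)
  have fin10: "finite ?P10" by simp
  have three10: False if "{2, j, k} \<subseteq> ?P10" "j \<noteq> 2" "k \<noteq> 2" "j \<noteq> k" for j k
    using card_mono[OF fin10 that(1)] c10 that by simp
  have three01: False if "{1, j, k} \<subseteq> ?P01" "j \<noteq> 1" "k \<noteq> 1" "j \<noteq> k" for j k
    using card_mono[of ?P01, OF _ that(1)] c01 that by simp
  show ?thesis
  proof (cases "\<exists>p. 2 \<le> p \<and> e p \<and> \<not> e (Suc p) \<and> Suc p < q")
    case True
    then obtain p where p: "2 \<le> p" "e p" "\<not> e (Suc p)" "Suc p < q" by blast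
    define n where "n = Suc p"
    have p3: "3 \<le> p" using p e2 by (cases "p = 2") auto
    note d = descent[OF p]
    have e3: "e 3"
    proof (rule ccontr)
      assume n3: "\<not> e 3"
      then have "p \<noteq> 3" using p by auto
      have "a 3"
      proof (rule zeros_run)
        fix j :: nat assume "2 \<le> j" "j \<le> 3"
        then have "j = 2 \<or> j = 3" by auto
        then show "\<not> e j" using e2 n3 by auto
      qed (use p p3 in auto)
      then show False using three10[of 3 n] in10 n3 d p p3 q3 n_def by auto
    qed
    have ones: "e k" if "3 \<le> k" "k \<le> p" for k
    proof (rule ccontr)
      assume nk: "\<not> e k"
      then have "3 < k" using e3 that by (cases "k = 3") auto
      from ends_before[OF this e3 nk] obtain p' where "3 \<le> p'" "p' < k" "e p'" "\<not> e (Suc p')" by blast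
      then show False using descent_unique[OF p, of p'] that p by simp
    qed
    have a11: "a j" if "3 \<le> j" "j \<le> q" "e j" "j \<noteq> p" for j
      using uniq[of p j] that d p p3 by auto
    obtain r where r: "q = Suc r" using q2 by (cases q) auto
    have zeros: "\<not> e k" if "n \<le> k" "k < q" for k
      using descent_tail[OF p] that n_def by simp
    have er: "\<not> e r" using zeros[of r] p r n_def by simp
    have e_set: "{i \<in> {1..q}. e i} = insert 1 (insert q {3..p})"
    proof (rule set_eqI)
      fix i show "i \<in> {i \<in> {1..q}. e i} \<longleftrightarrow> i \<in> insert 1 (insert q {3..p})"
      proof (cases "i = 1 \<or> i = q \<or> i = 2 \<or> i = 0 \<or> q < i")
        case True
        then show ?thesis using e1 eq e2 q3 p by auto
      next
        case False
        then show ?thesis using ones[of i] zeros[of i] n_def by (cases "i \<le> p") auto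
      qed
    qed
    have bet: "bet = p" unfolding bet_e e_set using p p3 by simp
    have nn: "n \<noteq> 2" "n \<le> q" "a n" "\<not> e n" using d p p3 n_def by auto
    \<comment> \<open>Otherwise \<open>y r\<close> has both labels 0, and \<open>no_back\<close>
      leaves it at most q - p out-neighbours where q + 1 - p are needed.\<close>
    have q_n: "q = Suc n"
    proof (rule ccontr)
      assume "q \<noteq> Suc n"
      then have rn: "n < r" using r p n_def by simp
      have nar: "\<not> a r" using three10[of n r] in10 nn rn r er p3 n_def by auto
      have "q + 1 \<le> card ({3} \<union> {n..<r} \<union> {q}) + (if a r then 1 else 0) + bet"
      proof (rule card_out_y)
        fix k assume k: "1 \<le> k" "k \<le> q" "A (y r) (y k)"
        have "k \<noteq> 1" using back1[of r] er k rn r n_def by auto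
        moreover have "k \<noteq> r" using k by auto
        moreover have "\<not> A (y r) (y k)" if "k \<le> p" "2 \<le> k" "k \<noteq> 3"
        proof -
          have "k = 2 \<or> e (k - 1)" using ones[of "k - 1"] that by (cases "k = 2") auto
          then show ?thesis using no_back[OF p(1-3), of r k] rn r er that n_def by auto
        qed
        ultimately show "k \<in> {3} \<union> {n..<r} \<union> {q}" using k r n_def
          by (cases "k \<le> p"; cases "k = 3") auto
      qed (use er rn r in auto)
      moreover have "card ({3} \<union> {n..<r} \<union> {q}) \<le> card {3::nat} + card {n..<r} + card {q}"
        by (meson add_le_mono1 card_Un_le order_trans)
      ultimately show False using nar bet r rn n_def by simp
    qed
    \<comment> \<open>Both labels at i = p - 1 would be 1, as would those of all earlier
      in-neighbours of \<open>y p\<close>; this leaves i candidates against bet = i + 1.\<close>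
    have "p = 3"
    proof (rule ccontr)
      assume "p \<noteq> 3"
      then obtain i where i: "p = Suc i" "3 \<le> i" using p3 by (cases p) auto
      have ei: "e i" "a i" using ones[of i] a11[of i] i p by auto
      have "bet \<le> card ({3..i} \<union> {n, q})"
      proof (rule card_in_y_a[of i])
        fix k assume k: "1 \<le> k" "k \<le> q" "A (y k) (y (Suc i))"
        have "a k \<and> e k" if "k < i"
          using forward_a[of k i] forward_e[of k i] that k i ei p by auto
        then have "3 \<le> k" using i not_a1 e2 k by (cases "k = 1"; cases "k = 2") auto
        moreover have "k \<noteq> p" using k i by auto
        ultimately show "k \<in> {3..i} \<union> {n, q}" using k i q_n n_def by auto
      qed (use i p ei in auto)
      also have "card ({3..i} \<union> {n, q}) \<le> card {3..i} + card {n, q}" by (rule card_Un_le)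
      also have "\<dots> = i" using i q_n by simp
      finally show False using bet i by simp
    qed
    then have q5: "q = 5" "n = 4" using q_n n_def by auto
    show ?thesis
    proof (rule alternating_s)
      fix i assume "1 \<le> i" "i < q"
      then have "i = 1 \<or> i = 2 \<or> i = 3 \<or> i = 4" using q5 by auto
      moreover have "e (Suc 1)= (\<not> e 1)" "e (Suc 2)= (\<not> e 2)" "e (Suc 3) = (\<not> e 3)" "e (Suc 4) = (\<not> e 4)"
        using e1 e2 e3 eq nn q5 by (simp_all add: numeral_eq_Suc)
      ultimately show "e (Suc i) = (\<not> e i)" by blast
    qed
  next
    case False
    have mono: "e k" if "j \<le> k" "e j" "2 \<le> j" "k \<le> q" for j k
    proof (rule ccontr)
      assume nk: "\<not> e k"
      have kq: "k \<noteq> q" using nk eq by metis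
      moreover have "j \<noteq> k" using nk that(2) by metis
      ultimately have "j < k" using that(1) by simp
      from ends_before[OF this that(2) nk] obtain p where
        "j \<le> p" "p < k" "e p" "\<not> e (Suc p)" by blast
      then show False using False that kq by auto
    qed
    obtain r where r: "q = Suc r" using q2 by (cases q) auto
    show ?thesis
    proof (cases "e 3")
      case e3: True
      have es: "e k" if "3 \<le> k" "k \<le> q" for k using mono[of 3 k] that e3 by simp
      have "?P10 \<subseteq> {2}"
      proof
        fix i assume i: "i \<in> ?P10"
        then show "i \<in> {2}" using es[of i] e1 by (cases "i = 1"; cases "i = 2") auto
      qed
      then have "card ?P10 \<le> card {2::nat}" by (rule card_mono[rotated]) simp
      also have "\<dots> = 1" by simp
      finally have one: "card ?P01 \<le> 1" by (simp only: card_labels)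
      have as: "a k" if "3 \<le> k" "k \<le> q" for k
      proof (rule ccontr)
        assume "\<not> a k"
        then have "{1, k} \<subseteq> ?P01" using in01 es[of k] that by auto
        from card_mono[OF _ this] show False using one that by simp
      qed
      have "q = 3"
        using last[of r] as[of r] es[of r] r q3 by (cases "r = 2") auto
      show ?thesis
      proof (rule alternating_s)
        fix i assume "1 \<le> i" "i < q"
        then have "i = 1 \<or> i = 2" using \<open>q = 3\<close> by auto
        moreover have "e (Suc 1)= (\<not> e 1)" "e (Suc 2)= (\<not> e 2)"
          using e1 e2 e3 by (simp_all add: numeral_eq_Suc)
        ultimately show "e (Suc i) = (\<not> e i)" by blast
      qed
    next
      case n3: False
      then have q4: "4 \<le> q" using eq q3 by (cases "q = 3") auto
      have a3: "a 3"
      proof (rule zeros_run)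
        fix j :: nat assume "2 \<le> j" "j \<le> 3"
        then have "j = 2 \<or> j = 3" by auto
        then show "\<not> e j" using e2 n3 by auto
      qed (use q4 in auto)
      have e4: "e 4"
      proof (rule ccontr)
        assume n4: "\<not> e 4"
        then have "4 < q" using eq q4 by (cases "q = 4") auto
        have "a 4"
        proof (rule zeros_run)
          fix j :: nat assume "2 \<le> j" "j \<le> 4"
          then have "j = 2 \<or> j = 3 \<or> j = 4" by auto
          then show "\<not> e j" using e2 n3 n4 by auto
        qed (use \<open>4 < q\<close> in auto)
        then show False using three10[of 3 4] in10 a3 n3 n4 q4 by auto
      qed
      have es: "e k" if "4 \<le> k" "k \<le> q" for k using mono[of 4 k] that e4 by simp
      have e_set: "{i \<in> {1..q}. e i} = insert 1 {4..q}"
      proof (rule set_eqI)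
        fix i show "i \<in> {i \<in> {1..q}. e i} \<longleftrightarrow> i \<in> insert 1 {4..q}"
        proof (cases "i = 0 \<or> i = 1 \<or> i = 2 \<or> i = 3")
          case True then show ?thesis using e1 e2 n3 q4 by auto
        next
          case False then show ?thesis using es[of i] by auto
        qed
      qed
      have bet: "bet = q - 2" unfolding bet_e e_set using q4 by simp
      \<comment> \<open>Besides index 1 there must be a second index where only \<open>e\<close>
        holds; \<open>last\<close> and uniqueness put it at q - 1.\<close>
      have "{2, 3} \<subseteq> ?P10" using in10 a3 n3 q4 by auto
      have "card {2::nat, 3} \<le> card ?P10" by (rule card_mono[OF fin10]) fact
      moreover have "card {2::nat, 3} = 2" by simp
      ultimately have "2 \<le> card ?P01" by (simp only: card_labels)
      then have "\<not> ?P01 \<subseteq> {1}" using card_mono[of "{1::nat}" ?P01] by auto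
      then obtain z where z: "1 \<le> z" "z \<le> q" "\<not> a z" "e z" "z \<noteq> 1" by auto
      have z4: "4 \<le> z" "z < q" using z a2 a3 aq 
        by (cases "z = 2"; cases "z = 3"; cases "z = q"; auto)+
      have zr: "z = r"
        using last[of r] es[of r] z4 r uniq[of z r] z by auto
      have r4: "r = 4"
      proof (rule ccontr)
        assume "r \<noteq> 4"
        then obtain i where i: "r = Suc i" "4 \<le> i" using zr z4 by (cases r) auto
        have ei: "e i" using es[of i] i r by simp
        have ai: "a i" using uniq[of z i] z z4 ei i r zr by auto
        have "bet \<le> card ({4..i} \<union> {q})"
        proof (rule card_in_y_a[of i])
          fix k assume k: "1 \<le> k" "k \<le> q" "A (y k) (y (Suc i))"
          have "a k \<and> e k" if "k < i"
            using forward_a[of k i] forward_e[of k i] that k i ei ai r by auto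
          then have "4 \<le> k" using i not_a1 e2 n3 k by (cases "k = 1"; cases "k = 2"; cases "k = 3") auto
          moreover have "k \<noteq> r" using k i by auto
          ultimately show "k \<in> {4..i} \<union> {q}" using k i r by auto
        qed (use i r ei ai in auto)
        also have "card ({4..i} \<union> {q}) \<le> card {4..i} + card {q}" by (rule card_Un_le)
        also have "\<dots> = i - 2" using i by simp
        finally show False using bet i r by simp
      qed
      then have q5: "q = 5" using r by simp
      have lab: "\<not> a 1" "a 2" "a 3" "\<not> a 4" "e 1" "\<not> e 2" "\<not> e 3" "e 4"
        using not_a1 a2 a3 z zr r4 e1 e2 n3 e4 by auto
      have sg: "seg 1 1 = [y 1]" "seg 2 2 = [y 2]" "seg 3 3 = [y 3]" "seg 4 4 = [y 4]" "seg 5 5 = [y 5]"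
        by (simp_all add: seg_def)
      have arcs: "A (y 4) s" "A s (y 3)" "A (y 3) u" "A u (y 2)" "A u (y 5)" "A (y 5) s" "A s (y 1)"
         "A (y 1) (y 2)" "A (y 2) (y 3)"
        using arcs_us(1,3)[of 3] arcs_us(1,3)[of 4] arcs_us(1,3)[of 5] arcs_us(2,4)[of 1] arcs_us(2,4)[of 2] arcs_us(2,4)[of 4]
          step[of 1] step[of 2] lab q5 eq by (simp_all add: numeral_eq_Suc)
      have y51: "A (y 5) (y 1)" using miss_in[of 4 5] in1_a[of 4] lab eq q5 by auto
      have y25: "A (y 2) (y 5)"
      proof (rule ccontr)
        assume nA: "\<not> A (y 2) (y 5)"
        have "q + 1 \<le> card {3::nat} + (if a 2 then 1 else 0) + bet"
        proof (rule card_out_y)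
          fix k assume k: "1 \<le> k" "k \<le> q" "A (y 2) (y k)"
          have "k \<noteq> 1" "k \<noteq> 2" "k \<noteq> 4" "k \<noteq> 5" 
            using back1[of 2] forward_e[of 2 3] k lab q5 nA by (auto simp: numeral_eq_Suc)
          then show "k \<in> {3}" using k q5 by auto
        qed (use q5 lab in auto)
        then show False using bet q5 by (simp split: if_splits)
      qed
      have mem: "y k \<in> {y 1, y 2, y 3, y 4, y 5}" if "1 \<le> k" "k \<le> q" for k
      proof -
        have "k = 1 \<or> k = 2 \<or> k = 3 \<or> k = 4 \<or> k = 5" using that q5 by auto
        then show ?thesis by auto
      qed
      have n14: "\<not> A (y 1) (y 4)"
      proof
        assume "A (y 1) (y 4)"
        then show False
        proof (intro noham1[of "[y 1, y 4, s, y 3, u, y 2, y 5]"])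
          show "y k \<in> set [y 1, y 4, s, y 3, u, y 2, y 5]" if "1 \<le> k" "k \<le> q" for k
            using mem[OF that] by auto
        qed (use arcs y51 y25 q5 in auto)
      qed
      have n54: "\<not> A (y 5) (y 4)"
      proof
        assume "A (y 5) (y 4)"
        then show False
        proof (intro noham1[of "[y 1, y 2, y 3, u, y 5, y 4, s]"])
          show "y k \<in> set [y 1, y 2, y 3, u, y 5, y 4, s]" if "1 \<le> k" "k \<le> q" for k
            using mem[OF that] by auto
        qed (use arcs q5 in auto)
      qed
      have "bet + length [s] \<le> card {z. A z (y (Suc 3))} + 1" using in_ge_a[of 3] lab q5 by simp
      moreover have "card {z. A z (y (Suc 3))} \<le> card {3::nat} + (if a 3 then 0 else length [u]) + (if e 3 then 0 else length [s])"
      proof (rule in_le_Suc)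
        fix k assume k: "1 \<le> k" "k \<le> q" "A (y k) (y (Suc 3))"
        have "k \<noteq> 1" "k \<noteq> 2" "k \<noteq> 4" "k \<noteq> 5" 
          using n14 n54 forward_e[of 2 3] k lab q5 by (auto simp: numeral_eq_Suc)
        then show "k \<in> {3}" using k q5 by auto
      qed (use q5 in auto)
      ultimately show ?thesis using lab bet q5 by simp
    qed
  qed
qed

theorem alternating: alternating
  using case_e2 case_not_e2 by blast

end

section \<open>Alternating neighbourhoods\<close>

text \<open>\<open>T\<close> consists of the n + 1 contracted independent edges. Arcs inside V - T
  are unrestricted: they encode the arbitrary bipartite graph.\<close>

definition class2_digraph :: "'a set \<Rightarrow> ('a \<Rightarrow> 'a \<Rightarrow> bool) \<Rightarrow> bool" where
  "class2_digraph V A \<longleftrightarrow> (\<exists>T. T \<subseteq> V \<and> V - T \<noteq> {} \<and> card T = card (V - T) + 1 \<and>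
     (\<forall>x\<in>T. \<forall>y\<in>T. \<not> A x y) \<and> (\<forall>x\<in>T. \<forall>y\<in>V - T. A x y \<and> A y x))"

definition class4_digraph :: "'a set \<Rightarrow> ('a \<Rightarrow> 'a \<Rightarrow> bool) \<Rightarrow> bool" where
  "class4_digraph V A \<longleftrightarrow> (\<exists>f. bij_betw f X\<^sub>4 V \<and> (\<forall>x\<in>X\<^sub>4. \<forall>y\<in>X\<^sub>4. A (f x) (f y) \<longleftrightarrow> (x, y) \<in> A\<^sub>4))"

lemma (in ore_digraph) cyc_reverse:
  "ore_digraph.cyc V (\<lambda>x y. A y x) c \<longleftrightarrow> cyc (rev c)"
proof -
  interpret r: ore_digraph V "\<lambda>x y. A y x" by (rule reverse)
  show ?thesis by (auto simp: r.cyc_def cyc_def successively_rev hd_rev last_rev)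
qed

lemma (in ore_digraph) alternating_reverse:
  assumes "ore_digraph.alternating V (\<lambda>x y. A y x)" shows alternating
proof -
  interpret r: ore_digraph V "\<lambda>x y. A y x" by (rule reverse)
  obtain c w where "r.cyc c" "w \<in> V" "set c = V - {w}" "\<forall>x\<in>set c. A w x \<longleftrightarrow> A x w"
    using assms unfolding r.alternating_def by blast
  then show ?thesis unfolding alternating_def cyc_reverse
    by (intro exI[of _ "rev c"] exI[of _ w]) auto
qed

lemma (in critical) critical_reverse: "critical V (\<lambda>x y. A y x)"
proof -
  interpret r: ore_digraph V "\<lambda>x y. A y x" by (rule reverse)
  show ?thesis
  proof
    show "\<not> r.hamiltonian" using nonham unfolding r.hamiltonian_def hamiltonian_def cyc_reverse
      by (metis set_rev)
    fix c w assume "r.cyc c" "w \<in> V" "set c = V - {w}"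
    then have "A (last (rev c)) w \<noteq> A w (hd (rev c))"
      by (intro miss) (auto simp: cyc_reverse)
    moreover have "c \<noteq> []" using \<open>r.cyc c\<close> by (auto simp: r.cyc_def)
    ultimately show "A w (last c) \<noteq> A (hd c) w" by (auto simp: hd_rev last_rev)
  qed
qed

text \<open>Start at a vertex with an arc to \<open>w\<close> and take the first \<open>x'\<close>
  that is entered from \<open>w\<close> without an arc back. Its predecessor \<open>t\<close> has no
  arc to \<open>w\<close> by alternation and none from \<open>w\<close> by the choice of
  \<open>x'\<close>, so it is the required nonadjacent vertex.\<close>

lemma (in critical) alternating_of_out:
  assumes c: "cyc c" "w \<in> V" "set c = V - {w}" and x: "x \<in> set c" "A w x" "\<not> A x w"
  shows alternating
proof -
  have "V - {w} \<noteq> {}" using x c by auto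
  then obtain z where z: "z \<in> set c" "A z w"
    using strong[of "V - {w}"] c by auto
  obtain p r where "c = p @ z # r" using z(1) by (meson split_list)
  then have c': "cyc ((z # r) @ p)" "set ((z # r) @ p) = V - {w}"
    using cyc_rotate[of p "z # r"] c by auto
  have "\<exists>x\<in>set ((z # r) @ p). A w x \<and> \<not> A x w" using x c(3) c'(2) by auto
  then obtain ps x' qs where s: "(z # r) @ p = ps @ x' # qs" "A w x'" "\<not> A x' w"
    "\<forall>v\<in>set ps. \<not> (A w v \<and> \<not> A v w)"
    using split_list_first_prop[of "(z # r) @ p" "\<lambda>x. A w x \<and> \<not> A x w"] by blast
  have "ps \<noteq> []"
  proof
    assume "ps = []"
    then have "x' = z" using s(1) by simp
    then show False using s z by simp
  qed
  then obtain ps' t where ps: "ps = ps' @ [t]" by (cases ps rule: rev_cases) auto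
  have "successively (\<lambda>x y. A x w \<noteq> A w y) (ps' @ t # x' # qs)"
    using xor_path[OF c'(1) c(2) c'(2)] s(1) ps by simp
  then have t: "\<not> A t w" "\<not> A w t" using successively_splitD s ps by fastforce+
  have cyc: "cyc (t # (x' # qs @ ps'))" "set (t # (x' # qs @ ps')) = V - {w}"
    using cyc_rotate[of ps' "t # x' # qs"] c' unfolding s(1) ps by auto
  have q: "2 \<le> length (x' # qs @ ps')"
  proof (rule ccontr)
    assume "\<not> ?thesis"
    then have "qs @ ps' = []" by (cases "qs @ ps'") auto
    then show False using miss[OF cyc(1) c(2) cyc(2)] t s by simp
  qed
  interpret config V A "\<lambda>i. (x' # qs @ ps') ! (i - 1)" "length (x' # qs @ ps')" "[w]" "[t]"
    "\<lambda>i. A ((x' # qs @ ps') ! (i - 1)) w" "\<lambda>i. A ((x' # qs @ ps') ! (i - 1)) t"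
    by (rule config_pair[OF cyc(1) c(2) cyc(2) t q])
  interpret config_one V A "\<lambda>i. (x' # qs @ ps') ! (i - 1)" "length (x' # qs @ ps')" w t
    "\<lambda>i. A ((x' # qs @ ps') ! (i - 1)) w" "\<lambda>i. A ((x' # qs @ ps') ! (i - 1)) t"
    by unfold_locales (use s in simp)
  show ?thesis by (rule alternating)
qed

lemma (in critical) alternating:
  assumes c: "cyc c" "w \<in> V" "set c = V - {w}"
  shows alternating
proof (cases "\<forall>x\<in>set c. A x w \<longleftrightarrow> A w x")
  case True
  then show ?thesis using c unfolding alternating_def by blast
next
  case False
  then consider x where "x \<in> set c" "A w x" "\<not> A x w" | x where "x \<in> set c" "A x w" "\<not> A w x" by blast
  then show ?thesis
  proof cases
    case 1 then show ?thesis using alternating_of_out[OF c] by blast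
  next
    case 2
    interpret r: critical V "\<lambda>x y. A y x" by (rule critical_reverse)
    have "r.cyc (rev c)" using c by (simp add: cyc_reverse)
    then have "r.alternating" using r.alternating_of_out[of "rev c" w] 2 c by auto
    then show ?thesis by (rule alternating_reverse)
  qed
qed

text \<open>The cycle is read as a sequence \<open>g\<close> of period \<open>2 * m\<close>, its even members being the vertices not
  adjacent to \<open>w\<close>.\<close>

locale periodic_cycle = critical +
  fixes g :: "nat \<Rightarrow> 'a" and m :: nat and w :: 'a
  assumes m1: "1 \<le> m"
    and period: "g (i + 2 * m) = g i"
    and V_eq: "V = insert w (g ` {..<2 * m})"
    and card_V: "card V = 2 * m + 1"
    and arc: "A (g i) (g (Suc i))"
    and even_w: "even i \<Longrightarrow> \<not> A w (g i) \<and> \<not> A (g i) w"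
    and odd_w: "odd i \<Longrightarrow> A w (g i) \<and> A (g i) w"
begin

lemma g_mod: "g (i mod (2 * m)) = g i"
proof -
  have "g (k + n * (2 * m)) = g k" for k n
  proof (induction n)
    case (Suc n)
    have "k + Suc n * (2 * m) = (k + n * (2 * m)) + 2 * m" by simp
    then show ?case using Suc period by (simp only:)
  qed simp
  from this[of "i mod (2 * m)" "i div (2 * m)"] show ?thesis by (simp only: mod_div_mult_eq)
qed

lemma inj: "inj_on g {..<2 * m}" and w_notin: "w \<notin> g ` {..<2 * m}"
proof -
  have "card V \<le> card (g ` {..<2 * m}) + 1" unfolding V_eq by (simp add: card_insert_if)
  then have c: "card (g ` {..<2 * m}) = card {..<2 * m}"
    using card_V card_image_le[of "{..<2 * m}" g] by simp
  then show "inj_on g {..<2 * m}" by (simp add: eq_card_imp_inj_on)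
  show "w \<notin> g ` {..<2 * m}"
  proof
    assume "w \<in> g ` {..<2 * m}"
    then have "V = g ` {..<2 * m}" using V_eq by auto
    then show False using c card_V by simp
  qed
qed

lemma g_eq: "g i = g j \<longleftrightarrow> i mod (2 * m) = j mod (2 * m)"
  using inj_on_eq_iff[OF inj, of "i mod (2 * m)" "j mod (2 * m)"] m1 by (simp add: g_mod)

lemma g_neq: "i < j \<Longrightarrow> j < i + 2 * m \<Longrightarrow> g i \<noteq> g j"
proof
  assume *: "i < j" "j < i + 2 * m" "g i = g j"
  then have "2 * m dvd j - i" by (metis g_eq less_imp_le_nat mod_eq_dvd_iff_nat)
  then show False using * by (auto dest: dvd_imp_le)
qed

lemma g_V [simp]: "g i \<in> V"
proof -
  have "i mod (2 * m) < 2 * m" using m1 by simp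
  then have "g (i mod (2 * m)) \<in> V" unfolding V_eq by blast
  then show ?thesis by (simp add: g_mod)
qed

lemma w_V [simp]: "w \<in> V" and g_w [simp]: "g i \<noteq> w" "w \<noteq> g i"
proof -
  show "w \<in> V" using V_eq by simp
  have "i mod (2 * m) < 2 * m" using m1 by simp
  then have "g (i mod (2 * m)) \<noteq> w" using w_notin by (metis imageI lessThan_iff)
  then show "g i \<noteq> w" "w \<noteq> g i" by (simp_all add: g_mod)
qed

text \<open>Any 2 m consecutive indices enumerate the cycle, so each vertex can be placed after a
  chosen start; this replaces talk of cyclic order.\<close>

lemma window: 
  assumes "v \<in> V" "v \<noteq> w" obtains k where "x \<le> k" "k < x + 2 * m" "v = g k"
proof -
  obtain i where i: "i < 2 * m" "v = g i" using assms V_eq by auto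
  let ?k = "x + (i + 2 * m - x mod (2 * m)) mod (2 * m)"
  have xm: "x mod (2 * m) < 2 * m" using m1 by simp
  have "?k mod (2 * m) = (x mod (2 * m) + (i + 2 * m - x mod (2 * m))) mod (2 * m)"
    by (metis mod_add_eq mod_mod_trivial)
  also have "\<dots> = i mod (2 * m)" using xm by simp
  finally have "g ?k = g i" by (simp only: g_eq)
  moreover have "?k < x + 2 * m" using m1 by simp
  ultimately show ?thesis using that[of ?k] i by simp
qed

lemma g_win: "x \<le> i \<Longrightarrow> i < x + 2 * m \<Longrightarrow> x \<le> k \<Longrightarrow> k < x + 2 * m \<Longrightarrow> g k = g i \<longleftrightarrow> k = i"
  using g_neq[of i k] g_neq[of k i] by (cases i k rule: linorder_cases) auto

definition sg :: "nat \<Rightarrow> nat \<Rightarrow> 'a list" where "sg i j = map g [i..<j]"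

lemma sg_simps [simp]: "sg i j = [] \<longleftrightarrow> j \<le> i" "length (sg i j) = j - i"
  "i < j \<Longrightarrow> hd (sg i j) = g i" "i < j \<Longrightarrow> last (sg i j) = g (j - 1)" "successively A (sg i j)"
  by (auto simp: sg_def hd_map last_map successively_conv_nth arc)

lemma mem_sg_win:
  "x \<le> i \<Longrightarrow> j \<le> x + 2 * m \<Longrightarrow> x \<le> k \<Longrightarrow> k < x + 2 * m \<Longrightarrow> g k \<in> set (sg i j) \<longleftrightarrow> i \<le> k \<and> k < j"
  unfolding sg_def using g_win[of x] by fastforce

lemma mem_sg: "i \<le> k \<Longrightarrow> k < j \<Longrightarrow> g k \<in> set (sg i j)" by (simp add: sg_def)

lemma noham:
  assumes "successively A c" "A (last c) (hd c)" "length c = 2 * m + 1" "w \<in> set c"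
    "\<And>k. x \<le> k \<Longrightarrow> k < x + 2 * m \<Longrightarrow> g k \<in> set c"
  shows False
proof -
  have "V \<subseteq> set c"
  proof
    fix v assume "v \<in> V"
    then show "v \<in> set c" using window[of v x] assms(4,5) by (cases "v = w") auto
  qed
  moreover have "c \<noteq> []" using assms(3) by auto
  ultimately have "cyc c" "set c = V" using cyc_of_cover[of c V] assms(1-3) card_V by auto
  then show False using nonham unfolding hamiltonian_def by blast
qed

text \<open>The odd neighbours of \<open>g x\<close> on the cycle are joined to \<open>w\<close> in
  both directions, so \<open>w\<close> can take its place.\<close>

lemma cyc_even:
  assumes "even x"
  shows "cyc (w # sg (Suc x) (x + 2 * m))" "set (w # sg (Suc x) (x + 2 * m)) = V - {g x}"
proof -
  let ?c = "w # sg (Suc x) (x + 2 * m)"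
  have "V - {g x} \<subseteq> set ?c"
  proof
    fix v assume v: "v \<in> V - {g x}"
    show "v \<in> set ?c"
    proof (cases "v = w")
      case False
      obtain k where k: "x \<le> k" "k < x + 2 * m" "v = g k" using window[of v x] v False by auto
      then have "k \<noteq> x" using v by auto
      then show ?thesis using k mem_sg[of "Suc x" k] by simp
    qed simp
  qed
  moreover have "length ?c = 2 * m" using m1 by simp
  moreover have "card (V - {g x}) = 2 * m" using card_V by simp
  moreover have "successively A ?c" "A (last ?c) (hd ?c)"
    using assms m1 odd_w[of "Suc x"] odd_w[of "x + 2 * m - 1"] by (auto simp: successively_Cons)
  ultimately show "cyc ?c" "set ?c = V - {g x}"
    using cyc_of_cover[of ?c "V - {g x}"] by (metis Diff_subset list.distinct(1) order_refl)+
qed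

lemma xor_even:
  assumes "even x" "x < i" "Suc i < x + 2 * m"
  shows "A (g i) (g x) \<noteq> A (g x) (g (Suc i))"
proof -
  have "successively (\<lambda>v v'. A v (g x) \<noteq> A (g x) v') (w # sg (Suc x) (x + 2 * m))"
    using xor_path[OF cyc_even(1)[OF assms(1)] g_V cyc_even(2)[OF assms(1)]] .
  then have "successively (\<lambda>v v'. A v (g x) \<noteq> A (g x) v') (sg (Suc x) (x + 2 * m))"
    using m1 by (simp add: successively_Cons)
  then have "A (sg (Suc x) (x + 2 * m) ! (i - Suc x)) (g x) \<noteq> A (g x) (sg (Suc x) (x + 2 * m) ! Suc (i - Suc x))"
    using assms by (subst (asm) successively_conv_nth) auto
  then show ?thesis using assms by (simp add: sg_def)
qed

text \<open>The arc skips a block that begins and ends at odd indices, so either end can be joined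
  to \<open>w\<close>. If a conclusion failed, \<open>xor_even\<close> would join the other end to
  \<open>g x\<close> and complete a Hamilton cycle.\<close>

lemma closure:
  assumes "even x" "even i" "even j" "x < i" "i < j" "j < x + 2 * m" "A (g i) (g j)"
  shows "A (g x) (g j)" "A (g i) (g x)"
proof -
  have ij: "Suc i < j" "Suc x < j" using assms by presburger+
  have ends: "A (g (x + 2 * m - 1)) (g x)" using arc[of "x + 2 * m - 1"] period[of x] m1 by simp
  show "A (g x) (g j)"
  proof (rule ccontr)
    assume "\<not> A (g x) (g j)"
    then have b: "A (g (j - 1)) (g x)" using xor_even[of x "j - 1"] assms ij by auto
    show False
      by (rule noham[of "sg (Suc x) (Suc i) @ sg j (x + 2 * m) @ [w] @ sg (Suc i) j @ [g x]" x])
        (use assms ij b m1 odd_w[of "x + 2 * m - 1"] odd_w[of "Suc i"] arc[of x] in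
          \<open>auto simp: successively_append_iff successively_Cons mem_sg_win[of x] g_win[of x]\<close>)
  qed
  show "A (g i) (g x)"
  proof (rule ccontr)
    assume "\<not> A (g i) (g x)"
    then have b: "A (g x) (g (Suc i))" using xor_even[of x i] assms ij by auto
    show False
      by (rule noham[of "sg (Suc x) (Suc i) @ sg j (x + 2 * m) @ [g x] @ sg (Suc i) j @ [w]" x])
        (use assms ij b m1 odd_w[of "j - 1"] odd_w[of "Suc x"] ends in
          \<open>auto simp: successively_append_iff successively_Cons mem_sg_win[of x] g_win[of x]\<close>)
  qed
qed

text \<open>\<open>w\<close> has at most m neighbours in each direction, so the condition against
  \<open>w\<close> gives \<open>g x\<close> at least m; its degrees sum to 2 m.\<close>

lemma deg_even: assumes "even x" shows "card {z. A (g x) z} = m" "card {z. A z (g x)} = m"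
proof -
  have odd: "z \<in> (\<lambda>k. g (2 * k + 1)) ` {..<m}" if "A w z \<or> A z w" for z
  proof -
    have "z \<in> V" "z \<noteq> w" using that arcD by blast+
    then obtain k where k: "k < 2 * m" "z = g k" using V_eq by auto
    then have "odd k" using that even_w by auto
    then obtain k' where "k = 2 * k' + 1" by (elim oddE)
    then show ?thesis using k by (intro image_eqI[of _ _ k']) auto
  qed
  have "card {z. A w z} \<le> card ((\<lambda>k. g (2 * k + 1)) ` {..<m})" by (rule card_mono) (use odd in auto)
  also have "\<dots> \<le> m" using card_image_le[of "{..<m}"] by simp
  finally have o: "card {z. A w z} \<le> m" .
  have "card {z. A z w} \<le> card ((\<lambda>k. g (2 * k + 1)) ` {..<m})" by (rule card_mono) (use odd in auto)
  also have "\<dots> \<le> m" using card_image_le[of "{..<m}"] by simp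
  finally have i: "card {z. A z w} \<le> m" .
  have "card V \<le> card {z. A w z} + card {z. A z (g x)} + 1" "card V \<le> card {z. A (g x) z} + card {z. A z w} + 1"
    using ore[of w "g x"] ore[of "g x" w] even_w[OF assms] by auto
  with o i deg_sum[OF cyc_even(1)[OF assms] g_V cyc_even(2)[OF assms]] card_V
  show "card {z. A (g x) z} = m" "card {z. A z (g x)} = m" by linarith+
qed

text \<open>One alternative of \<open>xor_even\<close> now always fails, which yields all arcs
  between even and odd vertices.\<close>

lemma class2_of_independent:
  assumes "\<And>i j. even i \<Longrightarrow> even j \<Longrightarrow> \<not> A (g i) (g j)"
  shows "class2_digraph V A"
proof -
  let ?S = "(\<lambda>k. g (2 * k)) ` {..<m}" and ?B = "(\<lambda>k. g (2 * k + 1)) ` {..<m}"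
  have cS: "card ?S = m" and cB: "card ?B = m"
    by (subst card_image; auto intro!: inj_onI simp: g_eq)+
  have disj: "?S \<inter> ?B = {}"
    using m1 by (auto simp: g_eq) presburger
  have V: "V = insert w ?S \<union> ?B"
  proof
    show "V \<subseteq> insert w ?S \<union> ?B"
    proof
      fix v assume "v \<in> V"
      then consider "v = w" | k where "k < 2 * m" "v = g k" using V_eq by auto
      then show "v \<in> insert w ?S \<union> ?B"
      proof cases
        case (2 k)
        show ?thesis
        proof (cases "even k")
          case True then obtain k' where "k = 2 * k'" by (elim evenE)
          then show ?thesis using 2 by auto
        next
          case False then obtain k' where "k = 2 * k' + 1" by (elim oddE)
          then show ?thesis using 2 by auto
        qed
      qed simp
    qed
  qed auto
  then have VT: "V - insert w ?S = ?B" using disj by auto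
  have full: "A (g x) (g k) \<and> A (g k) (g x)" if "even x" "odd k" for x k
  proof -
    obtain k' where k': "x \<le> k'" "k' < x + 2 * m" "g k = g k'" using window[of "g k" x] by auto
    have "odd k'"
    proof
      assume "even k'"
      then show False using even_w[of k'] odd_w[of k] that k' by auto
    qed
    then have xk: "x < k'" using k' that by (cases "x = k'") auto
    have "A (g k') (g x)"
    proof (cases "Suc k' < x + 2 * m")
      case True
      then show ?thesis using xor_even[of x k'] xk that assms[of x "Suc k'"] \<open>odd k'\<close> by auto
    next
      case False
      then have "Suc k' = x + 2 * m" using k' by simp
      then show ?thesis using arc[of k'] period[of x] by simp
    qed
    moreover have "A (g x) (g k')"
    proof (cases "k' = Suc x")
      case True then show ?thesis using arc by simp
    next
      case False
      then show ?thesis using xor_even[of x "k' - 1"] xk that assms[of "k' - 1" x] \<open>odd k'\<close> k' by auto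
    qed
    ultimately show ?thesis using k' by simp
  qed
  show ?thesis unfolding class2_digraph_def
  proof (intro exI[of _ "insert w ?S"] conjI ballI)
    show "insert w ?S \<subseteq> V" using V by auto
    show "V - insert w ?S \<noteq> {}" unfolding VT using m1 by (auto simp: lessThan_empty_iff)
    show "card (insert w ?S) = card (V - insert w ?S) + 1"
      unfolding VT cB using cS by (subst card_insert_disjoint) auto
    show "\<not> A x z" if "x \<in> insert w ?S" "z \<in> insert w ?S" for x z
      using that assms even_w by auto
    show "A x z" "A z x" if "x \<in> insert w ?S" "z \<in> V - insert w ?S" for x z
      using that odd_w full unfolding VT by auto
  qed
qed

text \<open>If there were no such forward step, some even vertex would have an arc to the previous
  even one, and \<open>xor_even\<close> would give the reverse of every cycle arc. Running
  backwards, with that step used once, produces a Hamilton cycle through \<open>w\<close>.\<close>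

lemma no_forward:
  assumes "even k0" "even j0" "A (g k0) (g j0)"
  obtains i where "even i" "A (g i) (g (i + 2))"
proof (rule ccontr)
  assume "\<not> thesis"
  then have nf: "\<not> A (g i) (g (i + 2))" if "even i" for i using that \<open>\<And>i. \<lbrakk>even i; A (g i) (g (i + 2))\<rbrakk> \<Longrightarrow> thesis\<close> by blast
  obtain j where j: "k0 \<le> j" "j < k0 + 2 * m" "g j0 = g j" using window[of "g j0" k0] by auto
  have "even j" using even_w[OF assms(2)] odd_w[of j] j(3) by auto
  have "j \<noteq> k0" using assms(3) j(3) by auto
  have kj: "k0 < j" using \<open>j \<noteq> k0\<close> j by simp
  then have "Suc k0 < j" using \<open>even j\<close> assms(1) by presburger
  then have m2: "2 \<le> m" using j by linarith
  \<comment> \<open>Unless the given arc already has this form, apply \<open>closure\<close> with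
    the even vertex just before \<open>g k0\<close> as the third vertex.\<close>
  obtain x where x: "even x" "A (g (x + 2)) (g x)"
  proof (cases "j + 2 = k0 + 2 * m")
    case True
    then have "g (j + 2) = g k0" by (simp only: period)
    then show ?thesis using that[of j] \<open>even j\<close> assms(3) j(3) by simp
  next
    case False
    have jl: "j + 2 < k0 + 2 * m" using False j \<open>even j\<close> assms(1) by presburger
    let ?x = "k0 + 2 * m - 2"
    have "A (g (k0 + 2 * m)) (g ?x)"
      by (rule closure(2)[of ?x "k0 + 2 * m" "j + 2 * m"])
        (use jl kj assms j m1 \<open>even j\<close> in \<open>auto simp: period\<close>)
    moreover have "?x + 2 = k0 + 2 * m" using m1 by simp
    ultimately show ?thesis using that[of ?x] assms(1) by (metis dvd_add_triv_left_iff even_add even_mult_iff even_numeral)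
  qed
  have bk: "A (g (Suc k)) (g k)" for k
  proof (cases "even k")
    case True
    then show ?thesis using xor_even[of k "Suc k"] nf[of k] m2 by auto
  next
    case False
    define k' where "k' = k - 1"
    have k': "k = Suc k'" "even k'" using False by (auto simp: k'_def elim: oddE)
    have "A (g (k' + 2 * m)) (g (k' + 2)) \<noteq> A (g (k' + 2)) (g (Suc (k' + 2 * m)))"
      using xor_even[of "k' + 2" "k' + 2 * m"] k' m2 by auto
    then show ?thesis using nf[OF k'(2)] period[of k'] period[of "Suc k'"] k'(1) by simp
  qed
  have rev: "successively A (rev (sg (x + 2) (x + 2 * m)))"
    unfolding successively_rev by (auto simp: sg_def successively_conv_nth bk)
  show False
    by (rule noham[of "w # rev (sg (x + 2) (x + 2 * m)) @ [g x, g (Suc x)]" x])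
      (use rev x m2 odd_w[of "Suc x"] odd_w[of "x + 2 * m - 1"] arc[of x] in
        \<open>auto simp: successively_append_iff successively_Cons hd_rev last_rev hd_append mem_sg_win[of x] g_win[of x]\<close>)
qed

end

section \<open>The even vertices form a clique\<close>

locale complete_periodic_cycle = periodic_cycle +
  fixes i0 :: nat
  assumes i0: "even i0" "A (g i0) (g (i0 + 2))" and m2: "2 \<le> m"
begin

text \<open>\<open>closure\<close> gives arcs from all other even vertices to
  \<open>g (i + 2)\<close>. Then \<open>xor_even\<close> excludes its arcs to odd vertices except
  the next, and outdegree m forces all arcs to even vertices. One of them leads to
  \<open>g (i + 4)\<close>, so the step repeats.\<close>

lemma all_even_step:
  assumes "even i" "A (g i) (g (i + 2))"
  shows "even k \<Longrightarrow> i + 2 < k \<Longrightarrow> k < i + 2 + 2 * m \<Longrightarrow> A (g (i + 2)) (g k)"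
proof -
  let ?x = "i + 2"
  have toward: "A (g k) (g ?x)" if "even k" "?x < k" "k < ?x + 2 * m" for k
  proof (cases "k = i + 2 * m")
    case True
    then show ?thesis using assms(2) by (simp add: period)
  next
    case False
    have "k < i + 2 * m" using False that assms(1) by presburger
    then have "A (g k) (g (?x + 2 * m))"
      using that assms period[of "Suc (Suc i)"] by (intro closure(1)[of k "i + 2 * m"]) (auto simp: period[of i])
    then show ?thesis using period[of "Suc (Suc i)"] by simp
  qed
  have own: "\<not> A (g ?x) (g (Suc k))" if "even k" "?x < k" "k < ?x + 2 * m" for k
  proof -
    have "Suc k < ?x + 2 * m" using that assms(1) by presburger
    then show ?thesis using xor_even[of ?x k] toward[OF that] that assms(1) by auto
  qed
  define K where "K = {k. even k \<and> ?x < k \<and> k < ?x + 2 * m}"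
  have K: "K = (\<lambda>l. ?x + 2 * l) ` {1..<m}"
  proof (rule set_eqI)
    fix k show "k \<in> K \<longleftrightarrow> k \<in> (\<lambda>l. ?x + 2 * l) ` {1..<m}"
    proof
      assume "k \<in> K"
      then have k: "even k" "?x < k" "k < ?x + 2 * m" by (auto simp: K_def)
      then have "even (k - ?x)" using assms(1) by simp
      then obtain l where "k - ?x = 2 * l" by (elim evenE)
      then have "k = ?x + 2 * l" "1 \<le> l" "l < m" using k by linarith+
      then show "k \<in> (\<lambda>l. ?x + 2 * l) ` {1..<m}" by auto
    qed (use assms(1) in \<open>auto simp: K_def\<close>)
  qed
  have cK: "card K = m - 1" unfolding K by (subst card_image) (auto intro: inj_onI)
  have out: "{z. A (g ?x) z} \<subseteq> insert (g (Suc ?x)) (g ` K)"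
  proof
    fix z assume "z \<in> {z. A (g ?x) z}"
    then have z: "A (g ?x) z" by simp
    then have "z \<in> V" "z \<noteq> w" "z \<noteq> g ?x" using arcD even_w[of ?x] assms(1) by auto
    then obtain k where k: "?x \<le> k" "k < ?x + 2 * m" "z = g k" using window[of z ?x] by metis
    then have "?x < k" using \<open>z \<noteq> g ?x\<close> by (cases "k = ?x") auto
    show "z \<in> insert (g (Suc ?x)) (g ` K)"
    proof (cases "even k")
      case True
      then show ?thesis using k \<open>?x < k\<close> by (auto simp: K_def)
    next
      case False
      then obtain k' where k': "k = Suc k'" "even k'" by (cases k) auto
      then have "\<not> ?x < k'" using own[of k'] z k by auto
      then have "k' = ?x" using \<open>?x < k\<close> k' by simp
      then show ?thesis using k k' by simp
    qed
  qed
  show "A (g ?x) (g k)" if "even k" "?x < k" "k < ?x + 2 * m"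
  proof (rule ccontr)
    assume n: "\<not> A (g ?x) (g k)"
    have kK: "k \<in> K" using that by (simp add: K_def)
    have "{z. A (g ?x) z} \<subseteq> insert (g (Suc ?x)) (g ` (K - {k}))" using out n by auto
    then have "card {z. A (g ?x) z} \<le> card (insert (g (Suc ?x)) (g ` (K - {k})))"
      by (rule card_mono[rotated]) (simp add: K)
    also have "\<dots> \<le> card (g ` (K - {k})) + 1" by (rule order_trans[OF card_insert_le_m1]) (auto simp: K)
    also have "card (g ` (K - {k})) \<le> card (K - {k})" by (rule card_image_le) (simp add: K)
    also have "card (K - {k}) + 1 = card K" using kK card.remove[of K k] by (simp add: K)
    finally show False using deg_even(1)[of ?x] assms(1) cK m2 by simp
  qed
qed

lemma even_arcs: assumes "even x" "even k" "x < k" "k < x + 2 * m" shows "A (g x) (g k)"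
proof -
  have step: "A (g (i0 + 2 * l)) (g (i0 + 2 * l + 2))" for l
  proof (induction l)
    case (Suc l)
    have "A (g (i0 + 2 * l + 2)) (g (i0 + 2 * l + 2 + 2))"
      by (rule all_even_step[OF _ Suc]) (use i0(1) m2 in auto)
    moreover have "i0 + 2 * Suc l = i0 + 2 * l + 2" by simp
    ultimately show ?case by (simp only:)
  qed (use i0 in simp)
  \<comment> \<open>Whole periods are added to move past \<open>i0 + 2\<close>, where repeated
    double steps from \<open>i0\<close> arrive.\<close>
  define y where "y = x + 2 * m * (i0 + 1)"
  have "2 * m * (i0 + 1) = 2 * (m * i0) + 2 * m" by (simp add: algebra_simps)
  moreover have "i0 \<le> m * i0" using m1 by simp
  ultimately have ge: "i0 + 2 \<le> y" unfolding y_def using m2 by linarith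
  moreover have "even y" using assms(1) by (simp add: y_def)
  ultimately have "even (y - (i0 + 2))" using i0(1) by simp
  then obtain l where "y - (i0 + 2) = 2 * l" by (elim evenE)
  then have l: "y = i0 + 2 * l + 2" using ge by linarith
  have "A (g y) (g (k + 2 * m * (i0 + 1)))"
    unfolding l by (rule all_even_step[OF _ step[of l]]) (use assms i0(1) l y_def in auto)
  moreover have "g y = g x" "g (k + 2 * m * (i0 + 1)) = g k" by (simp_all only: y_def g_eq mod_mult_self2)
  ultimately show ?thesis by simp
qed

lemma even_odd: assumes "even x" "odd k" "x < k" "k < x + 2 * m" shows "A (g x) (g k) \<longleftrightarrow> k = Suc x"
proof (cases "k = Suc x")
  case False
  then obtain i where i: "k = Suc i" "x < i" using assms by (cases k) auto
  have "A (g i) (g (x + 2 * m))" by (rule even_arcs) (use i assms in auto)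
  then show ?thesis using xor_even[of x i] i assms False by (simp add: period)
qed (use arc in simp)

lemma odd_even: assumes "odd k" "even x" "k < x" "x < k + 2 * m" shows "A (g k) (g x) \<longleftrightarrow> x = Suc k"
proof (cases "x = Suc k")
  case False
  have sk: "Suc (k + 2 * m) < x + 2 * m" "x < k + 2 * m" using assms False by auto
  have "A (g x) (g (Suc (k + 2 * m)))" by (rule even_arcs) (use assms sk in auto)
  then show ?thesis using xor_even[of x "k + 2 * m"] sk assms False by (simp add: period)
qed (use arc in simp)

text \<open>The even vertex \<open>g (Suc k)\<close> can be moved between \<open>g (z - 1)\<close>
  and \<open>g (Suc z)\<close>, which repairs the cycle after the chord.\<close>

lemma odd_odd: assumes "odd k" "odd z" "k + 2 < z" "z < k + 2 * m" shows "\<not> A (g k) (g z)"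
proof
  assume kz: "A (g k) (g z)"
  have zk: "k + 4 \<le> z" "z + 2 \<le> k + 2 * m" using assms by presburger+
  have a1: "A (g (z - 1)) (g (Suc k))"
    using even_arcs[of "z - 1" "Suc k + 2 * m"] period[of "Suc k"] zk assms by auto
  have a2: "A (g (Suc k)) (g (Suc z))" using even_arcs[of "Suc k" "Suc z"] zk assms by auto
  have a3: "A (g (k + 2 * m - 1)) (g k)" using arc[of "k + 2 * m - 1"] period[of k] m1 by simp
  show False
    by (rule noham[of "[g k, g z, w] @ sg (k + 2) z @ [g (Suc k)] @ sg (Suc z) (k + 2 * m)" k])
      (use kz a1 a2 a3 zk assms odd_w[of z] odd_w[of "k + 2"] in
        \<open>auto simp: successively_append_iff successively_Cons mem_sg_win[of k] g_win[of k]\<close>)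
qed

text \<open>The only possible out-neighbours are \<open>w\<close>, the next even and the next odd
  vertex. The even vertex at distance 3 is not one of them and has indegree m, so the condition asks
  for m out-neighbours. Hence m <= 3, and m = 3 requires the arc to the next odd vertex.\<close>

lemma out_odd: assumes "odd k"
  shows "m \<le> 2 + (if A (g k) (g (k + 2)) then 1 else 0)"
proof -
  have "{z. A (g k) z} \<subseteq> {w, g (Suc k)} \<union> (if A (g k) (g (k + 2)) then {g (k + 2)} else {})"
  proof
    fix z assume "z \<in> {z. A (g k) z}"
    then have z: "A (g k) z" by simp
    then have "z \<in> V" "z \<noteq> g k" using arcD by auto
    show "z \<in> {w, g (Suc k)} \<union> (if A (g k) (g (k + 2)) then {g (k + 2)} else {})"
    proof (cases "z = w")
      case False
      obtain i where i: "k \<le> i" "i < k + 2 * m" "z = g i" using window[OF \<open>z \<in> V\<close> False] by metis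
      then have "k < i" using \<open>z \<noteq> g k\<close> by (cases "k = i") auto
      show ?thesis
      proof (cases "even i")
        case True
        then show ?thesis using odd_even[OF assms True \<open>k < i\<close> i(2)] z i by auto
      next
        case odd: False
        have "\<not> k + 2 < i" using odd_odd[OF assms odd _ i(2)] z i(3) by blast
        then have "i = k + 2" using odd assms \<open>k < i\<close> by presburger
        then show ?thesis using z i by auto
      qed
    qed simp
  qed
  then have "card {z. A (g k) z} \<le> card ({w, g (Suc k)} \<union> (if A (g k) (g (k + 2)) then {g (k + 2)} else {}))"
    by (rule card_mono[rotated]) auto
  also have "\<dots> \<le> card {w, g (Suc k)} + card (if A (g k) (g (k + 2)) then {g (k + 2)} else {})"
    by (rule card_Un_le)
  also have "card {w, g (Suc k)} = 2" by simp
  finally have "card {z. A (g k) z} \<le> 2 + (if A (g k) (g (k + 2)) then 1 else 0)" by (simp split: if_splits)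
  moreover have "card V \<le> card {z. A (g k) z} + card {z. A z (g (k + 3))} + 1"
    using odd_even[of k "k + 3"] assms m2 g_neq[of k "k + 3"] by (intro ore) auto
  ultimately show ?thesis using deg_even(2)[of "k + 3"] assms card_V by (simp split: if_splits)
qed

lemma class3: assumes "m = 2" shows "class3_digraph V A"
proof -
  have g4: "g 4 = g 0" "g 5 = g 1" "g 6 = g 2" "g 7 = g 3"
    using period[of 0] period[of 1] period[of 2] period[of 3] assms by (simp_all add: numeral_eq_Suc)
  have d: "g 0 \<noteq> g 1" "g 0 \<noteq> g 2" "g 0 \<noteq> g 3" "g 1 \<noteq> g 2" "g 1 \<noteq> g 3" "g 2 \<noteq> g 3"
    using assms by (simp_all add: g_eq)
  have "{..<2 * m} = {0, 1, 2, 3}" using assms by auto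
  then have V: "V = {g 1, g 3, g 0, g 2} \<union> {w}" using V_eq by auto
  have ws: "A w (g 1)" "A w (g 3)" "A (g 1) w" "A (g 3) w" "\<not> A w (g 0)" "\<not> A w (g 2)" "\<not> A (g 0) w" "\<not> A (g 2) w"
    using odd_w[of 1] odd_w[of 3] even_w[of 0] even_w[of 2] by simp_all
  show ?thesis
  proof (rule class3I[OF V])
    show "distinct [g 1, g 3, g 0, g 2]" using d by auto
    show "A x y \<Longrightarrow> x \<in> V \<and> y \<in> V \<and> x \<noteq> y" for x y by (rule arcD)
    show "A (g 0) (g 2)" "A (g 2) (g 0)" using even_arcs[of 0 2] even_arcs[of 2 4] assms g4 by simp_all
    show "A (g 1) (g 2)" "A (g 3) (g 0)" "A (g 0) (g 1)" "A (g 2) (g 3)"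
      using arc[of 0] arc[of 1] arc[of 2] arc[of 3] g4 by (simp_all add: numeral_eq_Suc)
    show "\<not> A (g 1) (g 0)" "\<not> A (g 3) (g 2)" using odd_even[of 1 4] odd_even[of 3 6] assms g4 by simp_all
    show "\<not> A (g 0) (g 3)" "\<not> A (g 2) (g 1)" using even_odd[of 0 3] even_odd[of 2 5] assms g4 by simp_all
  qed (use ws in auto)
qed

text \<open>All arcs are known by parity and distance; \<open>w\<close> becomes \<open>H\<close>,
  odd vertices the labels \<open>C\<close>, even ones the labels \<open>T\<close>.\<close>

lemma class4: assumes "m = 3" shows "class4_digraph V A"
proof -
  have rel: "A (g x) (g (x + d)) \<longleftrightarrow> (if even x then even d \<or> d = 1 else d = 1 \<or> d = 2)" if "0 < d" "d < 6" for x d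
  proof (cases "even x"; cases "even d")
    assume "even x" "even d" then show ?thesis using even_arcs[of x "x + d"] that assms by simp
  next
    assume "even x" "odd d" then show ?thesis using even_odd[of x "x + d"] that assms by simp
  next
    assume x: "odd x" "even d"
    show ?thesis
    proof (cases "d = 2")
      case True
      then show ?thesis using out_odd[OF x(1)] assms x by (simp split: if_splits)
    next
      case False
      then have "2 < d" using x that by (cases "d = 0"; cases "d = 1") auto
      then show ?thesis using odd_odd[of x "x + d"] that assms x by auto
    qed
  next
    assume "odd x" "odd d"
    moreover have "d \<noteq> 2" using \<open>odd d\<close> by auto
    ultimately show ?thesis using odd_even[of x "x + d"] that assms by auto
  qed
  have gs: "A (g i) (g j) \<longleftrightarrow> (if even i then even j \<and> j \<noteq> i \<or> j = (i + 1) mod 6 else j = (i + 1) mod 6 \<or> j = (i + 2) mod 6)"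
    if "i < 6" "j < 6" for i j
  proof -
  have i6: "i = 0 \<or> i = 1 \<or> i = 2 \<or> i = 3 \<or> i = 4 \<or> i = 5" using that by linarith
  have j6: "j = 0 \<or> j = 1 \<or> j = 2 \<or> j = 3 \<or> j = 4 \<or> j = 5" using that by linarith
  show ?thesis
  proof (cases i j rule: linorder_cases)
    case less
    have "(if even i then even (j - i) \<or> j - i = 1 else j - i = 1 \<or> j - i = 2) \<longleftrightarrow>
        (if even i then even j \<and> j \<noteq> i \<or> j = (i + 1) mod 6 else j = (i + 1) mod 6 \<or> j = (i + 2) mod 6)"
      using less i6 j6 by (elim disjE) simp_all
    then show ?thesis using rel[of "j - i" i] less that by simp
  next
    case equal
    have "i \<noteq> (i + 1) mod 6" "i \<noteq> (i + 2) mod 6" using i6 by (elim disjE; simp)+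
    then show ?thesis using equal by simp
  next
    case greater
    have "(if even i then even (j + 6 - i) \<or> j + 6 - i = 1 else j + 6 - i = 1 \<or> j + 6 - i = 2) \<longleftrightarrow>
        (if even i then even j \<and> j \<noteq> i \<or> j = (i + 1) mod 6 else j = (i + 1) mod 6 \<or> j = (i + 2) mod 6)"
      using greater i6 j6 by (elim disjE) simp_all
    then show ?thesis using rel[of "j + 6 - i" i] greater that period[of j] assms by simp
  qed
  qed
  have ws: "A w (g 1)" "A w (g 3)" "A w (g 5)" "A (g 1) w" "A (g 3) w" "A (g 5) w"
    "\<not> A w (g 0)" "\<not> A w (g 2)" "\<not> A w (g 4)" "\<not> A (g 0) w" "\<not> A (g 2) w" "\<not> A (g 4) w"
    using odd_w[of 1] odd_w[of 3] odd_w[of 5] even_w[of 0] even_w[of 2] even_w[of 4] by simp_all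
  define f where "f l = (case l of H \<Rightarrow> w | label.C i \<Rightarrow> g (2 * i - 1) | label.T i \<Rightarrow> g (2 * i - 2))" for l
  have f: "f H = w" "f (label.C 1) = g 1" "f (label.C 2) = g 3" "f (label.C 3) = g 5"
    "f (label.T 1) = g 0" "f (label.T 2) = g 2" "f (label.T 3) = g 4"
    by (simp_all add: f_def)
  have "{..<2 * m} = {0, 1, 2, 3, 4, 5}" using assms by auto
  then have im: "f ` X\<^sub>4 = V" unfolding X\<^sub>4_def V_eq by (auto simp: f[simplified])
  have "card X\<^sub>4 = 7" "finite X\<^sub>4" by (simp_all add: X\<^sub>4_def)
  then have "bij_betw f X\<^sub>4 V"
    using im card_V assms by (auto simp: bij_betw_def intro!: eq_card_imp_inj_on)
  moreover have "\<forall>x\<in>X\<^sub>4. \<forall>y\<in>X\<^sub>4. A (f x) (f y) \<longleftrightarrow> (x, y) \<in> A\<^sub>4"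
    unfolding X\<^sub>4_def A\<^sub>4_def next3_def using ws by (simp add: f[simplified] gs)
  ultimately show ?thesis unfolding class4_digraph_def by blast
qed

lemma class34: "class3_digraph V A \<or> class4_digraph V A"
proof -
  have "m \<le> 3" using out_odd[of 1] by (simp split: if_splits)
  then have "m = 2 \<or> m = 3" using m2 by linarith
  then show ?thesis using class3 class4 by blast
qed

end

lemma (in periodic_cycle) classes: "class2_digraph V A \<or> class3_digraph V A \<or> class4_digraph V A"
proof (cases "\<exists>i j. even i \<and> even j \<and> A (g i) (g j)")
  case True
  then obtain k j where kj: "even k" "even j" "A (g k) (g j)" by blast
  then obtain i where i: "even i" "A (g i) (g (i + 2))" using no_forward by blast
  have "m \<noteq> 1"
  proof
    assume "m = 1"
    then have "g (i + 2) = g i" using period[of i] by simp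
    then show False using i by simp
  qed
  then interpret complete_periodic_cycle V A g m w i
    by unfold_locales (use i m1 in auto)
  show ?thesis using class34 by blast
next
  case False
  then show ?thesis using class2_of_independent by blast
qed

text \<open>\<open>miss\<close> yields a non-neighbour of \<open>w\<close>, where the cycle is
  started. Adjacency to \<open>w\<close> then flips at every step, the closing one included, so the
  length is even.\<close>

lemma (in critical) classes:
  assumes alternating
  shows "class2_digraph V A \<or> class3_digraph V A \<or> class4_digraph V A"
proof -
  obtain c0 w where c0: "cyc c0" "w \<in> V" "set c0 = V - {w}" "\<And>x. x \<in> set c0 \<Longrightarrow> A x w \<longleftrightarrow> A w x"
    using assms unfolding alternating_def by blast
  have ne0: "c0 \<noteq> []" using c0(1) by (simp add: cyc_def)
  have "\<not> A w (hd c0) \<or> \<not> A w (last c0)"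
    using miss[OF c0(1-3)] c0(4)[of "last c0"] c0(4)[of "hd c0"] ne0 by auto
  then obtain z where z: "z \<in> set c0" "\<not> A w z" using ne0 hd_in_set last_in_set by blast
  obtain p r where "c0 = p @ z # r" using z(1) by (meson split_list)
  then have "cyc ((z # r) @ p)" "set ((z # r) @ p) = set c0" using cyc_rotate[of p "z # r"] c0 by auto
  then obtain c where c: "cyc c" "set c = V - {w}" "hd c = z" using c0(3) by (metis append_Cons list.sel(1))
  define L where "L = length c"
  have d: "distinct c" "c \<noteq> []" "successively A c" "A (last c) (hd c)" using c by (auto simp: cyc_def)
  have L0: "0 < L" using d(2) by (simp add: L_def)
  define g where "g i = c ! (i mod L)" for i
  have g_in: "g i \<in> set c" for i using L0 by (simp add: g_def L_def)
  have sym: "A (g i) w \<longleftrightarrow> A w (g i)" for i using c0(3,4) c(2) g_in by auto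
  have arc: "A (g i) (g (Suc i))" for i
    using successively_nth_mod[OF d(3,4,2)] by (simp add: g_def L_def)
  have flip: "A (g i) w \<noteq> A (g (Suc i)) w" for i
    using successively_nth_mod[OF xor_path[OF c(1) c0(2) c(2)] miss[OF c(1) c0(2) c(2)] d(2), of i]
      sym[of "Suc i"] by (simp add: g_def L_def)
  have g0: "g 0 = z" using c(3) d(2) L0 by (simp add: g_def hd_conv_nth)
  have par: "A (g i) w \<longleftrightarrow> odd i" for i
  proof (induction i)
    case 0
    show ?case using z(2) sym[of 0] g0 by simp
  next
    case (Suc i)
    then show ?case using flip[of i] by auto
  qed
  have "g L = g 0" by (simp add: g_def)
  then have "even L" using par[of L] par[of 0] by simp
  then obtain m where m: "L = 2 * m" by (elim evenE)
  have "set c = (!) c ` {..<2 * m}" using m by (auto simp: set_conv_nth L_def)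
  also have "\<dots> = g ` {..<2 * m}" by (rule image_cong) (auto simp: g_def m)
  finally have "set c = g ` {..<2 * m}" .
  then have "V = insert w (g ` {..<2 * m})" using c(2) c0(2) by (metis insert_Diff)
  moreover have "card V = L + 1" using c(2) c0(2) d(1) fin_V unfolding L_def
    by (metis Suc_eq_plus1 card.remove distinct_card)
  ultimately interpret periodic_cycle V A g m w
  proof unfold_locales
    show "1 \<le> m" using L0 m by simp
    show "g (i + 2 * m) = g i" for i by (simp add: g_def m)
    show "even i \<Longrightarrow> \<not> A w (g i) \<and> \<not> A (g i) w" "odd i \<Longrightarrow> A w (g i) \<and> A (g i) w" for i
      using par[of i] sym[of i] by simp_all
  qed (use arc m in simp_all)
  show ?thesis by (rule classes)
qed

theorem (in ore_digraph) ore_digraph_classes: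
  "hamiltonian \<or> class1_digraph V A \<or> class2_digraph V A \<or> class3_digraph V A \<or> class4_digraph V A"
proof (cases "hamiltonian \<or> class1_digraph V A \<or> class3_digraph V A")
  case False
  then interpret critical V A using critical(1) by blast
  obtain c w where "cyc c" "w \<in> V" "set c = V - {w}" using critical(2) False by blast
  then show ?thesis using classes[OF alternating] by blast
qed blast

section \<open>Back to bipartite graphs\<close>

locale matched_bipartite =
  fixes W B :: "'a set" and E M :: "'a set set" and mu :: "'a \<Rightarrow> 'a"
  assumes bip: "bipartite_graph W B E"
    and pm: "perfect_matching (W \<union> B) E M"
    and mu: "bij_betw mu W B"
    and M_eq: "M = {{x, mu x} |x. x \<in> W}"
begin

definition A :: "'a \<Rightarrow> 'a \<Rightarrow> bool" where
  "A x y \<longleftrightarrow> x \<in> W \<and> y \<in> W \<and> x \<noteq> y \<and> {x, mu y} \<in> E"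

lemma fin: "finite W" "finite B" and disj: "W \<inter> B = {}" and EWB: "E \<subseteq> complete_bip W B"
  using bip by (auto simp: bipartite_graph_def)

lemma mu_B [simp]: "x \<in> W \<Longrightarrow> mu x \<in> B" and mu_surj: "mu ` W = B" and inj_mu: "inj_on mu W"
  using mu by (auto simp: bij_betw_def)

lemma mu_eq [simp]: "x \<in> W \<Longrightarrow> y \<in> W \<Longrightarrow> mu x = mu y \<longleftrightarrow> x = y"
  using inj_mu by (auto dest: inj_onD)

lemma mu_W [simp]: "x \<in> W \<Longrightarrow> mu x \<notin> W" "x \<in> W \<Longrightarrow> y \<in> W \<Longrightarrow> mu x \<noteq> y" "x \<in> W \<Longrightarrow> y \<in> W \<Longrightarrow> y \<noteq> mu x"
  using mu_B[of x] disj by auto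

lemma edge_eq [simp]: 
  assumes "x \<in> W" "y \<in> W" "x' \<in> W" "y' \<in> W" shows "{x, mu y} = {x', mu y'} \<longleftrightarrow> x = x' \<and> y = y'"
  using assms by (auto simp: doubleton_eq_iff)

lemma ME: "M \<subseteq> E" using pm by (simp add: perfect_matching_def)

lemma edge_iff: "x \<in> W \<Longrightarrow> y \<in> W \<Longrightarrow> {x, mu y} \<in> E \<longleftrightarrow> x = y \<or> A x y"
  using ME M_eq unfolding A_def by blast

lemma E_eq: "E = {{x, mu y} |x y. x \<in> W \<and> y \<in> W \<and> (x = y \<or> A x y)}"
proof
  show "E \<subseteq> {{x, mu y} |x y. x \<in> W \<and> y \<in> W \<and> (x = y \<or> A x y)}"
  proof
    fix ed assume ed: "ed \<in> E"
    then obtain x b where xb: "ed = {x, b}" "x \<in> W" "b \<in> B" using EWB by (auto simp: complete_bip_def)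
    then obtain y where "y \<in> W" "b = mu y" using mu_surj by auto
    then show "ed \<in> {{x, mu y} |x y. x \<in> W \<and> y \<in> W \<and> (x = y \<or> A x y)}"
      using ed xb edge_iff by blast
  qed
qed (use edge_iff in auto)

lemma edge_M: "x \<in> W \<Longrightarrow> y \<in> W \<Longrightarrow> {x, mu y} \<in> M \<longleftrightarrow> x = y"
proof -
  assume xy: "x \<in> W" "y \<in> W"
  have "\<exists>z. {x, mu y} = {z, mu z} \<and> z \<in> W" if "x = y" using xy that by blast
  moreover have "x = y" if "{x, mu y} = {z, mu z}" "z \<in> W" for z
    using edge_eq[OF xy that(2) that(2)] that(1) by simp
  ultimately show ?thesis unfolding M_eq by blast
qed

lemma degree_W: assumes "x \<in> W" shows "degree E x = card {z. A x z} + 1"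
proof -
  have "{ed \<in> E. x \<in> ed} = (\<lambda>y. {x, mu y}) ` insert x {z. A x z}"
  proof
    show "{ed \<in> E. x \<in> ed} \<subseteq> (\<lambda>y. {x, mu y}) ` insert x {z. A x z}"
    proof
      fix ed assume "ed \<in> {ed \<in> E. x \<in> ed}"
      then obtain x' y where e: "ed = {x', mu y}" "x' \<in> W" "y \<in> W" "x' = y \<or> A x' y" "x \<in> ed"
        by (subst (asm) E_eq) auto
      then have "x = x'" using assms by auto
      then show "ed \<in> (\<lambda>y. {x, mu y}) ` insert x {z. A x z}" using e by auto
    qed
    show "(\<lambda>y. {x, mu y}) ` insert x {z. A x z} \<subseteq> {ed \<in> E. x \<in> ed}"
      using assms edge_iff[of x x] by (auto simp: A_def)
  qed
  moreover have "inj_on (\<lambda>y. {x, mu y}) (insert x {z. A x z})"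
  proof (rule inj_onI)
    fix y y' assume yy: "y \<in> insert x {z. A x z}" "y' \<in> insert x {z. A x z}" "{x, mu y} = {x, mu y'}"
    then have "y \<in> W" "y' \<in> W" using assms by (auto simp: A_def)
    then show "y = y'" using yy(3) edge_eq[OF assms _ assms] by blast
  qed
  moreover have "finite {z. A x z}" using fin by (auto simp: A_def intro: finite_subset[of _ W])
  moreover have "x \<notin> {z. A x z}" by (simp add: A_def)
  ultimately show ?thesis by (simp add: degree_def card_image)
qed

lemma degree_B: assumes "y \<in> W" shows "degree E (mu y) = card {z. A z y} + 1"
proof -
  have "{ed \<in> E. mu y \<in> ed} = (\<lambda>x. {x, mu y}) ` insert y {z. A z y}"
  proof
    show "{ed \<in> E. mu y \<in> ed} \<subseteq> (\<lambda>x. {x, mu y}) ` insert y {z. A z y}"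
    proof
      fix ed assume "ed \<in> {ed \<in> E. mu y \<in> ed}"
      then obtain x y' where e: "ed = {x, mu y'}" "x \<in> W" "y' \<in> W" "x = y' \<or> A x y'" "mu y \<in> ed"
        by (subst (asm) E_eq) auto
      then have "y = y'" using assms by auto
      then show "ed \<in> (\<lambda>x. {x, mu y}) ` insert y {z. A z y}" using e by auto
    qed
    show "(\<lambda>x. {x, mu y}) ` insert y {z. A z y} \<subseteq> {ed \<in> E. mu y \<in> ed}"
      using assms edge_iff[of y y] by (auto simp: A_def)
  qed
  moreover have "inj_on (\<lambda>x. {x, mu y}) (insert y {z. A z y})"
  proof (rule inj_onI)
    fix x x' assume xx: "x \<in> insert y {z. A z y}" "x' \<in> insert y {z. A z y}" "{x, mu y} = {x', mu y}"
    then have "x \<in> W" "x' \<in> W" using assms by (auto simp: A_def)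
    then show "x = x'" using xx(3) edge_eq[OF _ assms _ assms] by blast
  qed
  moreover have "finite {z. A z y}" using fin by (auto simp: A_def intro: finite_subset[of _ W])
  moreover have "y \<notin> {z. A z y}" by (simp add: A_def)
  ultimately show ?thesis by (simp add: degree_def card_image)
qed

lemma card_WB: "card (W \<union> B) = 2 * card W"
  using card_Un_disjoint[OF fin disj] bij_betw_same_card[OF mu] by simp

lemma ore_digraph:
  assumes "card (W \<union> B) > 2"
    and "\<And>w b. w \<in> W \<Longrightarrow> b \<in> B \<Longrightarrow> {w, b} \<notin> E \<Longrightarrow>
           real (degree E w) + real (degree E b) \<ge> real (card (W \<union> B)) / 2 + 1"
  shows "ore_digraph W A"
proof
  fix x y assume xy: "x \<in> W" "y \<in> W" "x \<noteq> y" "\<not> A x y"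
  then have "{x, mu y} \<notin> E" using edge_iff by simp
  from assms(2)[OF xy(1) mu_B[OF xy(2)] this]
  show "card W \<le> card {z. A x z} + card {z. A z y} + 1"
    using xy by (simp add: degree_W degree_B card_WB)
qed (use assms(1) fin card_WB in \<open>auto simp: A_def\<close>)

lemma Hamilton_cycle:
  assumes "ore_digraph W A" "ore_digraph.hamiltonian W A"
  shows "has_alternating_Hamilton_cycle (W \<union> B) E M"
proof -
  interpret ore_digraph W A by fact
  obtain c where c: "cyc c" "set c = W" using assms(2) by (auto simp: hamiltonian_def)
  define n where "n = length c"
  have d: "distinct c" "c \<noteq> []" "successively A c" "A (last c) (hd c)" using c by (auto simp: cyc_def)
  have n: "n = card W" using d(1) c(2) by (simp add: n_def distinct_card[symmetric])
  have n2: "2 \<le> n" using two_le n by simp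
  define v where "v i = c ! (i mod n)" for i
  have v_W: "v i \<in> W" for i using n2 c(2) by (metis v_def n_def nth_mem mod_less_divisor not_numeral_le_zero gr0I)
  have v_arc: "A (v i) (v (Suc i))" for i
    using successively_nth_mod[OF d(3,4,2)] by (simp add: v_def n_def)
  \<comment> \<open>Each vertex is expanded to its black end followed by its white end, so matching
    edges occupy the even positions and arcs the odd ones.\<close>
  define h where "h k = (if even k then mu (v (k div 2)) else v (k div 2))" for k
  have h_mod: "h (k mod (2 * n)) = h k" for k
  proof -
    have "even (k mod (2 * n)) = even k" by (simp add: dvd_mod_iff)
    moreover have "(k mod (2 * n)) div 2 mod n = k div 2 mod n"
      by (simp add: mod_mult2_eq)
    ultimately show ?thesis by (simp add: h_def v_def)
  qed
  define p where "p = map h [0..<2 * n]"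
  have len: "length p = 2 * n" by (simp add: p_def)
  have ce: "cycle_edge p k = {h k, h (Suc k)}" for k
  proof -
    have "p ! (j mod (2 * n)) = h j" for j
      using n2 h_mod[of j] by (simp add: p_def)
    then show ?thesis by (simp add: cycle_edge_def len)
  qed
  have even_M: "cycle_edge p k \<in> M" if "even k" for k
  proof -
    have "{h k, h (Suc k)} = {v (k div 2), mu (v (k div 2))}" using that by (auto simp: h_def)
    then show ?thesis using edge_M v_W ce by simp
  qed
  have odd_E: "cycle_edge p k \<in> E \<and> cycle_edge p k \<notin> M" if "odd k" for k
  proof -
    have k: "{h k, h (Suc k)} = {v (k div 2), mu (v (Suc (k div 2)))}" using that by (auto simp: h_def)
    have a: "A (v (k div 2)) (v (Suc (k div 2)))" by (rule v_arc)
    then have "v (k div 2) \<noteq> v (Suc (k div 2))" by (simp add: A_def)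
    then have "{v (k div 2), mu (v (Suc (k div 2)))} \<notin> M" using edge_M[OF v_W v_W] by simp
    moreover have "{v (k div 2), mu (v (Suc (k div 2)))} \<in> E" using edge_iff[OF v_W v_W] a by simp
    ultimately show ?thesis unfolding ce k by blast
  qed
  have v_inj: "v i = v j \<longleftrightarrow> i = j" if "i < n" "j < n" for i j
    using that d(1) by (simp add: v_def n_def nth_eq_iff_index_eq)
  have "inj_on h {0..<2 * n}"
  proof (rule inj_onI)
    fix i j assume ij: "i \<in> {0..<2 * n}" "j \<in> {0..<2 * n}" "h i = h j"
    have lt: "i div 2 < n" "j div 2 < n" using ij by auto
    have "mu (v a) \<noteq> v b" for a b using mu_W(2)[OF v_W v_W] .
    then have par: "even i = even j" using ij(3) unfolding h_def by metis
    then have "v (i div 2) = v (j div 2)"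
      using ij(3) mu_eq[OF v_W v_W] unfolding h_def by metis
    then have "i div 2 = j div 2" using v_inj[OF lt] by simp
    with par show "i = j" by (metis dvd_mult_div_cancel odd_two_times_div_two_succ)
  qed
  then have dp: "distinct p" by (simp add: p_def distinct_map)
  have "set p = W \<union> B"
  proof
    show "set p \<subseteq> W \<union> B" using v_W by (auto simp: p_def h_def)
    have vs: "x \<in> v ` {0..<n}" if xW: "x \<in> W" for x
    proof -
      obtain i where "i < n" "x = c ! i" using xW c(2) n_def by (metis in_set_conv_nth)
      then show ?thesis by (auto simp: v_def intro!: image_eqI[of _ _ i])
    qed
    show "W \<union> B \<subseteq> set p"
    proof
      fix z assume "z \<in> W \<union> B"
      then consider "z \<in> W" | x where "x \<in> W" "z = mu x" using mu_surj by auto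
      then show "z \<in> set p"
      proof cases
        case 1
        obtain i where "i < n" "z = v i" using vs[OF 1] by auto
        then have "z = h (2 * i + 1)" "2 * i + 1 < 2 * n" by (auto simp: h_def)
        then show ?thesis by (auto simp: p_def intro!: image_eqI[of _ _ "2 * i + 1"])
      next
        case (2 x)
        obtain i where "i < n" "x = v i" using vs[OF 2(1)] by auto
        then have "z = h (2 * i)" "2 * i < 2 * n" using 2 by (auto simp: h_def)
        then show ?thesis by (auto simp: p_def intro!: image_eqI[of _ _ "2 * i"])
      qed
    qed
  qed
  moreover have "cycle_edge p k \<in> E" for k using even_M[of k] odd_E[of k] ME by blast
  then have "is_cycle E p" unfolding is_cycle_def using len n2 dp by simp
  moreover have "\<forall>i<length p. cycle_edge p i \<in> M \<longleftrightarrow> cycle_edge p (Suc i) \<notin> M"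
    using even_M odd_E by (metis even_Suc)
  ultimately show ?thesis unfolding has_alternating_Hamilton_cycle_def alternating_cycle_def by blast
qed

section \<open>The exceptional digraphs translated back\<close>

lemma complete_bip_mu: "X \<subseteq> W \<Longrightarrow> Y \<subseteq> W \<Longrightarrow> complete_bip X (mu ` Y) = {{x, mu y} |x y. x \<in> X \<and> y \<in> Y}"
  by (auto simp: complete_bip_def)

lemma complete_bip_mu': "X \<subseteq> W \<Longrightarrow> Y \<subseteq> W \<Longrightarrow> complete_bip (mu ` Y) X = {{x, mu y} |x y. x \<in> X \<and> y \<in> Y}"
  unfolding complete_bip_def by (auto simp: insert_commute)

lemma Collect_pair_image: "{{x, mu y} |x y. (x, y) \<in> S} = (\<lambda>(x, y). {x, mu y}) ` S"
  by (auto simp: image_def)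

lemma Collect_Times_image: "{{x, mu y} |x y. x \<in> X \<and> y \<in> Y} = (\<lambda>(x, y). {x, mu y}) ` (X \<times> Y)"
  using Collect_pair_image[of "X \<times> Y"] by (simp only: mem_Sigma_iff)

lemma card_mu: "X \<subseteq> W \<Longrightarrow> card (mu ` X) = card X"
  using inj_mu by (meson card_image inj_on_subset)

lemma E_cong: 
  assumes "\<And>x y. x \<in> W \<Longrightarrow> y \<in> W \<Longrightarrow> (x = y \<or> A x y) \<longleftrightarrow> P x y" "\<And>x y. P x y \<Longrightarrow> x \<in> W \<and> y \<in> W"
  shows "E = {{x, mu y} |x y. P x y}"
  by (subst E_eq) (use assms in blast)

lemma class1:
  assumes "class1_digraph W A" shows "class1 (W \<union> B) E M"
proof -
  obtain X Y c where XY: "X \<union> Y = W" "X \<inter> Y = {c}" "X \<noteq> {c}" "Y \<noteq> {c}"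
    "\<And>x y. A x y \<longleftrightarrow> x \<noteq> y \<and> (x \<in> X \<and> y \<in> X \<or> x \<in> Y \<and> y \<in> Y)"
    using assms unfolding class1_digraph_def by blast
  have sub: "X \<subseteq> W" "Y \<subseteq> W" "c \<in> W" using XY by auto
  have fX: "finite X" "finite Y" using sub fin finite_subset by auto
  \<comment> \<open>Each part has at least two vertices, so the class parameter, its size minus 1,
    can be written as a truncated difference plus 1.\<close>
  have cX: "card X = (card X - 2) + 1 + 1" if "finite X" "c \<in> X" "X \<noteq> {c}" for X :: "'a set"
  proof -
    have "{c} \<subset> X" using that by auto
    from psubset_card_mono[OF that(1) this] have "1 < card X" by simp
    then show ?thesis by simp
  qed
  have E: "E = complete_bip X (mu ` X) \<union> complete_bip Y (mu ` Y)"
  proof -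
    have "E = {{x, mu y} |x y. (x \<in> X \<and> y \<in> X) \<or> (x \<in> Y \<and> y \<in> Y)}"
      by (rule E_cong) (use XY(1,5) in auto)
    also have "\<dots> = {{x, mu y} |x y. x \<in> X \<and> y \<in> X} \<union> {{x, mu y} |x y. x \<in> Y \<and> y \<in> Y}"
      unfolding Collect_disj_eq[symmetric] by (intro Collect_cong iffI; elim exE conjE disjE; blast)
    finally show ?thesis using sub by (simp only: complete_bip_mu)
  qed
  have int: "mu ` X \<inter> mu ` Y = {mu c}"
    using inj_on_image_Int[OF inj_mu sub(1,2)] XY(2) by simp
  have mW: "mu ` X \<subseteq> B" "mu ` Y \<subseteq> B" "mu ` X \<union> mu ` Y = B" using sub mu_surj XY(1) by auto
  define k l where "k = card X - 2 + 1" and "l = card Y - 2 + 1"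
  have card: "card X = k + 1" "card Y = l + 1" "1 \<le> k" "1 \<le> l" using cX fX XY unfolding k_def l_def by auto
  have "{c, mu c} \<in> M" using edge_M sub by simp
  moreover have "card (mu ` X) = k + 1" "card (mu ` Y) = l + 1" using card card_mu sub by simp_all
  moreover have "(X \<union> Y) \<inter> (mu ` X \<union> mu ` Y) = {}" using XY(1) mW(3) disj by simp
  moreover have "W \<union> B = X \<union> Y \<union> mu ` X \<union> mu ` Y" using XY(1) mW(3) by (simp add: Un_assoc)
  ultimately show ?thesis unfolding class1_def using XY(2) int E pm card by blast
qed

lemma class2:
  assumes "class2_digraph W A" shows "class2 (W \<union> B) E M"
proof -
  obtain T where T: "T \<subseteq> W" "W - T \<noteq> {}" "card T = card (W - T) + 1"
    "\<And>x y. x \<in> T \<Longrightarrow> y \<in> T \<Longrightarrow> \<not> A x y" "\<And>x y. x \<in> T \<Longrightarrow> y \<in> W - T \<Longrightarrow> A x y \<and> A y x"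
  proof -
    from assms obtain T where "T \<subseteq> W \<and> W - T \<noteq> {} \<and> card T = card (W - T) + 1 \<and>
       (\<forall>x\<in>T. \<forall>y\<in>T. \<not> A x y) \<and> (\<forall>x\<in>T. \<forall>y\<in>W - T. A x y \<and> A y x)"
      unfolding class2_digraph_def by (elim exE)
    then show ?thesis by (elim conjE) (rule that[of T]; (assumption | fast))
  qed
  define S where "S = W - T"
  have S: "S \<subseteq> W" "S \<noteq> {}" "S \<union> T = W" "S \<inter> T = {}" "finite S" using T fin by (auto simp: S_def)
  \<comment> \<open>The class maps black ends to white ends, opposite to \<open>mu\<close>.\<close>
  define f where "f = the_inv_into T mu"
  have injT: "inj_on mu T" using inj_mu T(1) inj_on_subset by blast
  have f: "f (mu x) = x" if "x \<in> T" for x using the_inv_into_f_f[OF injT that] by (simp add: f_def)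
  have fb: "bij_betw f (mu ` T) T" using bij_betw_the_inv_into[of mu T "mu ` T"] injT by (auto simp: f_def bij_betw_def)
  define K where "K = {{b, f b} |b. b \<in> mu ` T}"
  have K: "K = {{x, mu x} |x. x \<in> T}" 
  proof -
    have "K = (\<lambda>b. {b, f b}) ` mu ` T" by (auto simp: K_def)
    also have "\<dots> = (\<lambda>x. {mu x, f (mu x)}) ` T" by (simp add: image_image)
    also have "\<dots> = (\<lambda>x. {x, mu x}) ` T" by (rule image_cong) (auto simp: f)
    finally show ?thesis by auto
  qed
  define E2 where "E2 = {{x, mu y} |x y. x \<in> S \<and> y \<in> S \<and> (x = y \<or> A x y)}"
  \<comment> \<open>The restriction of \<open>M\<close> is the perfect matching demanded of the
    arbitrary part.\<close>
  define M2 where "M2 = {{x, mu x} |x. x \<in> S}"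
  have E: "E = K \<union> E2 \<union> complete_bip (mu ` T) S \<union> complete_bip T (mu ` S)"
  proof -
    have "E = {{x, mu y} |x y. (x = y \<and> x \<in> T) \<or> (x \<in> S \<and> y \<in> S \<and> (x = y \<or> A x y)) \<or> (x \<in> S \<and> y \<in> T) \<or> (x \<in> T \<and> y \<in> S)}"
      by (rule E_cong) (use T S S_def in auto)
    also have "\<dots> = {{x, mu x} |x. x \<in> T} \<union> {{x, mu y} |x y. x \<in> S \<and> y \<in> S \<and> (x = y \<or> A x y)}
        \<union> {{x, mu y} |x y. x \<in> S \<and> y \<in> T} \<union> {{x, mu y} |x y. x \<in> T \<and> y \<in> S}"
      unfolding Collect_disj_eq[symmetric] by (intro Collect_cong iffI; elim exE conjE disjE; blast)
    finally show ?thesis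
      unfolding K E2_def complete_bip_mu[OF T(1) S(1)] complete_bip_mu'[OF S(1) T(1)] .
  qed
  have disjm: "mu ` T \<inter> mu ` S = {}" using inj_on_image_Int[OF inj_mu T(1) S(1)] S(4) by (auto simp: Int_commute)
  have mB: "mu ` T \<subseteq> B" "mu ` S \<subseteq> B" "mu ` T \<union> mu ` S = B" using T S mu_surj by auto
  have bip2: "bipartite_graph (mu ` S) S E2" unfolding bipartite_graph_def
    using S mB disj by (auto simp: E2_def complete_bip_mu'[OF S(1) S(1)])
  have pm2: "perfect_matching (mu ` S \<union> S) E2 M2"
    unfolding perfect_matching_def
  proof (intro conjI ballI)
    show "M2 \<subseteq> E2" by (auto simp: M2_def E2_def)
    fix z assume "z \<in> mu ` S \<union> S"
    then obtain x where x: "x \<in> S" "z = x \<or> z = mu x" by auto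
    show "\<exists>!ed. ed \<in> M2 \<and> z \<in> ed"
    proof (rule ex1I[of _ "{x, mu x}"])
      show "{x, mu x} \<in> M2 \<and> z \<in> {x, mu x}" using x by (auto simp: M2_def)
      fix ed assume "ed \<in> M2 \<and> z \<in> ed"
      then obtain y where "ed = {y, mu y}" "y \<in> S" "z \<in> {y, mu y}" by (auto simp: M2_def)
      moreover have "x \<in> W" "y \<in> W" using x calculation S(1) by auto
      ultimately show "ed = {x, mu x}" using x(2) mu_eq[of x y] mu_W(2)[of x y] mu_W(2)[of y x] by auto
    qed
  qed
  have "K \<subseteq> M" unfolding K M_eq using T(1) by blast
  moreover have "(mu ` T \<union> T) \<inter> (mu ` S \<union> S) = {}" 
  proof -
    have "mu ` T \<inter> S = {}" "T \<inter> mu ` S = {}" using mB(1,2) disj T(1) S(1) by blast+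
    then show ?thesis using disjm S(4) by (simp add: Int_Un_distrib Int_Un_distrib2 Int_commute)
  qed
  moreover have "W \<union> B = mu ` T \<union> T \<union> mu ` S \<union> S" using mB S by blast
  moreover have "mu ` T \<inter> T = {}" using mB disj T(1) by blast
  moreover have "1 \<le> card S" using S by (simp add: Suc_le_eq card_gt_0_iff)
  moreover have "card T = card S + 1" using T by (simp add: S_def)
  ultimately show ?thesis unfolding class2_def
    using fb K_def bip2 pm2 E pm card_mu[OF T(1)] card_mu[OF S(1)]
    by - (rule exI[of _ "card S"], rule exI[of _ "mu ` T"], rule exI[of _ T], rule exI[of _ f], rule exI[of _ K],
      rule exI[of _ "mu ` S"], rule exI[of _ S], rule exI[of _ E2], intro conjI exI[of _ M2]; simp only:)
qed

lemma class3:
  assumes "class3_digraph W A" shows "class3 (W \<union> B) E M"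
proof -
  obtain x0 x1 x2 x3 K where x: "distinct [x0, x1, x2, x3]" "{x0, x1, x2, x3} \<inter> K = {}" "K \<noteq> {}"
    "W = {x0, x1, x2, x3} \<union> K"
    and arcs: "\<And>x y. {x, y} \<noteq> {x0, x1} \<Longrightarrow> A x y \<longleftrightarrow>
        (x, y) \<in> {(x2, x3), (x3, x2), (x0, x3), (x1, x2), (x2, x0), (x3, x1)} \<or>
        x \<in> K \<and> y \<in> K \<and> x \<noteq> y \<or> x \<in> {x0, x1} \<and> y \<in> K \<or> x \<in> K \<and> y \<in> {x0, x1}"
  proof -
    from assms obtain x0 x1 x2 x3 K where D: "distinct [x0, x1, x2, x3] \<and> {x0, x1, x2, x3} \<inter> K = {} \<and> K \<noteq> {} \<and>
        W = {x0, x1, x2, x3} \<union> K \<and> (\<forall>x y. {x, y} \<noteq> {x0, x1} \<longrightarrow> (A x y \<longleftrightarrow>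
          (x, y) \<in> {(x2, x3), (x3, x2), (x0, x3), (x1, x2), (x2, x0), (x3, x1)} \<or>
          x \<in> K \<and> y \<in> K \<and> x \<noteq> y \<or> x \<in> {x0, x1} \<and> y \<in> K \<or> x \<in> K \<and> y \<in> {x0, x1}))"
      unfolding class3_digraph_def by (elim exE)
    note D2 = conjunct2[OF D] and D3 = conjunct2[OF conjunct2[OF D]]
    note D4 = conjunct2[OF D3]
    show ?thesis
      by (rule that[OF conjunct1[OF D] conjunct1[OF D2] conjunct1[OF D3] conjunct1[OF D4]])
        (rule conjunct2[OF D4, rule_format])
  qed
  have xW: "x0 \<in> W" "x1 \<in> W" "x2 \<in> W" "x3 \<in> W" "K \<subseteq> W" using x by auto
  \<comment> \<open>The optional edges are those arcs between \<open>x0\<close> and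
    \<open>x1\<close> that happen to be present.\<close>
  define F' where "F' = {(x, y). x = x0 \<and> y = x1 \<and> A x0 x1 \<or> x = x1 \<and> y = x0 \<and> A x1 x0}"
  define F where "F = (\<lambda>(x, y). {x, mu y}) ` F'"
  define Ps where "Ps = {(x0, x0), (x1, x1), (x2, x2), (x3, x3), (x2, x3), (x3, x2), (x0, x3), (x1, x2), (x2, x0), (x3, x1)}
    \<union> K \<times> K \<union> {x0, x1} \<times> K \<union> K \<times> {x0, x1} \<union> F'"
  define P where "P x y \<longleftrightarrow> (x, y) \<in> Ps" for x y
  have P_iff: "P x y \<longleftrightarrow> (x, y) \<in> {(x0, x0), (x1, x1), (x2, x2), (x3, x3), (x2, x3), (x3, x2), (x0, x3), (x1, x2), (x2, x0), (x3, x1)}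
    \<or> x \<in> K \<and> y \<in> K \<or> x \<in> {x0, x1} \<and> y \<in> K \<or> x \<in> K \<and> y \<in> {x0, x1}
    \<or> x = x0 \<and> y = x1 \<and> A x0 x1 \<or> x = x1 \<and> y = x0 \<and> A x1 x0" for x y
    by (simp only: P_def Ps_def F'_def Un_iff mem_Sigma_iff mem_Collect_eq prod.case disj_assoc)
  have "E = {{x, mu y} |x y. P x y}"
  proof (rule E_cong)
    show "x \<in> W \<and> y \<in> W" if "P x y" for x y using that xW unfolding P_iff by blast
    fix x y assume xy: "x \<in> W" "y \<in> W"
    have d: "x0 \<noteq> x1" "x0 \<notin> K" "x1 \<notin> K" "x2 \<noteq> x0" "x2 \<noteq> x1" "x3 \<noteq> x0" "x3 \<noteq> x1" using x(1,2) by auto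
    have nA: "\<not> A z z" for z by (simp add: A_def)
    show "(x = y \<or> A x y) \<longleftrightarrow> P x y"
    proof (cases "{x, y} = {x0, x1}")
      case True
      then have "x = x0 \<and> y = x1 \<or> x = x1 \<and> y = x0" by (auto simp: doubleton_eq_iff)
      then show ?thesis using d by (auto simp: P_iff)
    next
      case False
      have xc: "x = x0 \<or> x = x1 \<or> x = x2 \<or> x = x3 \<or> x \<in> K" using xy(1) x(4) by auto
      have n: "\<not> (x = x0 \<and> y = x1)" "\<not> (x = x1 \<and> y = x0)" using False by auto
      show ?thesis
      proof (cases "x = y")
        case True
        moreover have "P x x" using xc unfolding P_iff by (elim disjE) simp_all
        ultimately show ?thesis by simp
      next
        case xy: False
        show ?thesis
        proof
          assume "x = y \<or> A x y"
          then have "A x y" using xy by simp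
          then show "P x y" unfolding P_iff arcs[OF False] insert_iff prod.inject empty_iff by argo
        next
          assume "P x y"
          then show "x = y \<or> A x y"
            using xy n unfolding P_iff arcs[OF False] insert_iff prod.inject empty_iff by (elim disjE) simp_all
        qed
      qed
    qed
  qed
  also have "\<dots> = (\<lambda>(x, y). {x, mu y}) ` Ps" unfolding P_def by (rule Collect_pair_image)
  also have "\<dots> = {{x0, mu x0}, {x1, mu x1}, {x2, mu x2}, {x3, mu x3}, {x2, mu x3}, {x3, mu x2},
             {x0, mu x3}, {x1, mu x2}, {x2, mu x0}, {x3, mu x1}}
            \<union> complete_bip (mu ` K) K \<union> complete_bip (mu ` K) {x0, x1} \<union> complete_bip K {mu x0, mu x1} \<union> F"
    using complete_bip_mu'[OF xW(5,5)] complete_bip_mu'[of "{x0, x1}" K] complete_bip_mu[of K "{x0, x1}"] xW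
    by (simp only: Collect_Times_image Ps_def F_def image_Un image_insert image_empty prod.case insert_subset empty_subsetI simp_thms)
  finally have E: "E = {{x0, mu x0}, {x1, mu x1}, {x2, mu x2}, {x3, mu x3}, {x2, mu x3}, {x3, mu x2},
             {x0, mu x3}, {x1, mu x2}, {x2, mu x0}, {x3, mu x1}}
            \<union> complete_bip (mu ` K) K \<union> complete_bip (mu ` K) {x0, x1} \<union> complete_bip K {mu x0, mu x1} \<union> F" .
  have fK: "finite K" using xW(5) fin finite_subset by blast
  have K: "1 \<le> card K" "card (mu ` K) = card K" using x(3) fK card_mu[OF xW(5)] by (simp_all add: Suc_le_eq card_gt_0_iff)
  have muK: "mu z \<notin> mu ` K" if "z \<in> W" "z \<notin> K" for z
    using that inj_on_image_mem_iff[OF inj_mu that(1) xW(5)] by simp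
  have BK: "mu ` K \<subseteq> B" using xW(5) mu_surj by auto
  have xB: "x0 \<notin> B" "x1 \<notin> B" "x2 \<notin> B" "x3 \<notin> B" using xW disj by auto
  have "distinct [x0, x1, x2, x3, mu x0, mu x1, mu x2, mu x3]"
    using x(1) xW by simp
  moreover have "mu ` K \<inter> K = {}" using BK disj xW(5) by blast
  moreover have "{x0, x1, x2, x3, mu x0, mu x1, mu x2, mu x3} \<inter> (mu ` K \<union> K) = {}"
  proof -
    have "x0 \<notin> mu ` K" "x1 \<notin> mu ` K" "x2 \<notin> mu ` K" "x3 \<notin> mu ` K" using BK xB by blast+
    moreover have "x0 \<notin> K" "x1 \<notin> K" "x2 \<notin> K" "x3 \<notin> K" using x(2) by auto
    moreover have "mu x0 \<notin> K" "mu x1 \<notin> K" "mu x2 \<notin> K" "mu x3 \<notin> K" using xW mu_W(1) by blast+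
    ultimately show ?thesis using muK xW(1-4) by simp
  qed
  moreover have "F \<subseteq> {{x0, mu x1}, {x1, mu x0}}" unfolding F_def F'_def by auto
  moreover have "W \<union> B = {x0, x1, x2, x3, mu x0, mu x1, mu x2, mu x3} \<union> mu ` K \<union> K"
    using x(4) mu_surj by auto
  moreover have "{{x0, mu x0}, {x1, mu x1}, {x2, mu x2}, {x3, mu x3}} \<subseteq> M"
    using xW edge_M by simp
  ultimately show ?thesis unfolding class3_def
    using pm E K
    by - (rule exI[of _ "card K"], rule exI[of _ x0], rule exI[of _ x1], rule exI[of _ x2], rule exI[of _ x3],
      rule exI[of _ "mu x0"], rule exI[of _ "mu x1"], rule exI[of _ "mu x2"], rule exI[of _ "mu x3"],
      rule exI[of _ "mu ` K"], rule exI[of _ K], rule exI[of _ F], intro conjI; (assumption | rule refl))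
qed

lemma class4:
  assumes "class4_digraph W A" shows "matched_graph_iso (W \<union> B) E M V\<^sub>4 E\<^sub>4 M\<^sub>4"
proof -
  obtain f where f: "bij_betw f X\<^sub>4 W" "\<And>x y. x \<in> X\<^sub>4 \<Longrightarrow> y \<in> X\<^sub>4 \<Longrightarrow> A (f x) (f y) \<longleftrightarrow> (x, y) \<in> A\<^sub>4"
    using assms unfolding class4_digraph_def by blast
  define g where "g = the_inv_into X\<^sub>4 f"
  have inj_f: "inj_on f X\<^sub>4" and im_f: "f ` X\<^sub>4 = W" using f(1) by (auto simp: bij_betw_def)
  have gf: "g (f x) = x" if "x \<in> X\<^sub>4" for x using the_inv_into_f_f[OF inj_f that] by (simp add: g_def)
  define i where "i = the_inv_into W mu"
  have imu: "i (mu x) = x" if "x \<in> W" for x using the_inv_into_f_f[OF inj_mu that] by (simp add: i_def)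
  define h where "h v = (if v \<in> W then Inl (g v) else Inr (g (i v)))" for v
  have fW: "f x \<in> W" if "x \<in> X\<^sub>4" for x using im_f that by blast
  have hf: "h (f x) = Inl x" "h (mu (f x)) = Inr x" if "x \<in> X\<^sub>4" for x
    using that fW[OF that] gf imu by (simp_all add: h_def)
  have WB: "W \<union> B = f ` X\<^sub>4 \<union> mu ` f ` X\<^sub>4" using im_f mu_surj by simp
  have him: "h ` (W \<union> B) = V\<^sub>4" unfolding WB V\<^sub>4_def by (simp add: image_Un image_image hf cong: image_cong)
  have cX: "card W = card X\<^sub>4" using bij_betw_same_card[OF f(1)] by simp
  have finX: "finite X\<^sub>4" by (simp add: X\<^sub>4_def)
  have "card V\<^sub>4 = 2 * card X\<^sub>4"
    unfolding V\<^sub>4_def using finX by (subst card_Un_disjoint) (auto simp: card_image)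
  then have "inj_on h (W \<union> B)" using him card_WB cX fin by (intro eq_card_imp_inj_on) simp_all
  with him have "bij_betw h (W \<union> B) V\<^sub>4" by (simp add: bij_betw_def)
  moreover have "(`) h ` M = M\<^sub>4"
  proof -
    have "M = (\<lambda>x. {f x, mu (f x)}) ` X\<^sub>4" 
      by (simp only: M_eq im_f[symmetric] Setcompr_eq_image image_image)
    then have "(`) h ` M = (\<lambda>x. h ` {f x, mu (f x)}) ` X\<^sub>4" by (simp only: image_image)
    also have "\<dots> = (\<lambda>x. {Inl x, Inr x}) ` X\<^sub>4" by (rule image_cong) (simp_all add: hf)
    finally show ?thesis by (simp only: M\<^sub>4_def Setcompr_eq_image)
  qed
  moreover have "(`) h ` E = E\<^sub>4"
  proof -
    have A4: "x \<in> X\<^sub>4 \<and> y \<in> X\<^sub>4" if "(x, y) \<in> A\<^sub>4" for x y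
      using that unfolding A\<^sub>4_def X\<^sub>4_def next3_def by auto
    have "E = (\<lambda>(x, y). {f x, mu (f y)}) ` {(x, y). x \<in> X\<^sub>4 \<and> y \<in> X\<^sub>4 \<and> (x = y \<or> (x, y) \<in> A\<^sub>4)}"
    proof -
      have "E = {{x, mu y} |x y. \<exists>x' y'. x = f x' \<and> y = f y' \<and> x' \<in> X\<^sub>4 \<and> y' \<in> X\<^sub>4 \<and> (x' = y' \<or> (x', y') \<in> A\<^sub>4)}"
      proof (rule E_cong)
        fix x y assume "x \<in> W" "y \<in> W"
        then obtain x' y' where xy: "x = f x'" "x' \<in> X\<^sub>4" "y = f y'" "y' \<in> X\<^sub>4" using im_f by blast
        have "x' = x''" if "f x' = f x''" "x'' \<in> X\<^sub>4" for x'' using that gf xy(2) by metis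
        moreover have "y' = y''" if "f y' = f y''" "y'' \<in> X\<^sub>4" for y'' using that gf xy(4) by metis
        ultimately show "(x = y \<or> A x y) \<longleftrightarrow> (\<exists>x' y'. x = f x' \<and> y = f y' \<and> x' \<in> X\<^sub>4 \<and> y' \<in> X\<^sub>4 \<and> (x' = y' \<or> (x', y') \<in> A\<^sub>4))"
          unfolding xy(1,3) using f(2)[OF xy(2,4)] xy(2,4) by metis
      qed (use fW in blast)
      also have "\<dots> = (\<lambda>(x, y). {f x, mu (f y)}) ` {(x, y). x \<in> X\<^sub>4 \<and> y \<in> X\<^sub>4 \<and> (x = y \<or> (x, y) \<in> A\<^sub>4)}" (is "?L = ?R")
      proof (intro equalityI subsetI)
        fix ed assume "ed \<in> ?L"
        then obtain x y where "ed = {f x, mu (f y)}" "x \<in> X\<^sub>4" "y \<in> X\<^sub>4" "x = y \<or> (x, y) \<in> A\<^sub>4" by fast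
        then show "ed \<in> ?R" by (intro image_eqI[of _ _ "(x, y)"]) simp_all
      next
        fix ed assume "ed \<in> ?R"
        then obtain x y where "ed = {f x, mu (f y)}" "x \<in> X\<^sub>4" "y \<in> X\<^sub>4" "x = y \<or> (x, y) \<in> A\<^sub>4" by auto
        then show "ed \<in> ?L" by fast
      qed
      finally show ?thesis .
    qed
    then have "(`) h ` E = (\<lambda>(x, y). h ` {f x, mu (f y)}) ` {(x, y). x \<in> X\<^sub>4 \<and> y \<in> X\<^sub>4 \<and> (x = y \<or> (x, y) \<in> A\<^sub>4)}"
      by (simp add: image_image case_prod_beta)
    also have "\<dots> = (\<lambda>(x, y). {Inl x, Inr y}) ` {(x, y). x \<in> X\<^sub>4 \<and> y \<in> X\<^sub>4 \<and> (x = y \<or> (x, y) \<in> A\<^sub>4)}"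
      by (rule image_cong) (auto simp: hf)
    also have "\<dots> = E\<^sub>4" unfolding E\<^sub>4_def M\<^sub>4_def using A4 by (auto simp: image_def)
    finally show ?thesis .
  qed
  ultimately show ?thesis unfolding matched_graph_iso_def by blast
qed

end

section \<open>Perfect matchings as bijections, and the conclusion\<close>

lemma ex_matched_bipartite:
  assumes "bipartite_graph W B E" "perfect_matching (W \<union> B) E M"
  shows "\<exists>mu. matched_bipartite W B E M mu"
proof -
  have disj: "W \<inter> B = {}" and E: "E \<subseteq> complete_bip W B" using assms(1) by (auto simp: bipartite_graph_def)
  have ME: "M \<subseteq> E" and uniq: "\<And>v. v \<in> W \<union> B \<Longrightarrow> \<exists>!e. e \<in> M \<and> v \<in> e"
    using assms(2) by (auto simp: perfect_matching_def)
  have uniq2: "e = e'" if "v \<in> W \<union> B" "e \<in> M" "v \<in> e" "e' \<in> M" "v \<in> e'" for v e e'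
    using uniq[OF that(1)] that(2-) by metis
  have form: "\<exists>x b. e = {x, b} \<and> x \<in> W \<and> b \<in> B" if "e \<in> M" for e
    using that ME E by (auto simp: complete_bip_def)
  have "\<exists>b. b \<in> B \<and> {x, b} \<in> M" if xW: "x \<in> W" for x
  proof -
    obtain e where e: "e \<in> M" "x \<in> e" using uniq[of x] xW by blast
    then obtain x' b where "e = {x', b}" "x' \<in> W" "b \<in> B" using form by blast
    moreover have "x = x'" using calculation e(2) xW disj by auto
    ultimately show ?thesis using e by blast
  qed
  then obtain mu where mu: "\<And>x. x \<in> W \<Longrightarrow> mu x \<in> B \<and> {x, mu x} \<in> M" by metis
  have det: "b = mu x" if "{x, b} \<in> M" "x \<in> W" "b \<in> B" for x b
  proof -
    have "{x, b} = {x, mu x}" by (rule uniq2[of x]) (use that mu[of x] in auto)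
    then show ?thesis by (auto simp: doubleton_eq_iff)
  qed
  have "inj_on mu W"
  proof (rule inj_onI)
    fix x y assume xy: "x \<in> W" "y \<in> W" "mu x = mu y"
    have "{x, mu x} = {y, mu x}" by (rule uniq2[of "mu x"]) (use xy mu[of x] mu[of y] in auto)
    then show "x = y" by (auto simp: doubleton_eq_iff)
  qed
  moreover have "mu ` W = B"
  proof
    show "mu ` W \<subseteq> B" using mu by blast
    show "B \<subseteq> mu ` W"
    proof
      fix b assume b: "b \<in> B"
      obtain e where e: "e \<in> M" "b \<in> e" using uniq[of b] b by blast
      then obtain x b' where "e = {x, b'}" "x \<in> W" "b' \<in> B" using form by blast
      moreover have "b = b'" using calculation e(2) b disj by auto
      ultimately show "b \<in> mu ` W" using det[of x b] e by blast
    qed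
  qed
  moreover have "M = {{x, mu x} |x. x \<in> W}"
  proof
    show "M \<subseteq> {{x, mu x} |x. x \<in> W}"
    proof
      fix e assume e: "e \<in> M"
      then obtain x b where "e = {x, b}" "x \<in> W" "b \<in> B" using form by blast
      then show "e \<in> {{x, mu x} |x. x \<in> W}" using det[of x b] e by blast
    qed
  qed (use mu in blast)
  ultimately have "matched_bipartite W B E M mu"
    using assms by unfold_locales (auto simp: bij_betw_def)
  then show ?thesis by blast
qed

theorem theorem3p2:
  fixes W B :: "'a set" and E M :: "'a set set"
  assumes "bipartite_graph W B E"
    and "connected_graph (W \<union> B) E"
    and "card (W \<union> B) > 2"
    and "perfect_matching (W \<union> B) E M"
    and "\<And>w b. w \<in> W \<Longrightarrow> b \<in> B \<Longrightarrow> {w, b} \<notin> E \<Longrightarrow>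
           real (degree E w) + real (degree E b) \<ge> real (card (W \<union> B)) / 2 + 1"
  shows "has_alternating_Hamilton_cycle (W \<union> B) E M
    \<or> class1 (W \<union> B) E M
    \<or> class2 (W \<union> B) E M
    \<or> class3 (W \<union> B) E M
    \<or> matched_graph_iso (W \<union> B) E M V\<^sub>4 E\<^sub>4 M\<^sub>4"
proof -
  obtain mu where "matched_bipartite W B E M mu" using ex_matched_bipartite[OF assms(1,4)] by blast
  then interpret matched_bipartite W B E M mu .
  have ore: "ore_digraph W A" by (rule ore_digraph[OF assms(3,5)])
  from ore_digraph.ore_digraph_classes[OF ore] show ?thesis
    using Hamilton_cycle[OF ore] class1 class2 class3 class4 by blast
qed

end
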